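(* Fix $s<0$. There does not exist a $T>0$ such that the equation $$u_t+u_x+uu_x+\mathcal{H}u_{xt}=0,\qquad x\in\mathbb{R},$$ admits, for initial data $u(x,0)=\phi(x)$, a unique local solution defined on the interval $[-T,T]$ and such that the flow map (data-to-solution map) $$\phi\longmapsto u(t),\qquad t\in[-T,T],$$ is $C^2$ differentiable at zero from $H^s(\mathbb{R})$ to $H^s(\mathbb{R})$.
   Context: $H^s(\mathbb{R})$ is the usual $L^2$-based Sobolev space on the real line. $\mathcal{H}$ is the Hilbert transform $\widehat{\mathcal{H}f}(\xi)=-i\,\mathrm{sgn}(\xi)\widehat f(\xi)$. Solutions with datum $\phi$ are understood through the Duhamel formula $$u(t)=S(t)\phi-\int_0^tS(t-\tau)\Lambda[u(\tau)u_x(\tau)]\,d\tau,$$ where $\widehat{S(t)\phi}(\xi)=e^{-\frac{i\xi}{1+|\xi|}t}\widehat\phi(\xi)$ and $\widehat{\Lambda u}(\xi)=(1+|\xi|)^{-1}\widehat u(\xi)$. *)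

theory Defs
  imports "HOL-Analysis.Analysis"
begin

section \<open>Schwartz functions and tempered distributions on the real line\<close>

definition vderiv :: "(real \<Rightarrow> complex) \<Rightarrow> real \<Rightarrow> complex" where
  "vderiv f = (\<lambda>x. vector_derivative f (at x))"

definition schwartz :: "(real \<Rightarrow> complex) set" where
  "schwartz = {\<psi>. \<forall>k. (\<forall>x. (vderiv ^^ k) \<psi> differentiable (at x)) \<and>
                    (\<forall>j. bounded (range (\<lambda>x. x ^ j *\<^sub>R (vderiv ^^ k) \<psi> x)))}"

definition schwartz_seminorm :: "nat \<Rightarrow> (real \<Rightarrow> complex) \<Rightarrow> real" where
  "schwartz_seminorm N \<psi> =
     (\<Sum>j\<le>N. \<Sum>k\<le>N. (SUP x. norm (x ^ j *\<^sub>R (vderiv ^^ k) \<psi> x)))"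

lemma schwartz_seminorm_mono:
  assumes "\<psi> \<in> schwartz" "M \<le> N"
  shows "schwartz_seminorm M \<psi> \<le> schwartz_seminorm N \<psi>"
proof -
  have nn: "0 \<le> (SUP x. norm (x ^ j *\<^sub>R (vderiv ^^ k) \<psi> x))" for j k
  proof -
    have "bounded (range (\<lambda>x. x ^ j *\<^sub>R (vderiv ^^ k) \<psi> x))"
      using assms(1) by (simp add: schwartz_def)
    then obtain b where "\<And>x. norm (x ^ j *\<^sub>R (vderiv ^^ k) \<psi> x) \<le> b"
      unfolding bounded_iff by blast
    then have "bdd_above (range (\<lambda>x. norm (x ^ j *\<^sub>R (vderiv ^^ k) \<psi> x)))"
      by (auto intro!: bdd_aboveI)
    then have "norm (0 ^ j *\<^sub>R (vderiv ^^ k) \<psi> 0) \<le> (SUP x. norm (x ^ j *\<^sub>R (vderiv ^^ k) \<psi> x))"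
      by (rule cSUP_upper[OF UNIV_I])
    then show ?thesis
      using norm_ge_zero order_trans by blast
  qed
  have "schwartz_seminorm M \<psi> \<le>
      (\<Sum>j\<le>M. \<Sum>k\<le>N. (SUP x. norm (x ^ j *\<^sub>R (vderiv ^^ k) \<psi> x)))"
    unfolding schwartz_seminorm_def
    by (intro sum_mono sum_mono2) (use assms(2) nn in auto)
  also have "\<dots> \<le> schwartz_seminorm N \<psi>"
    unfolding schwartz_seminorm_def
    by (intro sum_mono2) (use assms(2) nn in \<open>auto intro!: sum_nonneg\<close>)
  finally show ?thesis .
qed

text \<open>Tempered distributions are the continuous complex-linear functionals on the Schwartz space.
  Off the Schwartz space the representing function is set to 0, so that equality of
  distributions is equality on Schwartz functions.\<close>

definition tempered :: "((real \<Rightarrow> complex) \<Rightarrow> complex) \<Rightarrow> bool" where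
  "tempered L \<longleftrightarrow>
     (\<forall>\<psi>. \<psi> \<notin> schwartz \<longrightarrow> L \<psi> = 0) \<and>
     (\<forall>\<psi>\<in>schwartz. \<forall>\<phi>\<in>schwartz. L (\<lambda>x. \<psi> x + \<phi> x) = L \<psi> + L \<phi>) \<and>
     (\<forall>\<psi>\<in>schwartz. \<forall>c. L (\<lambda>x. c * \<psi> x) = c * L \<psi>) \<and>
     (\<exists>C N. \<forall>\<psi>\<in>schwartz. norm (L \<psi>) \<le> C * schwartz_seminorm N \<psi>)"

typedef tdist = "{L. tempered L}"
  morphisms tapply Abs_tdist
proof
  show "(\<lambda>\<psi>. 0) \<in> {L. tempered L}"
    by (auto simp: tempered_def intro!: exI[of _ 0])
qed

lemma tempered_add:
  assumes "tempered L" "tempered M"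
  shows "tempered (\<lambda>\<psi>. L \<psi> + M \<psi>)"
proof -
  obtain C1 N1 where 1: "\<And>\<psi>. \<psi> \<in> schwartz \<Longrightarrow> norm (L \<psi>) \<le> C1 * schwartz_seminorm N1 \<psi>"
    using assms(1) unfolding tempered_def by blast
  obtain C2 N2 where 2: "\<And>\<psi>. \<psi> \<in> schwartz \<Longrightarrow> norm (M \<psi>) \<le> C2 * schwartz_seminorm N2 \<psi>"
    using assms(2) unfolding tempered_def by blast
  have bound: "norm (L \<psi> + M \<psi>) \<le> (\<bar>C1\<bar> + \<bar>C2\<bar>) * schwartz_seminorm (max N1 N2) \<psi>"
    if \<psi>: "\<psi> \<in> schwartz" for \<psi>
  proof -
    let ?p = "schwartz_seminorm (max N1 N2) \<psi>"
    have mono: "schwartz_seminorm N1 \<psi> \<le> ?p" "schwartz_seminorm N2 \<psi> \<le> ?p"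
      using schwartz_seminorm_mono[OF \<psi>] by auto
    have *: "C * schwartz_seminorm N \<psi> \<le> \<bar>C\<bar> * ?p"
      if le: "schwartz_seminorm N \<psi> \<le> ?p" and nn: "0 \<le> schwartz_seminorm N \<psi>" for C N
      by (rule mult_mono) (use le nn in auto)
    have nn: "0 \<le> schwartz_seminorm N \<psi>" for N
    proof -
      have "0 \<le> schwartz_seminorm 0 \<psi>"
      proof -
        have "bounded (range (\<lambda>x. x ^ 0 *\<^sub>R (vderiv ^^ 0) \<psi> x))"
          using \<psi> unfolding schwartz_def by blast
        then obtain b where "\<And>x. norm (\<psi> x) \<le> b"
          unfolding bounded_iff by auto
        then have "bdd_above (range (\<lambda>x. norm (\<psi> x)))"
          by (auto intro!: bdd_aboveI)
        then have "norm (\<psi> 0) \<le> (SUP x. norm (\<psi> x))"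
          by (rule cSUP_upper[OF UNIV_I])
        then have "0 \<le> (SUP x. norm (\<psi> x))"
          using norm_ge_zero order_trans by blast
        then show ?thesis by (simp add: schwartz_seminorm_def)
      qed
      then show ?thesis
        using schwartz_seminorm_mono[OF \<psi>, of 0 N] by simp
    qed
    have "norm (L \<psi> + M \<psi>) \<le> norm (L \<psi>) + norm (M \<psi>)"
      by (rule norm_triangle_ineq)
    also have "\<dots> \<le> \<bar>C1\<bar> * ?p + \<bar>C2\<bar> * ?p"
      using 1[OF \<psi>] 2[OF \<psi>] *[of N1 C1] *[of N2 C2] mono nn
        norm_ge_zero[of "L \<psi>"] norm_ge_zero[of "M \<psi>"] by (smt (verit))
    finally show ?thesis by (simp add: algebra_simps)
  qed
  show ?thesis
    using assms bound unfolding tempered_def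
    by (auto simp: algebra_simps intro!: exI[of _ "\<bar>C1\<bar> + \<bar>C2\<bar>"] exI[of _ "max N1 N2"])
qed

lemma tempered_scale:
  assumes "tempered L"
  shows "tempered (\<lambda>\<psi>. c *\<^sub>R L \<psi>)"
proof -
  obtain C N where 1: "\<And>\<psi>. \<psi> \<in> schwartz \<Longrightarrow> norm (L \<psi>) \<le> C * schwartz_seminorm N \<psi>"
    using assms unfolding tempered_def by blast
  have "norm (c *\<^sub>R L \<psi>) \<le> (\<bar>c\<bar> * C) * schwartz_seminorm N \<psi>" if "\<psi> \<in> schwartz" for \<psi>
    using mult_left_mono[OF 1[OF that], of "\<bar>c\<bar>"] by (simp add: mult.assoc)
  then have "\<exists>C N. \<forall>\<psi>\<in>schwartz. norm (c *\<^sub>R L \<psi>) \<le> C * schwartz_seminorm N \<psi>"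
    by blast
  then show ?thesis
    using assms unfolding tempered_def by (auto simp: algebra_simps)
qed

setup_lifting type_definition_tdist

instantiation tdist :: real_vector
begin

lift_definition zero_tdist :: tdist is "\<lambda>\<psi>. 0"
  by (auto simp: tempered_def intro!: exI[of _ 0])

lift_definition plus_tdist :: "tdist \<Rightarrow> tdist \<Rightarrow> tdist" is "\<lambda>L M \<psi>. L \<psi> + M \<psi>"
  by (rule tempered_add)

lift_definition scaleR_tdist :: "real \<Rightarrow> tdist \<Rightarrow> tdist" is "\<lambda>c L \<psi>. c *\<^sub>R L \<psi>"
  by (rule tempered_scale)

lift_definition uminus_tdist :: "tdist \<Rightarrow> tdist" is "\<lambda>L \<psi>. - L \<psi>"
  using tempered_scale[of _ "-1"] by simp

lift_definition minus_tdist :: "tdist \<Rightarrow> tdist \<Rightarrow> tdist" is "\<lambda>L M \<psi>. L \<psi> - M \<psi>"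
  using tempered_add[OF _ tempered_scale[of _ "-1"]] by simp

instance
  by standard (transfer; auto simp: algebra_simps fun_eq_iff)+

end

definition tdist_of_fun :: "(real \<Rightarrow> complex) \<Rightarrow> tdist" where
  "tdist_of_fun f =
     Abs_tdist (\<lambda>\<psi>. if \<psi> \<in> schwartz then (LINT x|lborel. f x * \<psi> x) else 0)"


section \<open>Fourier transform and Sobolev spaces\<close>

definition fourier :: "(real \<Rightarrow> complex) \<Rightarrow> real \<Rightarrow> complex" where
  "fourier f \<xi> = (LINT x|lborel. cis (- (\<xi> * x)) * f x)"

definition inv_fourier :: "(real \<Rightarrow> complex) \<Rightarrow> real \<Rightarrow> complex" where
  "inv_fourier g x = (LINT \<xi>|lborel. cis (\<xi> * x) * g \<xi>) / (2 * pi)"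

text \<open>The distributional Fourier transform of \<open>u\<close>, characterised by duality
  (its pairing with \<open>\<psi>\<close> is the pairing of \<open>u\<close> with the Fourier transform of \<open>\<psi>\<close>),
  is the function \<open>g\<close>.\<close>

definition has_fourier :: "tdist \<Rightarrow> (real \<Rightarrow> complex) \<Rightarrow> bool" where
  "has_fourier u g \<longleftrightarrow>
     g \<in> borel_measurable borel \<and>
     (\<forall>\<psi>\<in>schwartz. integrable lborel (\<lambda>\<xi>. g \<xi> * \<psi> \<xi>) \<and>
        tapply u (fourier \<psi>) = (LINT \<xi>|lborel. g \<xi> * \<psi> \<xi>))"

text \<open>The function \<open>fhat u\<close> is determined up to a null set whenever it exists.\<close>

definition fhat :: "tdist \<Rightarrow> real \<Rightarrow> complex" where
  "fhat u = (SOME g. has_fourier u g)"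

definition Hs :: "real \<Rightarrow> tdist set" where
  "Hs s = {u. \<exists>g. has_fourier u g \<and>
              integrable lborel (\<lambda>\<xi>. (1 + \<xi>\<^sup>2) powr s * (cmod (g \<xi>))\<^sup>2)}"

definition Hs_norm :: "real \<Rightarrow> tdist \<Rightarrow> real" where
  "Hs_norm s u = sqrt (LINT \<xi>|lborel. (1 + \<xi>\<^sup>2) powr s * (cmod (fhat u \<xi>))\<^sup>2)"

definition Hs_real :: "real \<Rightarrow> tdist set" where
  "Hs_real s = {u \<in> Hs s. \<forall>\<psi>\<in>schwartz. (\<forall>x. \<psi> x \<in> \<real>) \<longrightarrow> tapply u \<psi> \<in> \<real>}"

definition fourier_mult :: "(real \<Rightarrow> complex) \<Rightarrow> tdist \<Rightarrow> tdist" where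
  "fourier_mult m u = (THE v. has_fourier v (\<lambda>\<xi>. m \<xi> * fhat u \<xi>))"


section \<open>The equation in Duhamel form\<close>

text \<open>The operator acting on \<open>u\<^sub>t\<close> in \<open>u\<^sub>t + u\<^sub>x + u u\<^sub>x + H u\<^sub>x\<^sub>t = 0\<close>, with \<open>H\<close> the Hilbert
  transform, has symbol \<open>1 + (- \<i> sgn \<xi>) (\<i> \<xi>) = 1 + \<bar>\<xi>\<bar>\<close>; its inverse is \<open>Lam\<close>.\<close>

definition Sgrp :: "real \<Rightarrow> tdist \<Rightarrow> tdist" where
  "Sgrp t = fourier_mult (\<lambda>\<xi>. cis (- (\<xi> / (1 + \<bar>\<xi>\<bar>) * t)))"

definition Lam :: "tdist \<Rightarrow> tdist" where
  "Lam = fourier_mult (\<lambda>\<xi>. complex_of_real (1 / (1 + \<bar>\<xi>\<bar>)))"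

text \<open>For \<open>s < 0\<close> the product \<open>u u\<^sub>x\<close> of elements of \<open>Hs s\<close> has no pointwise-in-time meaning in
  general.  The Duhamel integral of \<open>u u\<^sub>x\<close> is taken in the extended sense of M. Christ: \<open>u\<close> is
  replaced by its Fourier truncations, which are smooth functions, and the resulting integrals
  are required to converge, in the sense of tempered distributions and to the same limit for
  all truncating sequences.\<close>

definition fourier_cutoffs :: "(nat \<Rightarrow> real \<Rightarrow> complex) \<Rightarrow> bool" where
  "fourier_cutoffs m \<longleftrightarrow>
     (\<forall>n. m n \<in> borel_measurable borel) \<and>
     (\<forall>n. \<exists>R. \<forall>\<xi>. R < \<bar>\<xi>\<bar> \<longrightarrow> m n \<xi> = 0) \<and>
     (\<exists>C. \<forall>n \<xi>. cmod (m n \<xi>) \<le> C) \<and>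
     (\<forall>\<xi>. (\<lambda>n. m n \<xi>) \<longlonglongrightarrow> 1)"

definition truncate :: "(real \<Rightarrow> complex) \<Rightarrow> tdist \<Rightarrow> real \<Rightarrow> complex" where
  "truncate m u = inv_fourier (\<lambda>\<xi>. m \<xi> * fhat u \<xi>)"

definition truncated_uux :: "(real \<Rightarrow> complex) \<Rightarrow> tdist \<Rightarrow> tdist" where
  "truncated_uux m u = tdist_of_fun (\<lambda>x. truncate m u x * vderiv (truncate m u) x)"

definition has_duhamel_integral :: "(real \<Rightarrow> tdist) \<Rightarrow> real \<Rightarrow> tdist \<Rightarrow> bool" where
  "has_duhamel_integral u t v \<longleftrightarrow>
     (\<forall>m. fourier_cutoffs m \<longrightarrow>
       (\<forall>\<psi>\<in>schwartz.
         (\<lambda>n. LBINT \<tau>=ereal 0..ereal t.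
                tapply (Sgrp (t - \<tau>) (Lam (truncated_uux (m n) (u \<tau>)))) \<psi>)
         \<longlonglongrightarrow> tapply v \<psi>))"

text \<open>Solutions on \<open>[-T, T]\<close> in \<open>C([-T, T]; X)\<close>, where \<open>X\<close> is \<open>Hs s\<close> or \<open>Hs_real s\<close>.\<close>

definition is_solution ::
  "tdist set \<Rightarrow> real \<Rightarrow> real \<Rightarrow> tdist \<Rightarrow> (real \<Rightarrow> tdist) \<Rightarrow> bool" where
  "is_solution X s T \<phi> u \<longleftrightarrow>
     (\<forall>t\<in>{-T..T}. u t \<in> X) \<and>
     (\<forall>t\<in>{-T..T}. ((\<lambda>\<tau>. Hs_norm s (u \<tau> - u t)) \<longlongrightarrow> 0) (at t within {-T..T})) \<and>
     (\<forall>t\<in>{-T..T}. \<exists>v. has_duhamel_integral u t v \<and> u t = Sgrp t \<phi> - v)"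


section \<open>Twice continuous Frechet differentiability on a normed subspace\<close>

text \<open>The norm of \<open>Hs s\<close> depends on the parameter \<open>s\<close>, so the library's derivative,
  which lives on types of class \<open>real_normed_vector\<close>, is not available; the definitions below
  are the usual ones for a subspace \<open>X\<close> with norm \<open>nrm\<close>.\<close>

definition bounded_linear_on ::
  "'a::real_vector set \<Rightarrow> ('a \<Rightarrow> real) \<Rightarrow> ('a \<Rightarrow> 'a) \<Rightarrow> bool" where
  "bounded_linear_on X nrm A \<longleftrightarrow>
     (\<forall>x\<in>X. A x \<in> X) \<and>
     (\<forall>x\<in>X. \<forall>y\<in>X. A (x + y) = A x + A y) \<and>
     (\<forall>x\<in>X. \<forall>c. A (c *\<^sub>R x) = c *\<^sub>R A x) \<and>
     (\<exists>K. \<forall>x\<in>X. nrm (A x) \<le> K * nrm x)"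

definition bounded_bilinear_on ::
  "'a::real_vector set \<Rightarrow> ('a \<Rightarrow> real) \<Rightarrow> ('a \<Rightarrow> 'a \<Rightarrow> 'a) \<Rightarrow> bool" where
  "bounded_bilinear_on X nrm B \<longleftrightarrow>
     (\<forall>x\<in>X. \<forall>y\<in>X. B x y \<in> X) \<and>
     (\<forall>x\<in>X. \<forall>y\<in>X. \<forall>z\<in>X. B (x + y) z = B x z + B y z \<and> B z (x + y) = B z x + B z y) \<and>
     (\<forall>x\<in>X. \<forall>y\<in>X. \<forall>c. B (c *\<^sub>R x) y = c *\<^sub>R B x y \<and> B x (c *\<^sub>R y) = c *\<^sub>R B x y) \<and>
     (\<exists>K. \<forall>x\<in>X. \<forall>y\<in>X. nrm (B x y) \<le> K * nrm x * nrm y)"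

definition frechet_on ::
  "'a::real_vector set \<Rightarrow> ('a \<Rightarrow> real) \<Rightarrow> ('a \<Rightarrow> 'a) \<Rightarrow> ('a \<Rightarrow> 'a) \<Rightarrow> 'a \<Rightarrow> bool" where
  "frechet_on X nrm F A x \<longleftrightarrow>
     bounded_linear_on X nrm A \<and>
     (\<forall>\<epsilon>>0. \<exists>d>0. \<forall>h\<in>X. nrm h < d \<longrightarrow> nrm (F (x + h) - F x - A h) \<le> \<epsilon> * nrm h)"

text \<open>The derivative of \<open>DF\<close>, valued in the bounded linear operators with the operator norm,
  written with the second derivative as a bilinear map.\<close>

definition frechet2_on ::
  "'a::real_vector set \<Rightarrow> ('a \<Rightarrow> real) \<Rightarrow> ('a \<Rightarrow> 'a \<Rightarrow> 'a) \<Rightarrow> ('a \<Rightarrow> 'a \<Rightarrow> 'a) \<Rightarrow> 'a \<Rightarrow> bool" where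
  "frechet2_on X nrm DF B x \<longleftrightarrow>
     bounded_bilinear_on X nrm B \<and>
     (\<forall>\<epsilon>>0. \<exists>d>0. \<forall>h\<in>X. nrm h < d \<longrightarrow>
        (\<forall>k\<in>X. nrm (DF (x + h) k - DF x k - B h k) \<le> \<epsilon> * nrm h * nrm k))"

definition C2_at ::
  "'a::real_vector set \<Rightarrow> ('a \<Rightarrow> real) \<Rightarrow> ('a \<Rightarrow> 'a) \<Rightarrow> 'a \<Rightarrow> bool" where
  "C2_at X nrm F a \<longleftrightarrow>
     (\<exists>r>0. \<exists>DF D2F.
        (\<forall>x\<in>X. nrm (x - a) < r \<longrightarrow>
           F x \<in> X \<and> frechet_on X nrm F (DF x) x \<and> frechet2_on X nrm DF (D2F x) x) \<and>
        (\<forall>\<epsilon>>0. \<exists>d>0. \<forall>x\<in>X. nrm (x - a) < d \<longrightarrow>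
           (\<forall>h\<in>X. \<forall>k\<in>X. nrm (D2F x h k - D2F a h k) \<le> \<epsilon> * nrm h * nrm k)))"


section \<open>Local well-posedness near zero with a flow map that is twice differentiable at zero\<close>

text \<open>The flow map at zero only involves data in a neighbourhood of zero, so existence and
  uniqueness on \<open>[-T, T]\<close> are asked for small data only; \<open>\<Phi> \<phi>\<close> is then the solution with datum
  \<open>\<phi>\<close>.\<close>

definition well_posed_C2 :: "tdist set \<Rightarrow> real \<Rightarrow> real \<Rightarrow> bool" where
  "well_posed_C2 X s T \<longleftrightarrow>
     (\<exists>\<delta>>0. \<exists>\<Phi> :: tdist \<Rightarrow> real \<Rightarrow> tdist.
        (\<forall>\<phi>\<in>X. Hs_norm s \<phi> < \<delta> \<longrightarrow>
           is_solution X s T \<phi> (\<Phi> \<phi>) \<and>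
           (\<forall>u. is_solution X s T \<phi> u \<longrightarrow> (\<forall>t\<in>{-T..T}. u t = \<Phi> \<phi> t))) \<and>
        (\<forall>t\<in>{-T..T}. C2_at X (Hs_norm s) (\<lambda>\<phi>. \<Phi> \<phi> t) 0))"

end

theory Submission
  imports Defs "HOL-Probability.Probability"
begin

text \<open>For data with a Fourier transform bounded by a multiple of \<open>1 / (1 + \<xi>\<^sup>2)\<close>, a weight that is
  stable under convolution, the Duhamel equation is solved on the Fourier side by Picard iteration
  on all of \<open>[-T, T]\<close> once the datum is multiplied by a small \<open>\<epsilon>\<close>.  Absolute integrability makes
  this a solution in the truncation sense, so by the assumed uniqueness it is the flow of \<open>\<epsilon> \<phi>\<close>, and
  its \<open>\<epsilon>\<^sup>2\<close> coefficient is half the second derivative of the flow at zero in direction \<open>(\<phi>, \<phi>)\<close>.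
  For packets of height \<open>N powr (-s)\<close> at the frequencies \<open>\<plusminus>N\<close>, whose \<open>Hs\<close> norms are
  bounded, opposite frequencies interact almost without oscillation, because the dispersion relation
  \<open>\<xi> / (1 + \<bar>\<xi>\<bar>)\<close> tends to the sign function.  The resulting low-frequency part of the coefficient
  has size \<open>N powr (-2 * s)\<close>, which is incompatible with a bounded second derivative.\<close>


section \<open>Schwartz functions\<close>

text \<open>The hypothesis speaks about an unspecified flow map, so its derivatives can only be
  identified once genuine solutions are at hand, on the prescribed interval and in the truncation
  sense. These exist because the symbol of \<open>Lam\<close> composed with the space derivative is
  \<open>\<i> * sg\<close>, where \<open>sg\<close> has modulus at most 1: no derivative is lost,
  and the Duhamel map contracts in a weighted supremum norm with \<open>T\<close> fixed and only the
  datum small.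

  Differentiability is tested through \<open>lfun\<close>, a real functional living on a fixed
  window of low frequencies. The Sobolev weight is bounded below there, so \<open>lfun\<close> is
  bounded on \<open>Hs s\<close>, and along a ray \<open>\<epsilon> *\<^sub>R \<phi>\<close>
  everything reduces to calculus for real functions of one variable.

  The admissible \<open>\<epsilon>\<close> and the constant of the cubic remainder deteriorate as
  \<open>N\<close> grows. This is harmless: \<open>\<epsilon>\<close> tends to 0 for each fixed
  \<open>N\<close>, whereas the bound \<open>K\<close> coming from the second derivative at zero is
  fixed before \<open>N\<close> is chosen.\<close>

lemma schwartzI:
  assumes "F 0 = \<psi>"
    and "\<And>k x. (F k has_vector_derivative F (Suc k) x) (at x)"
    and "\<And>k j. \<exists>B. \<forall>x. \<bar>x\<bar> ^ j * cmod (F k x) \<le> B"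
  shows "\<psi> \<in> schwartz"
proof -
  have eq: "(vderiv ^^ k) \<psi> = F k" for k
    by (induction k) (auto simp: vderiv_def assms(1) vector_derivative_at[OF assms(2)])
  show ?thesis
    unfolding schwartz_def mem_Collect_eq eq bounded_iff
    using assms(3) by (auto simp: norm_power power_abs intro: differentiableI_vector[OF assms(2)])
qed

lemma schwartz_has_deriv:
  assumes "\<psi> \<in> schwartz"
  shows "((vderiv ^^ k) \<psi> has_vector_derivative (vderiv ^^ Suc k) \<psi> x) (at x)"
proof -
  have "(vderiv ^^ k) \<psi> differentiable (at x)"
    using assms unfolding schwartz_def by blast
  then show ?thesis
    by (simp add: vderiv_def vector_derivative_works)
qed

lemma schwartz_bound:
  assumes "\<psi> \<in> schwartz"
  shows "\<exists>B. \<forall>x. \<bar>x\<bar> ^ j * cmod ((vderiv ^^ k) \<psi> x) \<le> B"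
proof -
  have "bounded (range (\<lambda>x. x ^ j *\<^sub>R (vderiv ^^ k) \<psi> x))"
    using assms unfolding schwartz_def by blast
  then show ?thesis
    unfolding bounded_iff by (auto simp: norm_power power_abs)
qed

lemma schwartz_bound0:
  assumes "\<psi> \<in> schwartz"
  obtains B where "0 \<le> B" "\<And>x. \<bar>x\<bar> ^ j * cmod (\<psi> x) \<le> B"
proof -
  obtain B where B: "\<And>x. \<bar>x\<bar> ^ j * cmod (\<psi> x) \<le> B"
    using schwartz_bound[OF assms, of j 0] by auto
  have "0 \<le> \<bar>0\<bar> ^ j * cmod (\<psi> 0)"
    by (intro mult_nonneg_nonneg zero_le_power) auto
  then have "0 \<le> B"
    using B order_trans by blast
  then show thesis
    using B that by blast
qed

lemma schwartz_vderiv: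
  assumes "\<psi> \<in> schwartz"
  shows "vderiv \<psi> \<in> schwartz"
proof (rule schwartzI[where F = "\<lambda>k. (vderiv ^^ Suc k) \<psi>"])
  show "((vderiv ^^ Suc k) \<psi> has_vector_derivative (vderiv ^^ Suc (Suc k)) \<psi> x) (at x)" for k x
    by (rule schwartz_has_deriv[OF assms])
  show "\<exists>B. \<forall>x. \<bar>x\<bar> ^ j * cmod ((vderiv ^^ Suc k) \<psi> x) \<le> B" for k j
    by (rule schwartz_bound[OF assms])
qed simp

lemma schwartz_vderiv_pow: "\<psi> \<in> schwartz \<Longrightarrow> (vderiv ^^ k) \<psi> \<in> schwartz"
  by (induction k) (auto intro: schwartz_vderiv)

lemma bounded_weighted_add:
  fixes f g :: "real \<Rightarrow> complex"
  assumes "\<exists>B. \<forall>x. \<bar>x\<bar> ^ j * cmod (f x) \<le> B" "\<exists>B. \<forall>x. \<bar>x\<bar> ^ j * cmod (g x) \<le> B"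
  shows "\<exists>B. \<forall>x. \<bar>x\<bar> ^ j * cmod (f x + g x) \<le> B"
proof -
  obtain B C where BC: "\<And>x. \<bar>x\<bar> ^ j * cmod (f x) \<le> B" "\<And>x. \<bar>x\<bar> ^ j * cmod (g x) \<le> C"
    using assms by blast
  have "\<bar>x\<bar> ^ j * cmod (f x + g x) \<le> B + C" for x
  proof -
    have "\<bar>x\<bar> ^ j * cmod (f x + g x) \<le> \<bar>x\<bar> ^ j * (cmod (f x) + cmod (g x))"
      by (intro mult_left_mono norm_triangle_ineq) auto
    then show ?thesis
      using BC[of x] by (simp add: algebra_simps)
  qed
  then show ?thesis by blast
qed

lemma bounded_weighted_cmult:
  fixes f :: "real \<Rightarrow> complex"
  assumes "\<exists>B. \<forall>x. \<bar>x\<bar> ^ j * cmod (f x) \<le> B"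
  shows "\<exists>B. \<forall>x. \<bar>x\<bar> ^ j * cmod (c * f x) \<le> B"
proof -
  obtain B where B: "\<And>x. \<bar>x\<bar> ^ j * cmod (f x) \<le> B"
    using assms by blast
  have "\<bar>x\<bar> ^ j * cmod (c * f x) \<le> cmod c * B" for x
    using mult_left_mono[OF B[of x], of "cmod c"] by (simp add: norm_mult mult_ac)
  then show ?thesis by blast
qed

lemma schwartz_add:
  assumes "\<psi> \<in> schwartz" "\<phi> \<in> schwartz"
  shows "(\<lambda>x. \<psi> x + \<phi> x) \<in> schwartz"
proof (rule schwartzI[where F = "\<lambda>k x. (vderiv ^^ k) \<psi> x + (vderiv ^^ k) \<phi> x"])
  show "((\<lambda>x. (vderiv ^^ k) \<psi> x + (vderiv ^^ k) \<phi> x) has_vector_derivative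
        (vderiv ^^ Suc k) \<psi> x + (vderiv ^^ Suc k) \<phi> x) (at x)" for k x
    by (intro has_vector_derivative_add schwartz_has_deriv assms)
  show "\<exists>B. \<forall>x. \<bar>x\<bar> ^ j * cmod ((vderiv ^^ k) \<psi> x + (vderiv ^^ k) \<phi> x) \<le> B" for k j
    by (intro bounded_weighted_add schwartz_bound assms)
qed simp

lemma schwartz_cmult:
  assumes "\<psi> \<in> schwartz"
  shows "(\<lambda>x. c * \<psi> x) \<in> schwartz"
proof (rule schwartzI[where F = "\<lambda>k x. c * (vderiv ^^ k) \<psi> x"])
  show "((\<lambda>x. c * (vderiv ^^ k) \<psi> x) has_vector_derivative c * (vderiv ^^ Suc k) \<psi> x) (at x)"
    for k x
    by (intro has_vector_derivative_mult_right schwartz_has_deriv assms)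
  show "\<exists>B. \<forall>x. \<bar>x\<bar> ^ j * cmod (c * (vderiv ^^ k) \<psi> x) \<le> B" for k j
    by (intro bounded_weighted_cmult schwartz_bound assms)
qed simp

lemma schwartz_reflect:
  assumes "\<psi> \<in> schwartz"
  shows "(\<lambda>x. \<psi> (- x)) \<in> schwartz"
proof (rule schwartzI[where F = "\<lambda>k x. (- 1) ^ k * (vderiv ^^ k) \<psi> (- x)"])
  show "((\<lambda>x. (- 1) ^ k * (vderiv ^^ k) \<psi> (- x)) has_vector_derivative
        (- 1) ^ Suc k * (vderiv ^^ Suc k) \<psi> (- x)) (at x)" for k x
  proof -
    have "((\<lambda>x. (vderiv ^^ k) \<psi> (- x)) has_vector_derivative - (vderiv ^^ Suc k) \<psi> (- x)) (at x)"
      using vector_diff_chain_at[of "uminus" "-1" x "(vderiv ^^ k) \<psi>" "(vderiv ^^ Suc k) \<psi> (- x)"]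
        schwartz_has_deriv[OF assms, of k "- x"]
        has_vector_derivative_minus[OF has_vector_derivative_id, of "at x"]
      by (simp add: o_def)
    from has_vector_derivative_mult_right[OF this, of "(- 1) ^ k"] show ?thesis by simp
  qed
  show "\<exists>B. \<forall>x. \<bar>x\<bar> ^ j * cmod ((- 1) ^ k * (vderiv ^^ k) \<psi> (- x)) \<le> B" for k j
  proof -
    obtain B where "\<And>x. \<bar>x\<bar> ^ j * cmod ((vderiv ^^ k) \<psi> x) \<le> B"
      using schwartz_bound[OF assms] by blast
    from this[of "- x" for x] show ?thesis
      by (auto simp: norm_mult norm_power)
  qed
qed simp

lemma schwartz_mult_id:
  assumes "\<psi> \<in> schwartz"
  shows "(\<lambda>x. complex_of_real x * \<psi> x) \<in> schwartz"
\<comment> \<open>Leibniz rule. For \<open>k = 0\<close> the truncated index \<open>k - 1\<close> is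
  0, but its term carries the factor \<open>of_nat 0\<close>.\<close>
proof (rule schwartzI[where F = "\<lambda>k x. of_real x * (vderiv ^^ k) \<psi> x + of_nat k * (vderiv ^^ (k - 1)) \<psi> x"])
  let ?D = "\<lambda>k. (vderiv ^^ k) \<psi>"
  show "((\<lambda>x. of_real x * ?D k x + of_nat k * ?D (k - 1) x) has_vector_derivative
      of_real x * ?D (Suc k) x + of_nat (Suc k) * ?D (Suc k - 1) x) (at x)" for k x
  proof -
    have 1: "((\<lambda>x. of_real x * ?D k x) has_vector_derivative of_real x * ?D (Suc k) x + 1 * ?D k x) (at x)"
      by (intro has_vector_derivative_mult schwartz_has_deriv assms
          has_vector_derivative_of_real) (auto intro!: derivative_eq_intros)
    have 2: "((\<lambda>x. of_nat k * ?D (k - 1) x) has_vector_derivative of_nat k * ?D k x) (at x)"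
      using schwartz_has_deriv[OF assms, of "k - 1" x]
      by (cases k) (auto intro!: has_vector_derivative_mult_right)
    from has_vector_derivative_add[OF 1 2] show ?thesis
      by (simp add: algebra_simps)
  qed
  show "\<exists>B. \<forall>x. \<bar>x\<bar> ^ j * cmod (of_real x * ?D k x + of_nat k * ?D (k - 1) x) \<le> B" for k j
  proof (intro bounded_weighted_add bounded_weighted_cmult schwartz_bound assms)
    show "\<exists>B. \<forall>x. \<bar>x\<bar> ^ j * cmod (of_real x * ?D k x) \<le> B"
      using schwartz_bound[OF assms, of "Suc j" k] by (simp add: norm_mult mult_ac)
  qed
qed simp

lemma schwartz_continuous:
  assumes "\<psi> \<in> schwartz"
  shows "continuous_on UNIV \<psi>"
proof -
  have "continuous (at x) \<psi>" for x
    using schwartz_has_deriv[OF assms, of 0 x] has_vector_derivative_continuous by simp blast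
  then show ?thesis
    by (simp add: continuous_on_eq_continuous_at)
qed

lemma schwartz_measurable: "\<psi> \<in> schwartz \<Longrightarrow> \<psi> \<in> borel_measurable borel"
  using schwartz_continuous borel_measurable_continuous_onI by blast

text \<open>A non-integrable \<open>f\<close> has integral 0 by convention, and the pointwise bound
  makes \<open>g\<close> nonnegative, so the estimate survives in that case too. Bounds on
  convolutions and Duhamel integrals can therefore be obtained without a measurability
  argument.\<close>

lemma norm_integral_le:
  fixes f :: "'a \<Rightarrow> 'b::{banach, second_countable_topology}"
  assumes "integrable M g" "\<And>x. norm (f x) \<le> g x"
  shows "norm (integral\<^sup>L M f) \<le> integral\<^sup>L M g"
proof (cases "integrable M f")
  case True
  have "norm (integral\<^sup>L M f) \<le> (\<integral>x. norm (f x) \<partial>M)"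
    by (rule integral_norm_bound)
  also have "\<dots> \<le> integral\<^sup>L M g"
    using True assms by (intro integral_mono) auto
  finally show ?thesis .
next
  case False
  have "0 \<le> g x" for x
    using assms(2)[of x] norm_ge_zero order_trans by blast
  then show ?thesis
    using False by (simp add: not_integrable_integral_eq)
qed

section \<open>The integrable weight and the decay of Schwartz functions\<close>

definition wt :: "real \<Rightarrow> real" where
  "wt x = inverse (1 + x\<^sup>2)"

lemma wt_measurable [measurable]: "wt \<in> borel_measurable borel"
  unfolding wt_def by measurable

lemma wt_pos: "0 < wt x"
  unfolding wt_def by (auto intro: add_pos_nonneg)

lemma wt_nonneg: "0 \<le> wt x"
  using wt_pos[of x] by simp

lemma wt_le_1: "wt x \<le> 1"
  unfolding wt_def by (simp add: inverse_le_1_iff)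

lemma wt_integrable: "integrable lborel wt"
  using integrable_inverse_1_plus_square
  by (simp add: set_integrable_def wt_def[abs_def] einterval_def)

lemma wt_integral: "(LINT x|lborel. wt x) = pi"
  using LBINT_inverse_1_plus_square
  by (simp add: interval_lebesgue_integral_def set_lebesgue_integral_def wt_def[abs_def] einterval_def)

lemma le_wt_iff: "a \<le> b * wt x \<longleftrightarrow> a * (1 + x\<^sup>2) \<le> b"
proof -
  have "0 < 1 + x\<^sup>2" by (auto intro: add_pos_nonneg)
  then show ?thesis
    by (simp add: wt_def field_simps)
qed

lemma integrable_wt_bound:
  fixes f :: "real \<Rightarrow> complex"
  assumes "f \<in> borel_measurable borel" "\<And>x. cmod (f x) \<le> A * wt x"
  shows "integrable lborel f"
proof (rule Bochner_Integration.integrable_bound[of _ "\<lambda>x. A * wt x"])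
  show "integrable lborel (\<lambda>x. A * wt x)"
    using wt_integrable by simp
  show "AE x in lborel. norm (f x) \<le> norm (A * wt x)"
    using assms(2) by (auto intro!: AE_I2 intro: order_trans[OF _ abs_ge_self])
qed (use assms(1) in auto)

lemma schwartz_wt_bound:
  assumes "\<psi> \<in> schwartz"
  obtains A where "0 \<le> A" "\<And>x. cmod (\<psi> x) \<le> A * wt x"
proof -
  obtain B where B: "0 \<le> B" "\<And>x. \<bar>x\<bar> ^ 0 * cmod (\<psi> x) \<le> B"
    using schwartz_bound0[OF assms, where j = 0] by blast
  obtain C where C: "0 \<le> C" "\<And>x. \<bar>x\<bar> ^ 2 * cmod (\<psi> x) \<le> C"
    using schwartz_bound0[OF assms, where j = 2] by blast
  have "cmod (\<psi> x) \<le> (B + C) * wt x" for x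
    unfolding le_wt_iff using B(2)[of x] C(2)[of x] by (simp add: algebra_simps)
  then show thesis
    using that[of "B + C"] B C by simp
qed

lemma schwartz_integrable:
  assumes "\<psi> \<in> schwartz"
  shows "integrable lborel \<psi>"
proof -
  obtain A where "\<And>x. cmod (\<psi> x) \<le> A * wt x"
    using schwartz_wt_bound[OF assms] by blast
  then show ?thesis
    using integrable_wt_bound schwartz_measurable[OF assms] by blast
qed

text \<open>Adding the terms \<open>j = 0\<close> and \<open>j = 2\<close> of the seminorm, both
  with \<open>k = 0\<close>, controls \<open>(1 + x\<^sup>2) * cmod (\<psi> x)\<close>; this is
  where the factor 2 comes from. The explicit dependence on the seminorm is what continuity of a
  functional in \<open>tempered\<close> asks for.\<close>

lemma schwartz_wt_seminorm:
  assumes "\<psi> \<in> schwartz"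
  shows "cmod (\<psi> x) \<le> 2 * schwartz_seminorm 2 \<psi> * wt x"
proof -
  let ?S = "\<lambda>j k. SUP x. norm (x ^ j *\<^sub>R (vderiv ^^ k) \<psi> x)"
  have bdd: "bdd_above (range (\<lambda>x. norm (x ^ j *\<^sub>R (vderiv ^^ k) \<psi> x)))" for j k
    using schwartz_bound[OF assms, of j k] by (auto simp: bdd_above_def norm_power power_abs)
  have up: "norm (y ^ j *\<^sub>R (vderiv ^^ k) \<psi> y) \<le> ?S j k" for j k y
    by (rule cSUP_upper[OF UNIV_I bdd])
  have nn: "0 \<le> ?S j k" for j k
    using up[where y = 0] norm_ge_zero order_trans by blast
  have le: "?S j 0 \<le> schwartz_seminorm 2 \<psi>" if "j \<le> 2" for j
  proof -
    have "?S j 0 \<le> (\<Sum>k\<le>2. ?S j k)"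
      by (rule member_le_sum[of 0 "{..2}" "\<lambda>k. ?S j k"]) (use nn in auto)
    also have "\<dots> \<le> (\<Sum>j\<le>2. \<Sum>k\<le>2. ?S j k)"
      by (rule member_le_sum[of j "{..2}" "\<lambda>j. \<Sum>k\<le>2. ?S j k"]) (use nn that in \<open>auto intro!: sum_nonneg\<close>)
    finally show ?thesis by (simp add: schwartz_seminorm_def)
  qed
  have "cmod (\<psi> x) \<le> schwartz_seminorm 2 \<psi>" "x\<^sup>2 * cmod (\<psi> x) \<le> schwartz_seminorm 2 \<psi>"
    using up[where y = x and j = 0 and k = 0] up[where y = x and j = 2 and k = 0] le[of 0] le[of 2]
    by auto
  then show ?thesis
    unfolding le_wt_iff by (simp add: algebra_simps)
qed

section \<open>Distributions given by bounded functions\<close>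

lemma integrable_bounded_mult:
  fixes f g :: "'a \<Rightarrow> complex"
  assumes "integrable M g" "f \<in> borel_measurable M" "\<And>x. cmod (f x) \<le> C"
  shows "integrable M (\<lambda>x. f x * g x)"
proof (rule Bochner_Integration.integrable_bound[of _ "\<lambda>x. C * norm (g x)"])
  show "AE x in M. norm (f x * g x) \<le> norm (C * norm (g x))"
    using assms(3) by (auto intro!: AE_I2 mult_right_mono intro: order_trans[OF _ abs_ge_self]
        simp: norm_mult abs_mult)
qed (use assms in auto)

text \<open>Without this fact the value of \<open>Abs_tdist\<close> inside
  \<open>tdist_of_fun\<close> would be unspecified. Continuity holds with seminorm index 2, by
  integrating the bound in terms of \<open>wt\<close>, whose integral is \<open>pi\<close>.\<close>

lemma tempered_bounded_fun:
  assumes f: "f \<in> borel_measurable borel" "\<And>x. cmod (f x) \<le> C"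
  shows "tempered (\<lambda>\<psi>. if \<psi> \<in> schwartz then (LINT x|lborel. f x * \<psi> x) else 0)"
proof -
  have int: "integrable lborel (\<lambda>x. f x * \<psi> x)" if "\<psi> \<in> schwartz" for \<psi>
    by (rule integrable_bounded_mult[OF schwartz_integrable[OF that], where C = C]) (use f in auto)
  have "0 \<le> C"
    using f(2)[of 0] norm_ge_zero order_trans by blast
  have "norm (LINT x|lborel. f x * \<psi> x) \<le> (2 * C * pi) * schwartz_seminorm 2 \<psi>"
    if \<psi>: "\<psi> \<in> schwartz" for \<psi>
  proof -
    let ?S = "schwartz_seminorm 2 \<psi>"
    have "norm (LINT x|lborel. f x * \<psi> x) \<le> (LINT x|lborel. C * (2 * ?S * wt x))"
    proof (rule norm_integral_le)
      show "norm (f x * \<psi> x) \<le> C * (2 * ?S * wt x)" for x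
        unfolding norm_mult by (rule mult_mono) (use f schwartz_wt_seminorm[OF \<psi>] \<open>0 \<le> C\<close> in auto)
    qed (use wt_integrable in auto)
    then show ?thesis
      by (simp add: wt_integral mult_ac)
  qed
  then have "\<exists>C N. \<forall>\<psi>\<in>schwartz. norm (LINT x|lborel. f x * \<psi> x) \<le> C * schwartz_seminorm N \<psi>"
    by blast
  moreover have "(LINT x|lborel. f x * (\<psi> x + \<phi> x)) = (LINT x|lborel. f x * \<psi> x) + (LINT x|lborel. f x * \<phi> x)"
    if "\<psi> \<in> schwartz" "\<phi> \<in> schwartz" for \<psi> \<phi>
    using int that by (simp add: distrib_left)
  moreover have "(LINT x|lborel. f x * (c * \<psi> x)) = c * (LINT x|lborel. f x * \<psi> x)" for \<psi> c
    by (simp add: mult.left_commute)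
  ultimately show ?thesis
    unfolding tempered_def by (simp add: schwartz_add schwartz_cmult)
qed

lemma tapply_tdist_of_fun:
  assumes "f \<in> borel_measurable borel" "\<And>x. cmod (f x) \<le> C" "\<psi> \<in> schwartz"
  shows "tapply (tdist_of_fun f) \<psi> = (LINT x|lborel. f x * \<psi> x)"
  unfolding tdist_of_fun_def
  using tempered_bounded_fun[OF assms(1,2)] assms(3) by (subst Abs_tdist_inverse) auto


section \<open>The Fourier transform\<close>

lemma cis_bound: "cmod (cis a - 1 - \<i> * of_real a) \<le> a\<^sup>2"
proof -
  have "cmod (iexp a - (\<Sum>k\<le>1. (\<i> * a) ^ k / fact k)) \<le> \<bar>a\<bar> ^ Suc 1 / fact (Suc 1)"
    by (rule iexp_approx1)
  then have "cmod (cis a - 1 - \<i> * of_real a) \<le> a\<^sup>2 / 2"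
    by (simp add: cis_conv_exp diff_diff_eq power2_eq_square)
  then show ?thesis by (rule order_trans) simp
qed

lemma cis_diff_bound: "cmod (cis a - cis b) \<le> \<bar>a - b\<bar>"
proof -
  have "cis a - cis b = cis b * (cis (a - b) - 1)"
    by (simp add: algebra_simps cis_mult)
  then have "cmod (cis a - cis b) = cmod (iexp (a - b) - (\<Sum>k\<le>0. (\<i> * (a - b)) ^ k / fact k))"
    by (simp add: norm_mult cis_conv_exp)
  also have "\<dots> \<le> \<bar>a - b\<bar> ^ Suc 0 / fact (Suc 0)"
    by (rule iexp_approx1)
  finally show ?thesis by simp
qed

lemma cis_measurable [measurable (raw)]:
  "f \<in> borel_measurable M \<Longrightarrow> (\<lambda>x. cis (f x)) \<in> borel_measurable M"
  unfolding cis_conv_exp by measurable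

lemma integrable_cis_mult:
  assumes "integrable lborel g" "k \<in> borel_measurable borel"
  shows "integrable lborel (\<lambda>x. cis (k x) * g x)"
  by (rule integrable_bounded_mult[OF assms(1), where C = 1]) (use assms in auto)

lemma norm_cis_integral_le:
  assumes "integrable lborel g"
  shows "cmod (LINT x|lborel. cis (k x) * g x) \<le> (LINT x|lborel. cmod (g x))"
  by (rule norm_integral_le) (use assms in \<open>auto simp: norm_mult\<close>)

text \<open>The second-order Taylor bound \<open>cis_bound\<close> is integrated against
  \<open>g\<close>: the second moment of \<open>g\<close> then controls the error of the linear
  approximation by a multiple of \<open>h\<^sup>2\<close>, uniformly in \<open>x\<close>. The
  parameter \<open>a\<close> serves both transforms, with \<open>-1\<close> for
  \<open>fourier\<close> and \<open>1\<close> for \<open>inv_fourier\<close>.\<close>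

lemma oscillatory_has_deriv:
  fixes a :: real
  assumes g: "integrable lborel g" "integrable lborel (\<lambda>y. of_real y * g y)"
    "integrable lborel (\<lambda>y. of_real (y\<^sup>2) * g y)"
  shows "((\<lambda>x. LINT y|lborel. cis (a * (x * y)) * g y) has_vector_derivative
           (LINT y|lborel. cis (a * (x * y)) * (\<i> * of_real a * (of_real y * g y)))) (at x)"
proof -
  let ?G = "\<lambda>x. LINT y|lborel. cis (a * (x * y)) * g y"
  let ?D = "LINT y|lborel. cis (a * (x * y)) * (\<i> * of_real a * (of_real y * g y))"
  define M where "M = (LINT y|lborel. cmod (of_real (y\<^sup>2) * g y))"
  have gm: "g \<in> borel_measurable borel"
    using g(1) by auto
  have i1: "integrable lborel (\<lambda>y. cis (a * (z * y)) * g y)" for z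
    by (rule integrable_cis_mult) (use g in auto)
  have i2: "integrable lborel (\<lambda>y. cis (a * (z * y)) * (\<i> * of_real a * (of_real y * g y)))" for z
    by (rule integrable_cis_mult) (use g in auto)
  have bound: "cmod (?G (x + h) - ?G x - h *\<^sub>R ?D) \<le> a\<^sup>2 * M * h\<^sup>2" for h
  proof -
    have "cmod (?G (x + h) - ?G x - h *\<^sub>R ?D) = cmod (LINT y|lborel. cis (a * ((x + h) * y)) * g y
        - cis (a * (x * y)) * g y - h *\<^sub>R (cis (a * (x * y)) * (\<i> * of_real a * (of_real y * g y))))"
      using i1 i2 by simp
    also have "\<dots> \<le> (LINT y|lborel. a\<^sup>2 * h\<^sup>2 * cmod (of_real (y\<^sup>2) * g y))"
    proof (rule norm_integral_le)
      show "integrable lborel (\<lambda>y. a\<^sup>2 * h\<^sup>2 * cmod (of_real (y\<^sup>2) * g y))"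
        using g(3) by (intro integrable_mult_right integrable_norm) auto
      fix y
      have eq: "cis (a * ((x + h) * y)) * g y - cis (a * (x * y)) * g y
          - h *\<^sub>R (cis (a * (x * y)) * (\<i> * of_real a * (of_real y * g y)))
          = cis (a * (x * y)) * g y * (cis (a * h * y) - 1 - \<i> * of_real (a * h * y))"
      proof -
        have "cis (a * ((x + h) * y)) = cis (a * (x * y)) * cis (a * h * y)"
          by (simp add: cis_mult algebra_simps)
        then show ?thesis
          by (simp add: algebra_simps scaleR_conv_of_real)
      qed
      have "cmod (cis (a * ((x + h) * y)) * g y - cis (a * (x * y)) * g y
          - h *\<^sub>R (cis (a * (x * y)) * (\<i> * of_real a * (of_real y * g y))))
          = cmod (g y) * cmod (cis (a * h * y) - 1 - \<i> * of_real (a * h * y))"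
        by (simp only: eq norm_mult norm_cis mult_1_left)
      also have "\<dots> \<le> cmod (g y) * (a * h * y)\<^sup>2"
        by (rule mult_left_mono[OF cis_bound norm_ge_zero])
      also have "\<dots> = a\<^sup>2 * h\<^sup>2 * (y\<^sup>2 * cmod (g y))"
        by (simp only: power_mult_distrib mult_ac)
      also have "y\<^sup>2 * cmod (g y) = cmod (of_real (y\<^sup>2) * g y)"
        by (simp add: norm_mult norm_power)
      finally show "cmod (cis (a * ((x + h) * y)) * g y - cis (a * (x * y)) * g y
          - h *\<^sub>R (cis (a * (x * y)) * (\<i> * of_real a * (of_real y * g y))))
          \<le> a\<^sup>2 * h\<^sup>2 * cmod (of_real (y\<^sup>2) * g y)" .
    qed
    also have "\<dots> = a\<^sup>2 * M * h\<^sup>2"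
      unfolding M_def integral_mult_right_zero by (simp only: mult_ac)
    finally show ?thesis .
  qed
  show ?thesis
    unfolding has_vector_derivative_def has_derivative_at
  proof
    show "bounded_linear (\<lambda>h. h *\<^sub>R ?D)"
      by (rule bounded_linear_scaleR_left)
    have "((\<lambda>h. a\<^sup>2 * M * \<bar>h\<bar>) \<longlongrightarrow> 0) (at 0)"
      by (auto intro!: tendsto_eq_intros)
    then show "(\<lambda>h. norm (?G (x + h) - ?G x - h *\<^sub>R ?D) / norm h) \<midarrow>0\<rightarrow> 0"
    proof (rule tendsto_sandwich[OF _ _ tendsto_const, rotated 2])
      show "\<forall>\<^sub>F h in at 0. norm (?G (x + h) - ?G x - h *\<^sub>R ?D) / norm h \<le> a\<^sup>2 * M * \<bar>h\<bar>"
      proof (rule eventually_mono[OF eventually_neq_at_within])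
        fix h :: real assume "h \<noteq> 0"
        then show "norm (?G (x + h) - ?G x - h *\<^sub>R ?D) / norm h \<le> a\<^sup>2 * M * \<bar>h\<bar>"
          using bound[of h] by (simp add: divide_le_eq power2_eq_square mult.assoc flip: abs_mult)
      qed
    qed auto
  qed
qed

lemma fourier_schwartz_has_deriv:
  assumes "\<psi> \<in> schwartz"
  shows "(fourier \<psi> has_vector_derivative fourier (\<lambda>y. - \<i> * (of_real y * \<psi> y)) x) (at x)"
proof -
  have "(\<lambda>y. of_real (y\<^sup>2) * \<psi> y) \<in> schwartz"
    using schwartz_mult_id[OF schwartz_mult_id[OF assms]] by (simp add: power2_eq_square mult.assoc)
  then show ?thesis
    using oscillatory_has_deriv[of \<psi> "-1" x] schwartz_integrable assms schwartz_mult_id[OF assms]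
    unfolding fourier_def by simp
qed

text \<open>Integration by parts in the form that the derivative \<open>f\<close> of
  \<open>F\<close> has integral 0 over the line, because \<open>F\<close> is dominated by a multiple
  of \<open>wt\<close> and vanishes at both ends. Splitting \<open>f\<close> by the product rule
  gives the identity.\<close>

lemma fourier_vderiv:
  assumes "\<psi> \<in> schwartz"
  shows "fourier (vderiv \<psi>) \<xi> = \<i> * of_real \<xi> * fourier \<psi> \<xi>"
proof -
  define F where "F = (\<lambda>x. cis (- (\<xi> * x)) * \<psi> x)"
  define f where "f = (\<lambda>x. cis (- (\<xi> * x)) * vderiv \<psi> x + - (\<i> * of_real \<xi>) * (cis (- (\<xi> * x)) * \<psi> x))"
  obtain A where A: "\<And>x. cmod (\<psi> x) \<le> A * wt x"
    using schwartz_wt_bound[OF assms] by blast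
  have "((\<lambda>x. cis (- (\<xi> * x))) has_vector_derivative - (\<i> * of_real \<xi>) * cis (- (\<xi> * x))) (at x)" for x
  proof -
    have "((\<lambda>z. exp (- (\<i> * of_real \<xi>) * z)) has_field_derivative
        - (\<i> * of_real \<xi>) * exp (- (\<i> * of_real \<xi>) * of_real x)) (at (of_real x))"
      by (auto intro!: derivative_eq_intros)
    from has_vector_derivative_real_field[OF this] show ?thesis
      by (simp add: cis_conv_exp mult.assoc)
  qed
  then have F: "(F has_vector_derivative f x) (at x)" for x
    unfolding F_def f_def
    by (auto intro!: derivative_eq_intros schwartz_has_deriv[OF assms, of 0, simplified] simp: algebra_simps)
  have i: "integrable lborel (\<lambda>x. cis (- (\<xi> * x)) * vderiv \<psi> x)"
    "integrable lborel (\<lambda>x. cis (- (\<xi> * x)) * \<psi> x)"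
    by (rule integrable_cis_mult; use schwartz_integrable assms schwartz_vderiv in auto)+
  then have "integrable lborel f"
    unfolding f_def by auto
  then have fi: "set_integrable lborel (einterval (-\<infinity>) \<infinity>) f"
    by (simp add: set_integrable_def einterval_def)
  have "continuous_on UNIV f"
    unfolding f_def cis_conv_exp
    by (intro continuous_intros schwartz_continuous schwartz_vderiv assms)
  then have fc: "isCont f x" for x
    by (simp add: continuous_on_eq_continuous_at)
  have wt0: "(wt \<longlongrightarrow> 0) at_top" "(wt \<longlongrightarrow> 0) at_bot"
    unfolding wt_def by real_asymp+
  have FA: "norm (F x) \<le> A * wt x" for x
    using A by (simp add: F_def norm_mult)
  have lim: "(F \<longlongrightarrow> 0) net" if "(wt \<longlongrightarrow> 0) net" for net
  proof (rule Lim_null_comparison)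
    show "((\<lambda>x. A * wt x) \<longlongrightarrow> 0) net"
      using tendsto_mult_left[OF that, of A] by simp
  qed (simp add: FA)
  have "(LBINT x=-\<infinity>..\<infinity>. f x) = 0 - 0"
  proof (rule interval_integral_FTC_integrable[where F = F])
    show "((F \<circ> real_of_ereal) \<longlongrightarrow> 0) (at_right (- \<infinity>))"
      using lim[OF wt0(2)] by (simp add: ereal_tendsto_simps1)
    show "((F \<circ> real_of_ereal) \<longlongrightarrow> 0) (at_left \<infinity>)"
      using lim[OF wt0(1)] by (simp add: ereal_tendsto_simps1)
  qed (use F fc fi in auto)
  then have "(LINT x|lborel. f x) = 0"
    by (simp add: interval_lebesgue_integral_def set_lebesgue_integral_def einterval_def)
  then show ?thesis
    using i unfolding f_def fourier_def by (simp add: add_eq_0_iff)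
qed

lemma fourier_vderiv_pow:
  assumes "\<psi> \<in> schwartz"
  shows "fourier ((vderiv ^^ j) \<psi>) \<xi> = (\<i> * of_real \<xi>) ^ j * fourier \<psi> \<xi>"
  by (induction j) (auto simp: fourier_vderiv schwartz_vderiv_pow assms)

text \<open>Derivatives of the transform are transforms of \<open>- \<i> * y\<close> multiples, and
  powers of the frequency are transforms of derivatives. Each weighted derivative is thus the
  transform of a Schwartz function, bounded by its \<open>L^1\<close> norm.\<close>

lemma fourier_schwartz:
  assumes "\<psi> \<in> schwartz"
  shows "fourier \<psi> \<in> schwartz"
proof (rule schwartzI[where F = "\<lambda>k. fourier (((\<lambda>h y. - \<i> * (of_real y * h y)) ^^ k) \<psi>)"])
  let ?M = "\<lambda>k. ((\<lambda>h y. - \<i> * (of_real y * h y)) ^^ k) \<psi>"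
  have S: "?M k \<in> schwartz" for k
  proof (induction k)
    case (Suc k)
    from schwartz_cmult[OF schwartz_mult_id[OF this], of "- \<i>"] show ?case by simp
  qed (use assms in simp)
  show "(fourier (?M k) has_vector_derivative fourier (?M (Suc k)) x) (at x)" for k x
    using fourier_schwartz_has_deriv[OF S[of k]] by simp
  show "\<exists>B. \<forall>x. \<bar>x\<bar> ^ j * cmod (fourier (?M k) x) \<le> B" for k j
  proof -
    have "\<bar>x\<bar> ^ j * cmod (fourier (?M k) x) \<le> (LINT y|lborel. cmod ((vderiv ^^ j) (?M k) y))" for x
    proof -
      have "\<bar>x\<bar> ^ j * cmod (fourier (?M k) x) = cmod (fourier ((vderiv ^^ j) (?M k)) x)"
        unfolding fourier_vderiv_pow[OF S] by (simp add: norm_mult norm_power)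
      also have "\<dots> \<le> (LINT y|lborel. cmod ((vderiv ^^ j) (?M k) y))"
        unfolding fourier_def
        by (rule norm_cis_integral_le) (use schwartz_integrable schwartz_vderiv_pow[OF S] in auto)
      finally show ?thesis .
    qed
    then show ?thesis by blast
  qed
qed simp

lemma inv_fourier_eq: "inv_fourier g x = fourier g (- x) / (2 * pi)"
  by (simp add: inv_fourier_def fourier_def mult.commute)

lemma inv_fourier_schwartz:
  assumes "\<psi> \<in> schwartz"
  shows "inv_fourier \<psi> \<in> schwartz"
proof -
  have "(\<lambda>x. (1 / (2 * of_real pi)) * fourier \<psi> (- x)) \<in> schwartz"
    by (rule schwartz_cmult[OF schwartz_reflect[OF fourier_schwartz[OF assms]]])
  then show ?thesis
    by (simp add: inv_fourier_eq[abs_def])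
qed

section \<open>Fubini for bounded kernels, and Fourier inversion\<close>

lemma kernel_integrable:
  fixes f g :: "real \<Rightarrow> complex"
  assumes "integrable lborel f" "integrable lborel g"
    and "case_prod K \<in> borel_measurable (borel \<Otimes>\<^sub>M borel)" "\<And>x y. cmod (K x y) \<le> C"
  shows "integrable (lborel \<Otimes>\<^sub>M lborel) (\<lambda>(x, y). K x y * (f x * g y))"
proof -
  have "integrable (lborel \<Otimes>\<^sub>M lborel) (\<lambda>p. f (fst p) * g (snd p))"
    by (rule lborel_pair.Fubini_integrable)
       (use assms(1,2) in \<open>auto simp: norm_mult intro!: integrable_mult_left integrable_norm\<close>)
  from integrable_bounded_mult[OF this, of "\<lambda>p. K (fst p) (snd p)" C] assms(3,4)
  show ?thesis
    by (simp add: split_beta' cong: measurable_cong_sets)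
qed

lemma kernel_swap:
  fixes f g :: "real \<Rightarrow> complex"
  assumes "integrable lborel f" "integrable lborel g"
    and "case_prod K \<in> borel_measurable (borel \<Otimes>\<^sub>M borel)" "\<And>x y. cmod (K x y) \<le> C"
  shows "(LINT y|lborel. LINT x|lborel. K x y * (f x * g y)) = (LINT x|lborel. LINT y|lborel. K x y * (f x * g y))"
  by (rule lborel_pair.Fubini_integral[OF kernel_integrable[OF assms]])

text \<open>Read off from the known characteristic function of the standard normal distribution by
  removing the normalising factor of its density.\<close>

lemma integral_cis_gauss:
  "(LINT y|lborel. cis (t * y) * of_real (exp (- y\<^sup>2 / 2))) = of_real (sqrt (2 * pi) * exp (- t\<^sup>2 / 2))"
proof -
  have "of_real (exp (- t\<^sup>2 / 2)) = char std_normal_distribution t"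
    by (simp add: char_std_normal_distribution)
  also have "\<dots> = (LINT y|lborel. std_normal_density y *\<^sub>R cis (t * y))"
    unfolding char_def by (subst integral_density) (auto simp: cis_conv_exp mult_ac)
  also have "\<dots> = (LINT y|lborel. of_real (1 / sqrt (2 * pi)) * (cis (t * y) * of_real (exp (- y\<^sup>2 / 2))))"
    by (simp add: std_normal_density_def scaleR_conv_of_real mult_ac)
  finally have *: "complex_of_real (exp (- t\<^sup>2 / 2)) =
      of_real (1 / sqrt (2 * pi)) * (LINT y|lborel. cis (t * y) * of_real (exp (- y\<^sup>2 / 2)))"
    unfolding integral_mult_right_zero .
  have "complex_of_real c * (of_real (1 / c) * I) = I" if "c \<noteq> 0" for c I
    using that by simp
  from this[of "sqrt (2 * pi)"] show ?thesis
    unfolding of_real_mult[of "sqrt (2 * pi)"] * by simp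
qed

lemma integrable_gauss: "integrable lborel (\<lambda>y. complex_of_real (exp (- y\<^sup>2 / 2)))"
proof -
  have "integrable lborel (\<lambda>y. sqrt (2 * pi) * std_normal_density y)"
    by (intro integrable_mult_right integrable_normal_density) simp
  then have "integrable lborel (\<lambda>y :: real. exp (- y\<^sup>2 / 2))"
    by (simp add: std_normal_density_def)
  then show ?thesis
    by (rule integrable_of_real)
qed

text \<open>Gaussian regularisation: damping the inversion integral by \<open>G (\<xi> / n)\<close>
  permits Fubini, after which the Gaussian reappears as an approximate identity of width
  \<open>1 / n\<close> acting on \<open>\<psi>\<close>. Both sides then converge by dominated
  convergence.\<close>

lemma inv_fourier_fourier:
  assumes \<psi>: "\<psi> \<in> schwartz"
  shows "inv_fourier (fourier \<psi>) x = \<psi> x"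
proof -
  define G where "G = (\<lambda>y. complex_of_real (exp (- y\<^sup>2 / 2)))"
  have Gm [measurable]: "G \<in> borel_measurable borel"
    unfolding G_def by measurable
  have Gi: "integrable lborel G"
    unfolding G_def by (rule integrable_gauss)
  have Gb: "cmod (G y) \<le> 1" for y
    by (simp add: G_def)
  have [measurable]: "\<psi> \<in> borel_measurable borel" "fourier \<psi> \<in> borel_measurable borel"
    using schwartz_measurable \<psi> fourier_schwartz by auto
  obtain B where B: "0 \<le> B" "\<And>y. cmod (\<psi> y) \<le> B"
    using schwartz_bound0[OF \<psi>, where j = 0] by auto
  \<comment> \<open>Fubini followed by two rescalings. The scale \<open>Suc n\<close> avoids a
    division by zero at \<open>n = 0\<close>, and the Jacobians \<open>n\<close> and
    \<open>1 / n\<close> cancel.\<close>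
  have key: "(LINT \<xi>|lborel. (cis (\<xi> * x) * fourier \<psi> \<xi>) * G (\<xi> / real (Suc n)))
      = of_real (sqrt (2 * pi)) * (LINT v|lborel. \<psi> (x + v / real (Suc n)) * G v)" for n
  proof -
    let ?n = "real (Suc n)"
    have n0: "?n \<noteq> 0" by simp
    have Gn: "integrable lborel (\<lambda>\<xi>. G (\<xi> / ?n))"
      using lborel_integrable_real_affine[OF Gi, of "1 / ?n" 0] by simp
    have "(LINT \<xi>|lborel. (cis (\<xi> * x) * fourier \<psi> \<xi>) * G (\<xi> / ?n))
        = (LINT \<xi>|lborel. LINT y|lborel. cis (\<xi> * (x - y)) * (\<psi> y * G (\<xi> / ?n)))"
    proof (intro Bochner_Integration.integral_cong refl)
      fix \<xi>
      have cis_split: "cis (\<xi> * (x - y)) = cis (\<xi> * x) * cis (- (\<xi> * y))" for y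
        by (simp add: cis_mult algebra_simps)
      have "(LINT y|lborel. cis (\<xi> * (x - y)) * (\<psi> y * G (\<xi> / ?n)))
          = (LINT y|lborel. cis (\<xi> * x) * G (\<xi> / ?n) * (cis (- (\<xi> * y)) * \<psi> y))"
        unfolding cis_split by (simp only: mult_ac)
      then show "(cis (\<xi> * x) * fourier \<psi> \<xi>) * G (\<xi> / ?n)
          = (LINT y|lborel. cis (\<xi> * (x - y)) * (\<psi> y * G (\<xi> / ?n)))"
        by (simp add: fourier_def)
    qed
    also have "\<dots> = (LINT y|lborel. LINT \<xi>|lborel. cis (\<xi> * (x - y)) * (\<psi> y * G (\<xi> / ?n)))"
      by (rule kernel_swap[OF schwartz_integrable[OF \<psi>] Gn, where C = 1]) auto
    also have "\<dots> = (LINT y|lborel. \<psi> y * (?n * (sqrt (2 * pi) * G (?n * (x - y)))))"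
    proof (intro Bochner_Integration.integral_cong refl)
      fix y
      have "(LINT \<xi>|lborel. cis (\<xi> * (x - y)) * (\<psi> y * G (\<xi> / ?n)))
          = ?n *\<^sub>R (LINT v|lborel. cis (?n * v * (x - y)) * (\<psi> y * G v))"
        using lborel_integral_real_affine[OF n0, of "\<lambda>\<xi>. cis (\<xi> * (x - y)) * (\<psi> y * G (\<xi> / ?n))" 0] n0
        by simp
      moreover have "(LINT v|lborel. cis (?n * v * (x - y)) * (\<psi> y * G v))
          = (LINT v|lborel. \<psi> y * (cis ((?n * (x - y)) * v) * G v))"
        by (simp only: mult_ac)
      moreover have "\<dots> = \<psi> y * (sqrt (2 * pi) * G (?n * (x - y)))"
        unfolding integral_mult_right_zero G_def integral_cis_gauss by simp
      ultimately show "(LINT \<xi>|lborel. cis (\<xi> * (x - y)) * (\<psi> y * G (\<xi> / ?n)))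
          = \<psi> y * (?n * (sqrt (2 * pi) * G (?n * (x - y))))"
        by (simp only: scaleR_conv_of_real mult_ac)
    qed
    also have "\<dots> = (1 / ?n) *\<^sub>R (LINT v|lborel. \<psi> (x + 1 / ?n * v) * (?n * (sqrt (2 * pi) * G (?n * (x - (x + 1 / ?n * v))))))"
      using lborel_integral_real_affine[of "1 / ?n" "\<lambda>y. \<psi> y * (?n * (sqrt (2 * pi) * G (?n * (x - y))))" x] n0
      by simp
    also have "\<dots> = (1 / ?n) *\<^sub>R (LINT v|lborel. (of_real ?n * of_real (sqrt (2 * pi))) * (\<psi> (x + v / ?n) * G v))"
    proof -
      have "(\<lambda>v. \<psi> (x + 1 / ?n * v) * (?n * (sqrt (2 * pi) * G (?n * (x - (x + 1 / ?n * v))))))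
        = (\<lambda>v. (of_real ?n * of_real (sqrt (2 * pi))) * (\<psi> (x + v / ?n) * G v))"
        using n0 by (simp add: G_def fun_eq_iff mult_ac)
      then show ?thesis by (simp only:)
    qed
    finally show ?thesis
      unfolding integral_mult_right_zero using n0 by (simp add: scaleR_conv_of_real del: of_nat_Suc)
  qed
  have "(\<lambda>n. LINT \<xi>|lborel. (cis (\<xi> * x) * fourier \<psi> \<xi>) * G (\<xi> / real (Suc n)))
      \<longlonglongrightarrow> (LINT \<xi>|lborel. (cis (\<xi> * x) * fourier \<psi> \<xi>) * G 0)"
  proof (rule integral_dominated_convergence[where w = "\<lambda>\<xi>. cmod (fourier \<psi> \<xi>)"])
    show "integrable lborel (\<lambda>\<xi>. cmod (fourier \<psi> \<xi>))"
      using schwartz_integrable[OF fourier_schwartz[OF \<psi>]] by auto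
    have "(\<lambda>n. (cis (\<xi> * x) * fourier \<psi> \<xi>) * G (\<xi> / real (Suc n))) \<longlonglongrightarrow> (cis (\<xi> * x) * fourier \<psi> \<xi>) * G 0" for \<xi>
    proof -
      have "(\<lambda>n. \<xi> / real (Suc n)) \<longlonglongrightarrow> 0"
        by real_asymp
      moreover have "isCont G 0"
        unfolding G_def by (intro continuous_intros) auto
      ultimately have "(\<lambda>n. G (\<xi> / real (Suc n))) \<longlonglongrightarrow> G 0"
        by (rule isCont_tendsto_compose[rotated])
      then show ?thesis by (rule tendsto_mult_left)
    qed
    then show "AE \<xi> in lborel. (\<lambda>n. (cis (\<xi> * x) * fourier \<psi> \<xi>) * G (\<xi> / real (Suc n))) \<longlonglongrightarrow> (cis (\<xi> * x) * fourier \<psi> \<xi>) * G 0"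
      by auto
    show "AE \<xi> in lborel. norm ((cis (\<xi> * x) * fourier \<psi> \<xi>) * G (\<xi> / real (Suc n))) \<le> cmod (fourier \<psi> \<xi>)" for n
      using Gb by (auto simp: norm_mult intro!: AE_I2 mult_left_le)
  qed (use Gm in measurable)
  moreover have "(\<lambda>n. LINT v|lborel. \<psi> (x + v / real (Suc n)) * G v) \<longlonglongrightarrow> (LINT v|lborel. \<psi> x * G v)"
  proof (rule integral_dominated_convergence[where w = "\<lambda>v. B * cmod (G v)"])
    show "integrable lborel (\<lambda>v. B * cmod (G v))"
      using Gi by auto
    have "(\<lambda>n. \<psi> (x + v / real (Suc n)) * G v) \<longlonglongrightarrow> \<psi> x * G v" for v
    proof -
      have "(\<lambda>n. x + v / real (Suc n)) \<longlonglongrightarrow> x"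
        by real_asymp
      moreover have "isCont \<psi> x"
        using schwartz_continuous[OF \<psi>] by (simp add: continuous_on_eq_continuous_at)
      ultimately have "(\<lambda>n. \<psi> (x + v / real (Suc n))) \<longlonglongrightarrow> \<psi> x"
        by (rule isCont_tendsto_compose[rotated])
      then show ?thesis by (rule tendsto_mult_right)
    qed
    then show "AE v in lborel. (\<lambda>n. \<psi> (x + v / real (Suc n)) * G v) \<longlonglongrightarrow> \<psi> x * G v"
      by auto
    show "AE v in lborel. norm (\<psi> (x + v / real (Suc n)) * G v) \<le> B * cmod (G v)" for n
      using B by (auto simp: norm_mult intro!: AE_I2 mult_right_mono)
  qed measurable
  then have "(\<lambda>n. of_real (sqrt (2 * pi)) * (LINT v|lborel. \<psi> (x + v / real (Suc n)) * G v)) \<longlonglongrightarrow> of_real (sqrt (2 * pi)) * (LINT v|lborel. \<psi> x * G v)"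
    by (rule tendsto_mult_left)
  ultimately have "(LINT \<xi>|lborel. (cis (\<xi> * x) * fourier \<psi> \<xi>) * G 0) = of_real (sqrt (2 * pi)) * (LINT v|lborel. \<psi> x * G v)"
    unfolding key by (rule LIMSEQ_unique)
  moreover have "(LINT v|lborel. G v) = of_real (sqrt (2 * pi))"
    using integral_cis_gauss[of 0] by (simp add: G_def)
  ultimately have "(LINT \<xi>|lborel. cis (\<xi> * x) * fourier \<psi> \<xi>) = of_real (sqrt (2 * pi)) * (\<psi> x * of_real (sqrt (2 * pi)))"
    by (simp add: G_def)
  \<comment> \<open>One factor is the constant in the transform of the Gaussian, the other is its
    total mass; the product cancels the \<open>2 * pi\<close> in \<open>inv_fourier\<close>.\<close>
  also have "\<dots> = of_real (sqrt (2 * pi) * sqrt (2 * pi)) * \<psi> x"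
    by (simp only: of_real_mult mult_ac)
  finally show ?thesis
    by (simp add: inv_fourier_def)
qed

lemma fourier_inv_fourier:
  assumes "\<psi> \<in> schwartz"
  shows "fourier (inv_fourier \<psi>) x = \<psi> x"
proof -
  have "fourier (inv_fourier \<psi>) x = (LINT y|lborel. cis (- (x * y)) * (fourier \<psi> (- y) / (2 * pi)))"
    by (simp add: fourier_def[of "inv_fourier \<psi>"] inv_fourier_eq)
  also have "\<dots> = (LINT y|lborel. cis (x * y) * (fourier \<psi> y / (2 * pi)))"
    using lborel_integral_real_affine[of "-1" "\<lambda>y. cis (x * y) * (fourier \<psi> y / (2 * pi))" 0] by simp
  also have "\<dots> = inv_fourier (fourier \<psi>) x"
    by (simp add: inv_fourier_def mult.commute)
  finally show ?thesis
    using inv_fourier_fourier[OF assms] by simp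
qed


section \<open>Distributions whose Fourier transform is a function\<close>

lemma inv_fourier_measurable:
  assumes "g \<in> borel_measurable borel"
  shows "inv_fourier g \<in> borel_measurable borel"
  unfolding inv_fourier_def[abs_def] using assms by measurable

lemma inv_fourier_bounded:
  assumes "integrable lborel g"
  shows "cmod (inv_fourier g x) \<le> (LINT \<xi>|lborel. cmod (g \<xi>))"
proof -
  have "cmod (inv_fourier g x) \<le> cmod (LINT \<xi>|lborel. cis (\<xi> * x) * g \<xi>) / 1"
    unfolding inv_fourier_def norm_divide using pi_ge_two by (intro divide_left_mono) auto
  also have "\<dots> \<le> (LINT \<xi>|lborel. cmod (g \<xi>))"
    using norm_cis_integral_le[OF assms, of "\<lambda>\<xi>. \<xi> * x"] by simp
  finally show ?thesis .
qed

lemma tapply_inv_fourier: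
  assumes "integrable lborel g" "\<psi> \<in> schwartz"
  shows "tapply (tdist_of_fun (inv_fourier g)) \<psi> = (LINT x|lborel. inv_fourier g x * \<psi> x)"
  by (rule tapply_tdist_of_fun[OF inv_fourier_measurable inv_fourier_bounded[OF assms(1)] assms(2)])
     (use assms(1) in auto)

lemma tapply_inv_fourier_eq:
  assumes g: "integrable lborel g" and \<psi>: "\<psi> \<in> schwartz"
  shows "tapply (tdist_of_fun (inv_fourier g)) \<psi> = (LINT \<xi>|lborel. g \<xi> * inv_fourier \<psi> \<xi>)"
proof -
  have "tapply (tdist_of_fun (inv_fourier g)) \<psi> = (LINT x|lborel. LINT \<xi>|lborel. (cis (\<xi> * x) / (2 * pi)) * (g \<xi> * \<psi> x))"
    unfolding tapply_inv_fourier[OF g \<psi>]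
  proof (intro Bochner_Integration.integral_cong refl)
    fix x
    have "(LINT \<xi>|lborel. (cis (\<xi> * x) / (2 * pi)) * (g \<xi> * \<psi> x)) = (LINT \<xi>|lborel. (\<psi> x / (2 * pi)) * (cis (\<xi> * x) * g \<xi>))"
      by (intro Bochner_Integration.integral_cong) auto
    then show "inv_fourier g x * \<psi> x = (LINT \<xi>|lborel. (cis (\<xi> * x) / (2 * pi)) * (g \<xi> * \<psi> x))"
      by (simp add: inv_fourier_def)
  qed
  also have "\<dots> = (LINT \<xi>|lborel. LINT x|lborel. (cis (\<xi> * x) / (2 * pi)) * (g \<xi> * \<psi> x))"
    by (rule kernel_swap[OF g schwartz_integrable[OF \<psi>], where C = "1 / (2 * pi)"]) (auto simp: norm_divide)
  also have "\<dots> = (LINT \<xi>|lborel. g \<xi> * inv_fourier \<psi> \<xi>)"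
  proof (intro Bochner_Integration.integral_cong refl)
    fix \<xi>
    have "(LINT x|lborel. (cis (\<xi> * x) / (2 * pi)) * (g \<xi> * \<psi> x)) = (LINT x|lborel. (g \<xi> / (2 * pi)) * (cis (x * \<xi>) * \<psi> x))"
      by (intro Bochner_Integration.integral_cong) (auto simp: mult.commute)
    then show "(LINT x|lborel. (cis (\<xi> * x) / (2 * pi)) * (g \<xi> * \<psi> x)) = g \<xi> * inv_fourier \<psi> \<xi>"
      by (simp add: inv_fourier_def)
  qed
  finally show ?thesis .
qed

text \<open>By Fubini the pairing with \<open>fourier \<psi>\<close> becomes the pairing of
  \<open>g\<close> with \<open>inv_fourier (fourier \<psi>)\<close>, which is \<open>\<psi>\<close>.
  The explicit distributions below are all built in this way from their transforms.\<close>

lemma has_fourier_inv_fourier: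
  assumes g: "integrable lborel g"
  shows "has_fourier (tdist_of_fun (inv_fourier g)) g"
  unfolding has_fourier_def
proof (intro conjI ballI)
  fix \<psi> assume \<psi>: "\<psi> \<in> schwartz"
  obtain B where B: "\<And>y. cmod (\<psi> y) \<le> B"
    using schwartz_bound0[OF \<psi>, where j = 0] by auto
  show "integrable lborel (\<lambda>\<xi>. g \<xi> * \<psi> \<xi>)"
    using integrable_bounded_mult[OF g, of \<psi> B] B schwartz_measurable[OF \<psi>] by (simp add: mult.commute)
  show "tapply (tdist_of_fun (inv_fourier g)) (fourier \<psi>) = (LINT \<xi>|lborel. g \<xi> * \<psi> \<xi>)"
    using tapply_inv_fourier_eq[OF g fourier_schwartz[OF \<psi>]] inv_fourier_fourier[OF \<psi>] by simp
qed (use g in auto)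

lemma tdist_eqI:
  assumes "\<And>\<psi>. \<psi> \<in> schwartz \<Longrightarrow> tapply u \<psi> = tapply v \<psi>"
  shows "u = v"
proof -
  have "tapply w \<psi> = 0" if "\<psi> \<notin> schwartz" for w \<psi>
    using tapply[of w] that by (auto simp: tempered_def)
  then have "tapply u = tapply v"
    using assms by (metis ext)
  then show ?thesis
    by (simp add: tapply_inject)
qed

text \<open>Every Schwartz function is the transform of one, namely of its inverse transform, so the
  values prescribed by \<open>has_fourier\<close> exhaust all test functions.\<close>

lemma has_fourier_inject:
  assumes "has_fourier u g" "has_fourier v g"
  shows "u = v"
proof (rule tdist_eqI)
  fix \<psi> assume \<psi>: "\<psi> \<in> schwartz"
  have "tapply u (fourier (inv_fourier \<psi>)) = tapply v (fourier (inv_fourier \<psi>))"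
    using assms inv_fourier_schwartz[OF \<psi>] unfolding has_fourier_def by simp
  moreover have "fourier (inv_fourier \<psi>) = \<psi>"
    using fourier_inv_fourier[OF \<psi>] by auto
  ultimately show "tapply u \<psi> = tapply v \<psi>" by simp
qed

lemma has_fourier_cong_AE:
  assumes "has_fourier u g" "h \<in> borel_measurable borel" "AE \<xi> in lborel. g \<xi> = h \<xi>"
  shows "has_fourier u h"
  unfolding has_fourier_def
proof (intro conjI ballI)
  fix \<psi> assume \<psi>: "\<psi> \<in> schwartz"
  have [measurable]: "g \<in> borel_measurable borel" "h \<in> borel_measurable borel" "\<psi> \<in> borel_measurable borel"
    using assms schwartz_measurable[OF \<psi>] by (auto simp: has_fourier_def)
  have ae: "AE \<xi> in lborel. g \<xi> * \<psi> \<xi> = h \<xi> * \<psi> \<xi>"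
    using assms(3) by eventually_elim simp
  have "integrable lborel (\<lambda>\<xi>. g \<xi> * \<psi> \<xi>)" and eq: "tapply u (fourier \<psi>) = (LINT \<xi>|lborel. g \<xi> * \<psi> \<xi>)"
    using assms(1) \<psi> by (auto simp: has_fourier_def)
  then show "integrable lborel (\<lambda>\<xi>. h \<xi> * \<psi> \<xi>)"
    using integrable_cong_AE[OF _ _ ae] by simp
  show "tapply u (fourier \<psi>) = (LINT \<xi>|lborel. h \<xi> * \<psi> \<xi>)"
    unfolding eq by (rule integral_cong_AE[OF _ _ ae]) auto
qed (use assms in auto)

lemma has_fourier_diff:
  assumes "has_fourier u g" "has_fourier v h"
  shows "has_fourier (u - v) (\<lambda>\<xi>. g \<xi> - h \<xi>)"
  using assms unfolding has_fourier_def by (auto simp: minus_tdist.rep_eq left_diff_distrib)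

lemma has_fourier_scaleR:
  assumes "has_fourier u g"
  shows "has_fourier (c *\<^sub>R u) (\<lambda>\<xi>. c *\<^sub>R g \<xi>)"
  using assms unfolding has_fourier_def
  by (auto simp: scaleR_tdist.rep_eq scaleR_conv_of_real mult.assoc)

subsection \<open>Uniqueness of the Fourier transform as a function\<close>

lemma power_le_fact_mult_exp:
  fixes y :: real
  assumes "0 \<le> y"
  shows "y ^ n \<le> fact n * exp y"
proof -
  have "(\<Sum>k\<in>{n}. y ^ k /\<^sub>R fact k) \<le> (\<Sum>k. y ^ k /\<^sub>R fact k)"
    using assms by (intro sum_le_suminf summable_exp_generic) auto
  then show ?thesis
    by (simp add: exp_def divide_inverse[symmetric] field_simps)
qed

text \<open>These test functions suffice to separate functions: pairing with them evaluates the
  Fourier transform of the Gaussian-damped function at every frequency.\<close>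

lemma schwartz_modulated_gauss:
  "(\<lambda>x. cis (a * x) * of_real (exp (- x\<^sup>2 / 2))) \<in> schwartz"
proof (rule schwartzI)
  let ?E = "\<lambda>x. cis (a * x) * complex_of_real (exp (- x\<^sup>2 / 2))"
  \<comment> \<open>Differentiating a polynomial \<open>p\<close> times
    \<open>exp (\<i> * a * x - x\<^sup>2 / 2)\<close> multiplies \<open>p\<close> by the derivative
    \<open>\<i> * a - x\<close> of the exponent and adds \<open>pderiv p\<close>.\<close>
  define P :: "nat \<Rightarrow> complex poly" where
    "P = (\<lambda>k. ((\<lambda>p. pderiv p + [: \<i> * of_real a, - 1 :] * p) ^^ k) 1)"
  let ?F = "\<lambda>k x. poly (P k) (of_real x) * ?E x"
  show "?F 0 = ?E"
    by (simp add: P_def)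
  show "(?F k has_vector_derivative ?F (Suc k) x) (at x)" for k x
  proof -
    have "((\<lambda>z. poly (P k) z * exp (\<i> * of_real a * z - z\<^sup>2 / 2)) has_field_derivative
        poly (P (Suc k)) (of_real x) * exp (\<i> * of_real a * of_real x - (of_real x)\<^sup>2 / 2)) (at (of_real x))"
      unfolding P_def
      by (auto intro!: derivative_eq_intros poly_DERIV simp: algebra_simps)
    moreover have "exp (\<i> * of_real a * of_real y - (of_real y)\<^sup>2 / 2) = ?E y" for y
      by (simp add: cis_conv_exp exp_of_real[symmetric] mult_exp_exp mult.assoc)
    ultimately show ?thesis
      using has_vector_derivative_real_field by fastforce
  qed
  have E: "cmod (?E x) = exp (- x\<^sup>2 / 2)" for x
    by (simp add: norm_mult)
  \<comment> \<open>One term of the exponential series at \<open>x\<^sup>2 / 2\<close> absorbs an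
    even power; the summand 1 reduces an arbitrary power \<open>n\<close> to the even power
    \<open>2 * n\<close>.\<close>
  have pow: "\<bar>x\<bar> ^ n * cmod (?E x) \<le> 1 + 2 ^ n * fact n" for n and x :: real
  proof -
    have "\<bar>x\<bar> ^ n \<le> 1 + \<bar>x\<bar> ^ (2 * n)"
      by (cases "\<bar>x\<bar> \<le> 1") (auto simp: power_le_one add_increasing2 add_increasing intro: order_trans[OF power_increasing])
    also have "\<bar>x\<bar> ^ (2 * n) = (x\<^sup>2) ^ n"
      by (simp add: power_mult)
    also have "(x\<^sup>2) ^ n = 2 ^ n * (x\<^sup>2 / 2) ^ n"
      by (simp add: power_divide)
    also have "\<dots> \<le> 2 ^ n * (fact n * exp (x\<^sup>2 / 2))"
      using power_le_fact_mult_exp[of "x\<^sup>2 / 2" n] by (intro mult_left_mono) auto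
    finally have "\<bar>x\<bar> ^ n \<le> 1 + 2 ^ n * (fact n * exp (x\<^sup>2 / 2))" by simp
    from mult_right_mono[OF this, of "exp (- x\<^sup>2 / 2)"]
    have "\<bar>x\<bar> ^ n * exp (- x\<^sup>2 / 2) \<le> exp (- x\<^sup>2 / 2) + 2 ^ n * fact n"
      by (simp add: algebra_simps exp_minus)
    also have "exp (- x\<^sup>2 / 2) \<le> 1" by simp
    finally show ?thesis unfolding E by simp
  qed
  show "\<exists>B. \<forall>x. \<bar>x\<bar> ^ j * cmod (?F k x) \<le> B" for k j
  proof -
    have "\<exists>B. \<forall>x. \<bar>x\<bar> ^ j * cmod (poly p (of_real x) * ?E x) \<le> B" for p j
    proof (induction p arbitrary: j)
      case (pCons c p)
      have "\<exists>B. \<forall>x. \<bar>x\<bar> ^ j * cmod (c * ?E x + of_real x * (poly p (of_real x) * ?E x)) \<le> B"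
      proof (rule bounded_weighted_add)
        show "\<exists>B. \<forall>x. \<bar>x\<bar> ^ j * cmod (c * ?E x) \<le> B"
          using pow by (intro bounded_weighted_cmult) blast
        show "\<exists>B. \<forall>x. \<bar>x\<bar> ^ j * cmod (of_real x * (poly p (of_real x) * ?E x)) \<le> B"
          using pCons.IH[of "Suc j"] by (simp add: norm_mult mult_ac)
      qed
      then show ?case by (simp add: algebra_simps)
    qed auto
    then show ?thesis by blast
  qed
qed

text \<open>The positive and negative parts of \<open>G\<close> have equal transforms and, at
  frequency 0, equal masses. After normalisation they are probability densities with the same
  characteristic function, so Levy's uniqueness theorem applies.\<close>

lemma real_zero_of_fourier_zero:
  fixes G :: "real \<Rightarrow> real"
  assumes G: "integrable lborel G" and 0: "\<And>a. (LINT x|lborel. cis (a * x) * of_real (G x)) = 0"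
  shows "AE x in lborel. G x = 0"
proof -
  define p q where "p = (\<lambda>x. max 0 (G x))" and "q = (\<lambda>x. max 0 (- G x))"
  have [measurable]: "G \<in> borel_measurable borel" "p \<in> borel_measurable borel" "q \<in> borel_measurable borel"
    using G unfolding p_def q_def by auto
  have nn: "0 \<le> p x" "0 \<le> q x" for x
    by (auto simp: p_def q_def)
  have pq: "integrable lborel p" "integrable lborel q"
    using G unfolding p_def q_def by auto
  have G_eq: "G x = p x - q x" for x
    by (auto simp: p_def q_def)
  have cis_int: "integrable lborel (\<lambda>x. cis (a * x) * of_real (h x))" if "integrable lborel h" for a and h :: "real \<Rightarrow> real"
    by (rule integrable_cis_mult) (use that in auto)
  have eq: "(LINT x|lborel. cis (a * x) * of_real (p x)) = (LINT x|lborel. cis (a * x) * of_real (q x))" for a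
    using 0[of a] cis_int[OF pq(1), of a] cis_int[OF pq(2), of a] by (simp add: G_eq right_diff_distrib)
  define c where "c = (LINT x|lborel. p x)"
  have cq: "(LINT x|lborel. q x) = c"
  proof -
    have "complex_of_real c = of_real (LINT x|lborel. q x)"
      using eq[of 0] by (simp add: c_def)
    then show ?thesis by (simp only: of_real_eq_iff)
  qed
  have "0 \<le> c"
    unfolding c_def using nn by (intro Bochner_Integration.integral_nonneg) auto
  \<comment> \<open>Normalisation requires positive mass. If the common mass is 0, both parts vanish
    almost everywhere.\<close>
  show ?thesis
  proof (cases "c = 0")
    case True
    then have "AE x in lborel. p x = 0" "AE x in lborel. q x = 0"
      using integral_nonneg_eq_0_iff_AE[OF pq(1)] integral_nonneg_eq_0_iff_AE[OF pq(2)] nn cq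
      by (auto simp: c_def)
    then show ?thesis
      by eventually_elim (simp add: G_eq)
  next
    case False
    with \<open>0 \<le> c\<close> have c: "0 < c" by simp
    have dist: "real_distribution (density lborel (\<lambda>x. ennreal (h x / c)))"
      if h: "integrable lborel h" "\<And>x. 0 \<le> h x" "(LINT x|lborel. h x) = c" for h
    proof -
      have [measurable]: "h \<in> borel_measurable borel" using h by auto
      have "(\<integral>\<^sup>+x. ennreal (h x / c) \<partial>lborel) = ennreal (LINT x|lborel. h x / c)"
        using h c by (intro nn_integral_eq_integral) auto
      also have "\<dots> = 1" using h c by simp
      finally have "prob_space (density lborel (\<lambda>x. ennreal (h x / c)))"
        by (intro prob_spaceI) (simp add: emeasure_density)
      then show ?thesis
        by (simp add: real_distribution_def real_distribution_axioms_def)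
    qed
    have chr: "char (density lborel (\<lambda>x. ennreal (h x / c))) t = (LINT x|lborel. cis (t * x) * of_real (h x)) / c"
      if h: "integrable lborel h" "\<And>x. 0 \<le> h x" for h t
    proof -
      have [measurable]: "h \<in> borel_measurable borel" using h by auto
      have "char (density lborel (\<lambda>x. ennreal (h x / c))) t = (LINT x|lborel. (h x / c) *\<^sub>R iexp (t * x))"
        unfolding char_def using h c by (subst integral_density) auto
      also have "\<dots> = (LINT x|lborel. (cis (t * x) * of_real (h x)) / c)"
        by (simp add: cis_conv_exp scaleR_conv_of_real mult.commute)
      finally show ?thesis by simp
    qed
    have "density lborel (\<lambda>x. ennreal (p x / c)) = density lborel (\<lambda>x. ennreal (q x / c))"
      by (rule Levy_uniqueness) (use dist pq nn cq c_def chr eq in \<open>auto simp: fun_eq_iff\<close>)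
    then have "AE x in lborel. ennreal (p x / c) = ennreal (q x / c)"
      by (subst (asm) sigma_finite_measure.density_unique_iff[OF sigma_finite_lborel]) auto
    then show ?thesis
      by eventually_elim (use nn c in \<open>simp add: G_eq\<close>)
  qed
qed

text \<open>The difference of the two candidates need not be integrable, but it becomes so after
  multiplication by the Gaussian, which is itself a test function. The real-valued result is then
  applied to the real and imaginary parts.\<close>

lemma has_fourier_unique:
  assumes "has_fourier u g" "has_fourier u h"
  shows "AE \<xi> in lborel. g \<xi> = h \<xi>"
proof -
  define E where "E = (\<lambda>x. exp (- x\<^sup>2 / 2) :: real)"
  define d where "d = (\<lambda>x. g x - h x)"
  have z: "integrable lborel (\<lambda>x. d x * (cis (a * x) * of_real (E x)))"
    "(LINT x|lborel. d x * (cis (a * x) * of_real (E x))) = 0" for a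
    using assms schwartz_modulated_gauss[of a] unfolding has_fourier_def d_def E_def
    by (auto simp: left_diff_distrib)
  have i: "integrable lborel (\<lambda>x. d x * of_real (E x))"
    using z(1)[of 0] by simp
  then have ri: "integrable lborel (\<lambda>x. Re (d x) * E x)" "integrable lborel (\<lambda>x. Im (d x) * E x)"
    using integrable_Re[OF i] integrable_Im[OF i] by auto
  have ci: "integrable lborel (\<lambda>x. cis (a * x) * of_real (f x))" if "integrable lborel f" for a and f :: "real \<Rightarrow> real"
    by (rule integrable_cis_mult) (use that in auto)
  let ?R = "\<lambda>a. LINT x|lborel. cis (a * x) * of_real (Re (d x) * E x)"
  let ?I = "\<lambda>a. LINT x|lborel. cis (a * x) * of_real (Im (d x) * E x)"
  have 1: "?R a + \<i> * ?I a = 0" for a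
  proof -
    have "?R a + \<i> * ?I a = (LINT x|lborel. cis (a * x) * of_real (Re (d x) * E x) + \<i> * (cis (a * x) * of_real (Im (d x) * E x)))"
      using ci[OF ri(1), of a] ci[OF ri(2), of a] by simp
    also have "\<dots> = (LINT x|lborel. d x * (cis (a * x) * of_real (E x)))"
      by (intro Bochner_Integration.integral_cong refl) (simp add: complex_eq_iff algebra_simps)
    finally show ?thesis using z(2) by simp
  qed
  have cnjs: "cnj (LINT x|lborel. cis (- a * x) * of_real (f x)) = (LINT x|lborel. cis (a * x) * of_real (f x))" for a and f :: "real \<Rightarrow> real"
  proof -
    have "cnj (LINT x|lborel. cis (- a * x) * of_real (f x)) = (LINT x|lborel. cnj (cis (- a * x) * of_real (f x)))"
      by (rule Bochner_Integration.integral_cnj[symmetric])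
    also have "\<dots> = (LINT x|lborel. cis (a * x) * of_real (f x))"
      by (intro Bochner_Integration.integral_cong refl) (simp only: complex_cnj_mult cis_cnj complex_cnj_complex_of_real mult_minus_left minus_minus)
    finally show ?thesis .
  qed
  \<comment> \<open>Conjugating the relation at \<open>- a\<close> reverses the sign in front of
    \<open>?I\<close>, so the transforms of the real and imaginary parts vanish separately.\<close>
  have 2: "?R a - \<i> * ?I a = 0" for a
    using arg_cong[OF 1[of "- a"], of cnj] unfolding complex_cnj_add complex_cnj_mult cnjs by simp
  have "?R a = 0" "?I a = 0" for a
    using 1[of a] 2[of a] by (auto simp: complex_eq_iff)
  then have "AE x in lborel. Re (d x) * E x = 0" "AE x in lborel. Im (d x) * E x = 0"
    using real_zero_of_fourier_zero[OF ri(1)] real_zero_of_fourier_zero[OF ri(2)] by auto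
  then show ?thesis
    by eventually_elim (simp add: E_def d_def complex_eq_iff)
qed

lemma has_fourier_fhat: "has_fourier u g \<Longrightarrow> has_fourier u (fhat u)"
  unfolding fhat_def by (rule someI[of "has_fourier u"])

lemma fhat_AE:
  assumes "has_fourier u g"
  shows "AE \<xi> in lborel. fhat u \<xi> = g \<xi>"
  by (rule has_fourier_unique[OF has_fourier_fhat[OF assms] assms])

text \<open>Bridges two choices: \<open>fhat u\<close> is fixed only up to a null set, which
  \<open>has_fourier\<close> does not see, and the definite description is resolved by injectivity
  of the transform. Any convenient representative \<open>g\<close> may thus be used.\<close>

lemma fourier_mult_eqI:
  assumes "has_fourier u g" "has_fourier v (\<lambda>\<xi>. m \<xi> * g \<xi>)" "m \<in> borel_measurable borel"
  shows "fourier_mult m u = v"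
proof -
  have [measurable]: "fhat u \<in> borel_measurable borel" "m \<in> borel_measurable borel"
    using has_fourier_fhat[OF assms(1)] assms(3) by (auto simp: has_fourier_def)
  have "AE \<xi> in lborel. m \<xi> * g \<xi> = m \<xi> * fhat u \<xi>"
    using fhat_AE[OF assms(1)] by eventually_elim simp
  then have "has_fourier v (\<lambda>\<xi>. m \<xi> * fhat u \<xi>)"
    by (rule has_fourier_cong_AE[OF assms(2), rotated]) measurable
  then show ?thesis
    unfolding fourier_mult_def by (auto intro: has_fourier_inject)
qed


section \<open>Convolution and the weight\<close>

definition conv :: "(real \<Rightarrow> complex) \<Rightarrow> (real \<Rightarrow> complex) \<Rightarrow> real \<Rightarrow> complex" where
  "conv f g \<xi> = (LINT \<eta>|lborel. f (\<xi> - \<eta>) * g \<eta>)"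

text \<open>Both factors and the evaluation point may depend on a parameter, because
  \<open>conv (U \<tau>) (U \<tau>) \<xi>\<close> has to be jointly measurable in time and frequency
  for Fubini.\<close>

lemma conv_measurable [measurable (raw)]:
  assumes [measurable]: "case_prod f \<in> borel_measurable (N \<Otimes>\<^sub>M borel)"
    "case_prod g \<in> borel_measurable (N \<Otimes>\<^sub>M borel)" "h \<in> borel_measurable N"
  shows "(\<lambda>x. conv (f x) (g x) (h x)) \<in> borel_measurable N"
  unfolding conv_def by measurable

lemma conv_commute: "conv f g \<xi> = conv g f \<xi>"
  unfolding conv_def
  using lborel_integral_real_affine[of "-1" "\<lambda>\<eta>. f (\<xi> - \<eta>) * g \<eta>" \<xi>] by (simp add: mult.commute)

lemma integrable_conv_kernel:
  fixes f g :: "real \<Rightarrow> complex"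
  assumes f: "integrable lborel f" and g: "integrable lborel g"
  shows "integrable (lborel \<Otimes>\<^sub>M lborel) (\<lambda>(\<eta>, \<xi>). f (\<xi> - \<eta>) * g \<eta>)"
proof (rule lborel_pair.Fubini_integrable)
  have [measurable]: "f \<in> borel_measurable borel" "g \<in> borel_measurable borel"
    using f g by auto
  show "(\<lambda>(\<eta>, \<xi>). f (\<xi> - \<eta>) * g \<eta>) \<in> borel_measurable (lborel \<Otimes>\<^sub>M lborel)"
    by measurable
  have shift: "integrable lborel (\<lambda>\<xi>. f (\<xi> - \<eta>))" for \<eta>
    using lborel_integrable_real_affine[OF f, of 1 "- \<eta>"] by simp
  then show "AE \<eta> in lborel. integrable lborel (\<lambda>\<xi>. case (\<eta>, \<xi>) of (\<eta>, \<xi>) \<Rightarrow> f (\<xi> - \<eta>) * g \<eta>)"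
    by auto
  have "(LINT \<xi>|lborel. cmod (f (\<xi> - \<eta>))) = (LINT \<xi>|lborel. cmod (f \<xi>))" for \<eta>
    using lborel_integral_real_affine[of 1 "\<lambda>\<xi>. cmod (f \<xi>)" "- \<eta>"] by simp
  then show "integrable lborel (\<lambda>\<eta>. LINT \<xi>|lborel. norm (case (\<eta>, \<xi>) of (\<eta>, \<xi>) \<Rightarrow> f (\<xi> - \<eta>) * g \<eta>))"
    using g by (simp add: norm_mult)
qed

lemma conv_integrable:
  assumes "integrable lborel f" "integrable lborel g"
  shows "integrable lborel (conv f g)"
  using lborel_pair.integrable_snd[OF integrable_conv_kernel[OF assms]] unfolding conv_def[abs_def] .

lemma inv_fourier_mult:
  assumes f: "integrable lborel f" and g: "integrable lborel g"
  shows "inv_fourier f x * inv_fourier g x = inv_fourier (\<lambda>\<xi>. conv f g \<xi> / (2 * pi)) x"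
proof -
  have i: "integrable (lborel \<Otimes>\<^sub>M lborel) (\<lambda>(\<eta>, \<xi>). cis (\<xi> * x) * (f (\<xi> - \<eta>) * g \<eta>))"
    using integrable_bounded_mult[OF integrable_conv_kernel[OF f g], of "\<lambda>p. cis (snd p * x)" 1]
    by (simp add: split_beta')
  have "(LINT \<xi>|lborel. cis (\<xi> * x) * conv f g \<xi>) = (LINT \<xi>|lborel. LINT \<eta>|lborel. cis (\<xi> * x) * (f (\<xi> - \<eta>) * g \<eta>))"
    by (simp add: conv_def)
  also have "\<dots> = (LINT \<eta>|lborel. LINT \<xi>|lborel. cis (\<xi> * x) * (f (\<xi> - \<eta>) * g \<eta>))"
    by (rule lborel_pair.Fubini_integral[OF i])
  also have "\<dots> = (LINT \<eta>|lborel. (LINT \<zeta>|lborel. cis (\<zeta> * x) * f \<zeta>) * (cis (\<eta> * x) * g \<eta>))"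
  proof (intro Bochner_Integration.integral_cong refl)
    fix \<eta>
    have "(LINT \<xi>|lborel. cis (\<xi> * x) * (f (\<xi> - \<eta>) * g \<eta>)) = (LINT \<zeta>|lborel. cis ((\<eta> + \<zeta>) * x) * (f \<zeta> * g \<eta>))"
      using lborel_integral_real_affine[of 1 "\<lambda>\<xi>. cis (\<xi> * x) * (f (\<xi> - \<eta>) * g \<eta>)" \<eta>] by simp
    also have "\<dots> = (LINT \<zeta>|lborel. (cis (\<zeta> * x) * f \<zeta>) * (cis (\<eta> * x) * g \<eta>))"
    proof (intro Bochner_Integration.integral_cong refl)
      fix \<zeta>
      have "cis ((\<eta> + \<zeta>) * x) = cis (\<zeta> * x) * cis (\<eta> * x)"
        by (simp add: cis_mult algebra_simps)
      then show "cis ((\<eta> + \<zeta>) * x) * (f \<zeta> * g \<eta>) = (cis (\<zeta> * x) * f \<zeta>) * (cis (\<eta> * x) * g \<eta>)"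
        by simp
    qed
    finally show "(LINT \<xi>|lborel. cis (\<xi> * x) * (f (\<xi> - \<eta>) * g \<eta>)) =
        (LINT \<zeta>|lborel. cis (\<zeta> * x) * f \<zeta>) * (cis (\<eta> * x) * g \<eta>)"
      by simp
  qed
  finally show ?thesis
    by (simp add: inv_fourier_def)
qed

text \<open>Since \<open>\<xi> = (\<xi> - \<eta>) + \<eta>\<close>, the number
  \<open>1 + \<xi>\<^sup>2\<close> is at most twice the sum of
  \<open>1 + (\<xi> - \<eta>)\<^sup>2\<close> and \<open>1 + \<eta>\<^sup>2\<close>; divide by the
  product of all three.\<close>

lemma wt_mult_le: "wt (\<xi> - \<eta>) * wt \<eta> \<le> 2 * wt \<xi> * (wt (\<xi> - \<eta>) + wt \<eta>)"
proof -
  define p q r where "p = 1 + (\<xi> - \<eta>)\<^sup>2" and "q = 1 + \<eta>\<^sup>2" and "r = 1 + \<xi>\<^sup>2"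
  have pos: "0 < p" "0 < q" "0 < r"
    by (auto simp: p_def q_def r_def intro: add_pos_nonneg)
  have "\<xi>\<^sup>2 \<le> 2 * (\<xi> - \<eta>)\<^sup>2 + 2 * \<eta>\<^sup>2"
    using zero_le_power2[of "\<xi> - 2 * \<eta>"] by (simp add: power2_eq_square algebra_simps)
  then have "r \<le> 2 * (p + q)"
    by (simp add: p_def q_def r_def)
  then have "inverse p * inverse q \<le> 2 * inverse r * (inverse p + inverse q)"
    using pos by (simp add: field_simps)
  then show ?thesis
    by (simp add: wt_def p_def q_def r_def)
qed

lemma wt_shift: "integrable lborel (\<lambda>\<eta>. wt (\<xi> - \<eta>))" "(LINT \<eta>|lborel. wt (\<xi> - \<eta>)) = pi"
  using lborel_integrable_real_affine[OF wt_integrable, of "-1" \<xi>]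
    lborel_integral_real_affine[of "-1" wt \<xi>] wt_integral by simp_all

text \<open>Stability of the weight under convolution. The constant is 2 from
  \<open>wt_mult_le\<close> times the integral \<open>pi\<close> of each of the two remaining
  weights.\<close>

lemma conv_bound:
  assumes "\<And>\<xi>. cmod (f \<xi>) \<le> a * wt \<xi>" "\<And>\<xi>. cmod (g \<xi>) \<le> b * wt \<xi>"
  shows "cmod (conv f g \<xi>) \<le> 4 * pi * a * b * wt \<xi>"
proof -
  have nn: "0 \<le> c" if "\<And>\<xi>. cmod (h \<xi>) \<le> c * wt \<xi>" for h c
    using order_trans[OF norm_ge_zero that[of 0]] by (simp add: wt_def)
  have ab: "0 \<le> a" "0 \<le> b"
    using nn assms by blast+
  have "cmod (conv f g \<xi>) \<le> (LINT \<eta>|lborel. a * b * (2 * wt \<xi> * (wt (\<xi> - \<eta>) + wt \<eta>)))"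
    unfolding conv_def
  proof (rule norm_integral_le)
    show "integrable lborel (\<lambda>\<eta>. a * b * (2 * wt \<xi> * (wt (\<xi> - \<eta>) + wt \<eta>)))"
      using wt_integrable wt_shift by auto
    fix \<eta>
    have "cmod (f (\<xi> - \<eta>) * g \<eta>) \<le> (a * wt (\<xi> - \<eta>)) * (b * wt \<eta>)"
      unfolding norm_mult using assms ab wt_nonneg by (intro mult_mono) auto
    also have "\<dots> = a * b * (wt (\<xi> - \<eta>) * wt \<eta>)" by simp
    also have "\<dots> \<le> a * b * (2 * wt \<xi> * (wt (\<xi> - \<eta>) + wt \<eta>))"
      using ab by (intro mult_left_mono wt_mult_le) auto
    finally show "cmod (f (\<xi> - \<eta>) * g \<eta>) \<le> a * b * (2 * wt \<xi> * (wt (\<xi> - \<eta>) + wt \<eta>))" .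
  qed
  also have "\<dots> = a * b * (2 * wt \<xi> * (pi + pi))"
    using wt_integrable wt_shift wt_integral by simp
  finally show ?thesis by (simp add: mult_ac)
qed

lemma wt_bounded_mult_integrable:
  assumes "f \<in> borel_measurable borel" "\<And>\<xi>. cmod (f \<xi>) \<le> a * wt \<xi>" "integrable lborel g"
  shows "integrable lborel (\<lambda>\<eta>. f (\<xi> - \<eta>) * g \<eta>)"
proof (rule integrable_bounded_mult[OF assms(3)])
  have "0 \<le> a"
    using order_trans[OF norm_ge_zero assms(2)[of 0]] by (simp add: wt_def)
  then have "a * wt \<xi> \<le> a" for \<xi>
    using wt_le_1 by (simp add: mult_left_le)
  then show "cmod (f (\<xi> - \<eta>)) \<le> a" for \<eta>
    using assms(2) order_trans by blast
qed (use assms in measurable)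

text \<open>With \<open>h = f - g\<close>, bilinearity gives
  \<open>conv f f - conv g g = conv f h + conv h g\<close>.\<close>

lemma conv_diff:
  assumes f: "f \<in> borel_measurable borel" "\<And>\<xi>. cmod (f \<xi>) \<le> a * wt \<xi>"
    and g: "g \<in> borel_measurable borel" "\<And>\<xi>. cmod (g \<xi>) \<le> b * wt \<xi>"
    and d: "\<And>\<xi>. cmod (f \<xi> - g \<xi>) \<le> d * wt \<xi>"
  shows "cmod (conv f f \<xi> - conv g g \<xi>) \<le> 4 * pi * ((a + b) * d) * wt \<xi>"
proof -
  have fi: "integrable lborel f" and gi: "integrable lborel g"
    using integrable_wt_bound f g by blast+
  let ?h = "\<lambda>\<xi>. f \<xi> - g \<xi>"
  have i: "integrable lborel (\<lambda>\<eta>. f (\<xi> - \<eta>) * f \<eta>)" "integrable lborel (\<lambda>\<eta>. f (\<xi> - \<eta>) * g \<eta>)"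
    "integrable lborel (\<lambda>\<eta>. g (\<xi> - \<eta>) * g \<eta>)"
    using wt_bounded_mult_integrable[OF f fi] wt_bounded_mult_integrable[OF f gi]
      wt_bounded_mult_integrable[OF g gi] by auto
  have "conv f f \<xi> - conv g g \<xi> = conv f ?h \<xi> + conv ?h g \<xi>"
    using i by (simp add: conv_def algebra_simps)
  also have "cmod \<dots> \<le> 4 * pi * a * d * wt \<xi> + 4 * pi * d * b * wt \<xi>"
    by (intro norm_triangle_mono conv_bound f g d)
  finally show ?thesis by (simp add: algebra_simps)
qed

text \<open>The frequency form of \<open>u u_x = (u^2)_x / 2\<close>: symmetrising under
  \<open>\<eta>\<close> and \<open>\<xi> - \<eta>\<close> turns the factor \<open>\<eta>\<close>
  into \<open>\<xi> / 2\<close>.\<close>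

lemma conv_ident_mult:
  assumes g: "g \<in> borel_measurable borel" "\<And>\<xi>. cmod (g \<xi>) \<le> a * wt \<xi>"
    and i: "integrable lborel (\<lambda>\<xi>. \<i> * of_real \<xi> * g \<xi>)"
  shows "conv g (\<lambda>\<eta>. \<i> * of_real \<eta> * g \<eta>) \<xi> = \<i> * of_real \<xi> / 2 * conv g g \<xi>"
proof -
  let ?h = "\<lambda>\<eta>. \<i> * of_real \<eta> * g \<eta>"
  have 1: "integrable lborel (\<lambda>\<eta>. g (\<xi> - \<eta>) * ?h \<eta>)"
    by (rule wt_bounded_mult_integrable[OF g i])
  have 2: "integrable lborel (\<lambda>\<eta>. ?h (\<xi> - \<eta>) * g \<eta>)"
    using lborel_integrable_real_affine[OF 1, of "-1" \<xi>] by (simp add: mult.commute)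
  have "conv g ?h \<xi> + conv ?h g \<xi> = (LINT \<eta>|lborel. g (\<xi> - \<eta>) * ?h \<eta> + ?h (\<xi> - \<eta>) * g \<eta>)"
    unfolding conv_def using 1 2 by simp
  also have "\<dots> = (LINT \<eta>|lborel. \<i> * of_real \<xi> * (g (\<xi> - \<eta>) * g \<eta>))"
    by (intro Bochner_Integration.integral_cong refl) (simp add: algebra_simps)
  also have "\<dots> = \<i> * of_real \<xi> * conv g g \<xi>"
    by (simp add: conv_def)
  finally show ?thesis
    using conv_commute[of ?h g \<xi>] by (simp add: mult.commute)
qed

section \<open>The truncated nonlinearity\<close>

text \<open>Plays two parts: it is the dispersion relation of the group, and
  \<open>\<i> * sg\<close> is the symbol of \<open>Lam\<close> composed with the derivative in
  \<open>u u_x\<close>. The bound by 1 makes the nonlinearity free of derivative loss.\<close>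

definition sg :: "real \<Rightarrow> real" where
  "sg \<xi> = \<xi> / (1 + \<bar>\<xi>\<bar>)"

lemma sg_measurable [measurable]: "sg \<in> borel_measurable borel"
  unfolding sg_def by measurable

lemma abs_sg_le: "\<bar>sg \<xi>\<bar> \<le> 1"
  by (simp add: sg_def abs_divide divide_le_eq)

lemma has_fourier_fourier_mult:
  assumes "has_fourier u g" "m \<in> borel_measurable borel" "integrable lborel (\<lambda>\<xi>. m \<xi> * g \<xi>)"
  shows "has_fourier (fourier_mult m u) (\<lambda>\<xi>. m \<xi> * g \<xi>)"
  using fourier_mult_eqI[OF assms(1) has_fourier_inv_fourier[OF assms(3)] assms(2)]
    has_fourier_inv_fourier[OF assms(3)] by simp

lemma has_fourier_Sgrp:
  assumes "has_fourier u g" "integrable lborel g"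
  shows "has_fourier (Sgrp t u) (\<lambda>\<xi>. cis (- (sg \<xi> * t)) * g \<xi>)"
proof -
  have "(\<lambda>\<xi>. cis (- (\<xi> / (1 + \<bar>\<xi>\<bar>) * t))) = (\<lambda>\<xi>. cis (- (sg \<xi> * t)))"
    by (simp add: sg_def)
  moreover have "integrable lborel (\<lambda>\<xi>. cis (- (sg \<xi> * t)) * g \<xi>)"
    by (rule integrable_cis_mult) (use assms in auto)
  ultimately show ?thesis
    unfolding Sgrp_def by (simp add: has_fourier_fourier_mult[OF assms(1)])
qed

lemma vderiv_inv_fourier:
  assumes "integrable lborel g" "integrable lborel (\<lambda>y. of_real y * g y)"
    "integrable lborel (\<lambda>y. of_real (y\<^sup>2) * g y)"
  shows "vderiv (inv_fourier g) = inv_fourier (\<lambda>\<xi>. \<i> * of_real \<xi> * g \<xi>)"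
proof
  fix x
  have "((\<lambda>x. (LINT y|lborel. cis (1 * (x * y)) * g y) / (2 * pi)) has_vector_derivative
      (LINT y|lborel. cis (1 * (x * y)) * (\<i> * of_real 1 * (of_real y * g y))) / (2 * pi)) (at x)"
    by (intro has_vector_derivative_divide oscillatory_has_deriv assms)
  then have "(inv_fourier g has_vector_derivative inv_fourier (\<lambda>\<xi>. \<i> * of_real \<xi> * g \<xi>) x) (at x)"
    by (simp add: inv_fourier_def[abs_def] mult_ac)
  then show "vderiv (inv_fourier g) x = inv_fourier (\<lambda>\<xi>. \<i> * of_real \<xi> * g \<xi>) x"
    by (simp add: vderiv_def vector_derivative_at)
qed

text \<open>The factor \<open>4 * pi\<close> combines the 2 in \<open>u u_x = (u^2)_x / 2\<close>
  with the \<open>2 * pi\<close> by which products of inverse transforms differ from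
  convolutions.\<close>

lemma has_fourier_truncated_uux:
  assumes u: "has_fourier u g" and g: "g \<in> borel_measurable borel" "\<And>\<xi>. cmod (g \<xi>) \<le> A * wt \<xi>"
    and m: "m \<in> borel_measurable borel" "\<And>\<xi>. cmod (m \<xi>) \<le> C" "\<And>\<xi>. R < \<bar>\<xi>\<bar> \<Longrightarrow> m \<xi> = 0"
  defines "h \<equiv> \<lambda>\<xi>. m \<xi> * g \<xi>"
  shows "has_fourier (truncated_uux m u) (\<lambda>\<xi>. \<i> * of_real \<xi> / (4 * pi) * conv h h \<xi>)"
    and "integrable lborel (\<lambda>\<xi>. \<i> * of_real \<xi> / (4 * pi) * conv h h \<xi>)"
proof -
  have [measurable]: "fhat u \<in> borel_measurable borel" "g \<in> borel_measurable borel" "m \<in> borel_measurable borel"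
    using has_fourier_fhat[OF u] g m by (auto simp: has_fourier_def)
  have hm: "h \<in> borel_measurable borel"
    unfolding h_def by measurable
  have "0 \<le> C" using order_trans[OF norm_ge_zero m(2)] .
  then have hb: "cmod (h \<xi>) \<le> (C * A) * wt \<xi>" for \<xi>
    unfolding h_def norm_mult mult.assoc by (intro mult_mono m g) auto
  have hi: "integrable lborel h"
    using integrable_wt_bound[OF hm hb] .
  \<comment> \<open>The cutoff confines \<open>h\<close> to frequencies of modulus at most
    \<open>R\<close>, so all moments are finite and the truncation may be differentiated under the
    integral.\<close>
  have pw: "integrable lborel (\<lambda>\<xi>. of_real (\<xi> ^ k) * h \<xi>)" for k
  proof (rule integrable_wt_bound)
    fix \<xi>
    have "\<bar>\<xi>\<bar> ^ k * cmod (h \<xi>) \<le> \<bar>R\<bar> ^ k * (C * A * wt \<xi>)"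
    proof (cases "R < \<bar>\<xi>\<bar>")
      case True
      then show ?thesis using order_trans[OF norm_ge_zero hb[of \<xi>]] by (simp add: h_def m)
    next
      case False
      then show ?thesis by (intro mult_mono power_mono hb) auto
    qed
    then show "cmod (of_real (\<xi> ^ k) * h \<xi>) \<le> (\<bar>R\<bar> ^ k * (C * A)) * wt \<xi>"
      by (simp add: norm_mult norm_power mult.assoc)
  qed (use hm in measurable)
  have hi1: "integrable lborel (\<lambda>\<xi>. \<i> * of_real \<xi> * h \<xi>)"
    using pw[of 1] by (simp add: mult.assoc)
  have tr: "truncate m u = inv_fourier h"
  proof
    fix x
    have "AE \<xi> in lborel. cis (\<xi> * x) * (m \<xi> * fhat u \<xi>) = cis (\<xi> * x) * h \<xi>"
      using fhat_AE[OF u] by eventually_elim (simp add: h_def)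
    then have "(LINT \<xi>|lborel. cis (\<xi> * x) * (m \<xi> * fhat u \<xi>)) = (LINT \<xi>|lborel. cis (\<xi> * x) * h \<xi>)"
      using hm by (intro integral_cong_AE) measurable
    then show "truncate m u x = inv_fourier h x"
      by (simp add: truncate_def inv_fourier_def)
  qed
  have "truncated_uux m u = tdist_of_fun (inv_fourier (\<lambda>\<xi>. conv h (\<lambda>\<xi>. \<i> * of_real \<xi> * h \<xi>) \<xi> / (2 * pi)))"
    unfolding truncated_uux_def tr vderiv_inv_fourier[OF hi pw[of 1, simplified] pw[of 2]]
    by (simp add: inv_fourier_mult[OF hi hi1])
  also have "(\<lambda>\<xi>. conv h (\<lambda>\<xi>. \<i> * of_real \<xi> * h \<xi>) \<xi> / (2 * pi)) = (\<lambda>\<xi>. \<i> * of_real \<xi> / (4 * pi) * conv h h \<xi>)"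
    unfolding conv_ident_mult[OF hm hb hi1] by auto
  finally have eq: "truncated_uux m u = tdist_of_fun (inv_fourier (\<lambda>\<xi>. \<i> * of_real \<xi> / (4 * pi) * conv h h \<xi>))" .
  show i: "integrable lborel (\<lambda>\<xi>. \<i> * of_real \<xi> / (4 * pi) * conv h h \<xi>)"
    using integrable_divide[OF conv_integrable[OF hi hi1], of "2 * pi"]
    unfolding conv_ident_mult[OF hm hb hi1] by (simp add: field_simps)
  show "has_fourier (truncated_uux m u) (\<lambda>\<xi>. \<i> * of_real \<xi> / (4 * pi) * conv h h \<xi>)"
    unfolding eq by (rule has_fourier_inv_fourier[OF i])
qed

lemma has_fourier_duhamel_integrand:
  assumes u: "has_fourier u g" and g: "g \<in> borel_measurable borel" "\<And>\<xi>. cmod (g \<xi>) \<le> A * wt \<xi>"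
    and m: "m \<in> borel_measurable borel" "\<And>\<xi>. cmod (m \<xi>) \<le> C" "\<And>\<xi>. R < \<bar>\<xi>\<bar> \<Longrightarrow> m \<xi> = 0"
  defines "h \<equiv> \<lambda>\<xi>. m \<xi> * g \<xi>"
  shows "has_fourier (Sgrp t (Lam (truncated_uux m u)))
    (\<lambda>\<xi>. cis (- (sg \<xi> * t)) * (\<i> * of_real (sg \<xi>) / (4 * pi) * conv h h \<xi>))"
proof -
  note T = has_fourier_truncated_uux[OF u g m, folded h_def]
  have "cmod (complex_of_real (1 / (1 + \<bar>\<xi>\<bar>))) \<le> 1" for \<xi>
    unfolding norm_of_real by (simp add: divide_le_eq)
  then have i: "integrable lborel (\<lambda>\<xi>. complex_of_real (1 / (1 + \<bar>\<xi>\<bar>)) * (\<i> * of_real \<xi> / (4 * pi) * conv h h \<xi>))"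
    by (intro integrable_bounded_mult[OF T(2), where C = 1]) measurable
  have eq: "complex_of_real (1 / (1 + \<bar>\<xi>\<bar>)) * (\<i> * of_real \<xi> / (4 * pi) * conv h h \<xi>)
      = \<i> * of_real (sg \<xi>) / (4 * pi) * conv h h \<xi>" for \<xi>
    by (simp add: sg_def)
  have "has_fourier (Lam (truncated_uux m u)) (\<lambda>\<xi>. \<i> * of_real (sg \<xi>) / (4 * pi) * conv h h \<xi>)"
    using has_fourier_fourier_mult[OF T(1) _ i] unfolding Lam_def eq by simp
  then show ?thesis
    by (rule has_fourier_Sgrp) (use i eq in simp)
qed

section \<open>Sobolev norms\<close>

lemma one_plus_square_powr_le:
  fixes x s :: real
  assumes "s \<le> 0"
  shows "(1 + x\<^sup>2) powr s \<le> 1"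
proof -
  have "1 + x\<^sup>2 \<noteq> 0"
    by (metis add_nonneg_eq_0_iff zero_le_one zero_le_power2 zero_neq_one)
  then show ?thesis
    using powr_mono[of s 0 "1 + x\<^sup>2"] assms by simp
qed

text \<open>For \<open>s \<le> 0\<close> the Sobolev weight is at most 1, and the square of
  \<open>wt\<close> is at most \<open>wt\<close>. Weighted bounds thus pass to \<open>Hs s\<close>
  with a constant independent of \<open>s\<close>.\<close>

lemma Hs_weight_integrable:
  assumes "s \<le> 0" "g \<in> borel_measurable borel" "\<And>\<xi>. cmod (g \<xi>) \<le> A * wt \<xi>"
  shows "integrable lborel (\<lambda>\<xi>. (1 + \<xi>\<^sup>2) powr s * (cmod (g \<xi>))\<^sup>2)"
    and "(LINT \<xi>|lborel. (1 + \<xi>\<^sup>2) powr s * (cmod (g \<xi>))\<^sup>2) \<le> A\<^sup>2 * pi"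
proof -
  have b: "(1 + \<xi>\<^sup>2) powr s * (cmod (g \<xi>))\<^sup>2 \<le> A\<^sup>2 * wt \<xi>" for \<xi>
  proof -
    have "(1 + \<xi>\<^sup>2) powr s * (cmod (g \<xi>))\<^sup>2 \<le> 1 * (A * wt \<xi>)\<^sup>2"
      using one_plus_square_powr_le[OF assms(1)] assms(3)
      by (intro mult_mono power_mono) auto
    also have "\<dots> = A\<^sup>2 * (wt \<xi> * wt \<xi>)"
      by (simp add: power2_eq_square mult_ac)
    also have "\<dots> \<le> A\<^sup>2 * wt \<xi>"
      using wt_le_1 wt_nonneg by (intro mult_left_mono) (auto simp: mult_left_le)
    finally show ?thesis .
  qed
  have ib: "integrable lborel (\<lambda>\<xi>. A\<^sup>2 * wt \<xi>)"
    using wt_integrable by auto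
  show i: "integrable lborel (\<lambda>\<xi>. (1 + \<xi>\<^sup>2) powr s * (cmod (g \<xi>))\<^sup>2)"
    by (rule Bochner_Integration.integrable_bound[OF ib]) (use assms(2) b wt_nonneg in auto)
  have "(LINT \<xi>|lborel. (1 + \<xi>\<^sup>2) powr s * (cmod (g \<xi>))\<^sup>2) \<le> (LINT \<xi>|lborel. A\<^sup>2 * wt \<xi>)"
    by (rule integral_mono[OF i ib]) (use b in auto)
  then show "(LINT \<xi>|lborel. (1 + \<xi>\<^sup>2) powr s * (cmod (g \<xi>))\<^sup>2) \<le> A\<^sup>2 * pi"
    by (simp add: wt_integral)
qed

lemma Hs_norm_eq:
  assumes "has_fourier u g"
  shows "Hs_norm s u = sqrt (LINT \<xi>|lborel. (1 + \<xi>\<^sup>2) powr s * (cmod (g \<xi>))\<^sup>2)"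
proof -
  have [measurable]: "fhat u \<in> borel_measurable borel" "g \<in> borel_measurable borel"
    using has_fourier_fhat[OF assms] assms by (auto simp: has_fourier_def)
  have "AE \<xi> in lborel. (1 + \<xi>\<^sup>2) powr s * (cmod (fhat u \<xi>))\<^sup>2 = (1 + \<xi>\<^sup>2) powr s * (cmod (g \<xi>))\<^sup>2"
    using fhat_AE[OF assms] by eventually_elim simp
  then have "(LINT \<xi>|lborel. (1 + \<xi>\<^sup>2) powr s * (cmod (fhat u \<xi>))\<^sup>2) = (LINT \<xi>|lborel. (1 + \<xi>\<^sup>2) powr s * (cmod (g \<xi>))\<^sup>2)"
    by (intro integral_cong_AE) measurable
  then show ?thesis
    by (simp add: Hs_norm_def)
qed

lemma Hs_norm_le:
  assumes "has_fourier u g" "s \<le> 0" "\<And>\<xi>. cmod (g \<xi>) \<le> A * wt \<xi>"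
  shows "Hs_norm s u \<le> A * sqrt pi"
proof -
  have "0 \<le> A"
    using order_trans[OF norm_ge_zero assms(3)[of 0]] by (simp add: wt_def)
  have "Hs_norm s u \<le> sqrt (A\<^sup>2 * pi)"
    unfolding Hs_norm_eq[OF assms(1)] using Hs_weight_integrable(2)[OF assms(2) _ assms(3)] assms(1)
    by (simp add: has_fourier_def)
  then show ?thesis
    using \<open>0 \<le> A\<close> by (simp add: real_sqrt_mult)
qed

lemma Hs_norm_nonneg: "0 \<le> Hs_norm s u"
  unfolding Hs_norm_def by (intro real_sqrt_ge_zero Bochner_Integration.integral_nonneg) simp

lemma Hs_norm_scaleR:
  assumes "has_fourier u g"
  shows "Hs_norm s (c *\<^sub>R u) = \<bar>c\<bar> * Hs_norm s u"
proof -
  have "(LINT \<xi>|lborel. (1 + \<xi>\<^sup>2) powr s * (cmod (c *\<^sub>R g \<xi>))\<^sup>2) = (LINT \<xi>|lborel. c\<^sup>2 * ((1 + \<xi>\<^sup>2) powr s * (cmod (g \<xi>))\<^sup>2))"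
    by (simp add: power_mult_distrib mult_ac)
  then show ?thesis
    unfolding Hs_norm_eq[OF assms] Hs_norm_eq[OF has_fourier_scaleR[OF assms]]
    by (simp add: real_sqrt_mult)
qed

text \<open>Hermitian symmetry of \<open>g\<close> makes the inverse transform real. Working in
  \<open>Hs_real s\<close> throughout covers the real and the complex version of the theorem at
  once.\<close>

lemma Hs_real_inv_fourier:
  assumes "s \<le> 0" "g \<in> borel_measurable borel" "\<And>\<xi>. cmod (g \<xi>) \<le> A * wt \<xi>"
    and sym: "\<And>\<xi>. g (- \<xi>) = cnj (g \<xi>)"
  shows "tdist_of_fun (inv_fourier g) \<in> Hs_real s"
proof -
  have i: "integrable lborel g"
    using integrable_wt_bound assms(2,3) by blast
  have "inv_fourier g x \<in> \<real>" for x
  proof -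
    have "cnj (LINT \<xi>|lborel. cis (\<xi> * x) * g \<xi>) = (LINT \<xi>|lborel. cnj (cis (\<xi> * x) * g \<xi>))"
      by (rule Bochner_Integration.integral_cnj[symmetric])
    also have "\<dots> = (LINT \<xi>|lborel. cis (- \<xi> * x) * g (- \<xi>))"
      by (simp add: sym cis_cnj)
    also have "\<dots> = (LINT \<xi>|lborel. cis (\<xi> * x) * g \<xi>)"
      using lborel_integral_real_affine[of "-1" "\<lambda>\<xi>. cis (\<xi> * x) * g \<xi>" 0] by simp
    finally have "(LINT \<xi>|lborel. cis (\<xi> * x) * g \<xi>) \<in> \<real>"
      by (simp add: Reals_cnj_iff)
    then show ?thesis
      unfolding inv_fourier_def by (intro Reals_divide) auto
  qed
  then have "tapply (tdist_of_fun (inv_fourier g)) \<psi> \<in> \<real>" if "\<psi> \<in> schwartz" "\<forall>x. \<psi> x \<in> \<real>" for \<psi>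
  proof -
    have "inv_fourier g x * \<psi> x = of_real (Re (inv_fourier g x * \<psi> x))" for x
      using \<open>\<And>x. inv_fourier g x \<in> \<real>\<close> that(2) by (metis Reals_mult of_real_Re)
    then have "(LINT x|lborel. inv_fourier g x * \<psi> x) = of_real (LINT x|lborel. Re (inv_fourier g x * \<psi> x))"
      by (metis (no_types, lifting) Bochner_Integration.integral_cong integral_complex_of_real)
    then show ?thesis
      unfolding tapply_inv_fourier[OF i that(1)] by simp
  qed
  then show ?thesis
    unfolding Hs_real_def Hs_def
    using has_fourier_inv_fourier[OF i] Hs_weight_integrable(1)[OF assms(1-3)] by blast
qed


section \<open>The Duhamel operator\<close>

text \<open>A signed indicator of the open interval between 0 and \<open>t\<close>. It writes the
  oriented integral from 0 to \<open>t\<close>, for either sign of \<open>t\<close>, as one integral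
  over the line with an integrand measurable in \<open>t\<close> as well.\<close>

definition itv :: "real \<Rightarrow> real \<Rightarrow> real" where
  "itv t \<tau> = (if 0 < \<tau> \<and> \<tau> < t then 1 else if t < \<tau> \<and> \<tau> < 0 then - 1 else 0)"

lemma itv_measurable [measurable (raw)]:
  assumes [measurable]: "f \<in> borel_measurable M" "g \<in> borel_measurable M"
  shows "(\<lambda>x. itv (f x) (g x)) \<in> borel_measurable M"
  unfolding itv_def by measurable

lemma abs_itv: "\<bar>itv t \<tau>\<bar> = indicator {min 0 t<..<max 0 t} \<tau>"
  by (auto simp: itv_def indicator_def)

lemma abs_itv_integrable: "integrable lborel (\<lambda>\<tau>. \<bar>itv t \<tau>\<bar>)"
  unfolding abs_itv by (auto intro!: integrable_real_indicator)

lemma abs_itv_integral: "(LINT \<tau>|lborel. \<bar>itv t \<tau>\<bar>) = \<bar>t\<bar>"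
  unfolding abs_itv by (auto simp: min_def max_def)

lemma LBINT_eq_itv:
  fixes f :: "real \<Rightarrow> complex"
  shows "(LBINT \<tau>=ereal 0..ereal t. f \<tau>) = (LINT \<tau>|lborel. itv t \<tau> *\<^sub>R f \<tau>)"
proof (cases "0 \<le> t")
  case True
  then show ?thesis
    unfolding interval_lebesgue_integral_def set_lebesgue_integral_def
    by (auto simp: einterval_def itv_def indicator_def intro!: Bochner_Integration.integral_cong)
next
  case False
  then have "(LBINT \<tau>=ereal 0..ereal t. f \<tau>) = - (LINT \<tau>|lborel. indicator {t<..<0} \<tau> *\<^sub>R f \<tau>)"
    unfolding interval_lebesgue_integral_def set_lebesgue_integral_def
    by (simp add: einterval_def greaterThanLessThan_def greaterThan_def lessThan_def Collect_conj_eq)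
  also have "\<dots> = (LINT \<tau>|lborel. - (indicator {t<..<0} \<tau> *\<^sub>R f \<tau>))"
    by simp
  also have "\<dots> = (LINT \<tau>|lborel. itv t \<tau> *\<^sub>R f \<tau>)"
    using False by (intro Bochner_Integration.integral_cong) (auto simp: itv_def indicator_def)
  finally show ?thesis .
qed

lemma itv_bound:
  fixes f :: "real \<Rightarrow> complex"
  assumes "\<And>\<tau>. \<bar>\<tau>\<bar> \<le> \<bar>t\<bar> \<Longrightarrow> cmod (f \<tau>) \<le> B"
  shows "cmod (itv t \<tau> *\<^sub>R f \<tau>) \<le> B * \<bar>itv t \<tau>\<bar>"
  using assms[of \<tau>] by (auto simp: itv_def)

lemma itv_integral_bound:
  fixes f :: "real \<Rightarrow> complex"
  assumes "\<And>\<tau>. \<bar>\<tau>\<bar> \<le> \<bar>t\<bar> \<Longrightarrow> cmod (f \<tau>) \<le> B"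
  shows "cmod (LINT \<tau>|lborel. itv t \<tau> *\<^sub>R f \<tau>) \<le> \<bar>t\<bar> * B"
proof -
  have "cmod (LINT \<tau>|lborel. itv t \<tau> *\<^sub>R f \<tau>) \<le> (LINT \<tau>|lborel. B * \<bar>itv t \<tau>\<bar>)"
    by (rule norm_integral_le) (use abs_itv_integrable itv_bound[OF assms] in auto)
  then show ?thesis
    by (simp add: abs_itv_integral mult.commute)
qed

lemma itv_integrable:
  fixes f :: "real \<Rightarrow> complex"
  assumes [measurable]: "f \<in> borel_measurable borel" and "\<And>\<tau>. \<bar>\<tau>\<bar> \<le> \<bar>t\<bar> \<Longrightarrow> cmod (f \<tau>) \<le> B"
  shows "integrable lborel (\<lambda>\<tau>. itv t \<tau> *\<^sub>R f \<tau>)"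
proof (rule Bochner_Integration.integrable_bound)
  show "integrable lborel (\<lambda>\<tau>. B * \<bar>itv t \<tau>\<bar>)"
    using abs_itv_integrable by auto
  show "AE \<tau> in lborel. norm (itv t \<tau> *\<^sub>R f \<tau>) \<le> norm (B * \<bar>itv t \<tau>\<bar>)"
  proof (rule AE_I2)
    fix \<tau>
    show "norm (itv t \<tau> *\<^sub>R f \<tau>) \<le> norm (B * \<bar>itv t \<tau>\<bar>)"
      using itv_bound[where f = f and t = t and \<tau> = \<tau>, OF assms(2)] by simp
  qed
qed measurable

lemma itv_integral_lipschitz:
  fixes f :: "real \<Rightarrow> complex"
  assumes f [measurable]: "f \<in> borel_measurable borel"
    and B: "\<And>\<tau>. \<bar>\<tau>\<bar> \<le> T \<Longrightarrow> cmod (f \<tau>) \<le> B" and t: "\<bar>t\<bar> \<le> T" "\<bar>t'\<bar> \<le> T"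
  shows "cmod ((LINT \<tau>|lborel. itv t \<tau> *\<^sub>R f \<tau>) - (LINT \<tau>|lborel. itv t' \<tau> *\<^sub>R f \<tau>)) \<le> \<bar>t - t'\<bar> * B"
proof -
  let ?I = "{min t t'..max t t'}"
  have "0 \<le> B" using order_trans[OF norm_ge_zero B[of t]] t by simp
  have i: "integrable lborel (\<lambda>\<tau>. itv t \<tau> *\<^sub>R f \<tau>)" "integrable lborel (\<lambda>\<tau>. itv t' \<tau> *\<^sub>R f \<tau>)"
    using B t by (auto intro!: itv_integrable[where B = B])
  have "(LINT \<tau>|lborel. itv t \<tau> *\<^sub>R f \<tau>) - (LINT \<tau>|lborel. itv t' \<tau> *\<^sub>R f \<tau>)
      = (LINT \<tau>|lborel. (itv t \<tau> - itv t' \<tau>) *\<^sub>R f \<tau>)"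
    using i by (simp add: scaleR_left_diff_distrib)
  moreover have "cmod (LINT \<tau>|lborel. (itv t \<tau> - itv t' \<tau>) *\<^sub>R f \<tau>) \<le> (LINT \<tau>|lborel. B * indicator ?I \<tau>)"
  proof (rule norm_integral_le)
    show "integrable lborel (\<lambda>\<tau>. B * indicator ?I \<tau>)"
      by (auto intro!: integrable_real_indicator)
    fix \<tau>
    have 1: "\<bar>itv t \<tau> - itv t' \<tau>\<bar> \<le> indicator ?I \<tau>"
      by (auto simp: itv_def indicator_def)
    show "cmod ((itv t \<tau> - itv t' \<tau>) *\<^sub>R f \<tau>) \<le> B * indicator ?I \<tau>"
    proof (cases "\<tau> \<in> ?I")
      case True
      then have "\<bar>\<tau>\<bar> \<le> T" using t by auto
      from mult_mono[OF 1 B[OF this]] show ?thesis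
        using True by (simp add: mult.commute)
    next
      case False
      then have "itv t \<tau> - itv t' \<tau> = 0" using 1 by simp
      then show ?thesis using False by simp
    qed
  qed
  ultimately show ?thesis
    by (simp add: max_def min_def abs_if mult.commute split: if_splits)
qed

text \<open>The Fourier transform at \<open>\<xi>\<close> of the Duhamel integrand at time
  \<open>\<tau>\<close>, without truncation, when \<open>U \<tau>\<close> is the transform of the
  solution at time \<open>\<tau>\<close>.\<close>

definition duhi :: "(real \<Rightarrow> real \<Rightarrow> complex) \<Rightarrow> real \<Rightarrow> real \<Rightarrow> real \<Rightarrow> complex" where
  "duhi U t \<xi> \<tau> = cis (- (sg \<xi> * (t - \<tau>))) * (\<i> * of_real (sg \<xi>) / (4 * pi) * conv (U \<tau>) (U \<tau>) \<xi>)"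

definition duh :: "(real \<Rightarrow> real \<Rightarrow> complex) \<Rightarrow> real \<Rightarrow> real \<Rightarrow> complex" where
  "duh U t \<xi> = (LINT \<tau>|lborel. itv t \<tau> *\<^sub>R duhi U t \<xi> \<tau>)"

text \<open>A ball of radius \<open>a\<close> in the weighted space in which the fixed point is
  sought. The bound is confined to \<open>[-T, T]\<close>, while measurability is global and joint
  so that Fubini applies without restricting measures.\<close>

definition wbounded :: "real \<Rightarrow> real \<Rightarrow> (real \<Rightarrow> real \<Rightarrow> complex) \<Rightarrow> bool" where
  "wbounded T a U \<longleftrightarrow> case_prod U \<in> borel_measurable (borel \<Otimes>\<^sub>M borel) \<and>
     (\<forall>t \<xi>. \<bar>t\<bar> \<le> T \<longrightarrow> cmod (U t \<xi>) \<le> a * wt \<xi>)"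

lemma wboundedD:
  assumes "wbounded T a U"
  shows "case_prod U \<in> borel_measurable (borel \<Otimes>\<^sub>M borel)"
    and "U t \<in> borel_measurable borel"
    and "\<bar>t\<bar> \<le> T \<Longrightarrow> cmod (U t \<xi>) \<le> a * wt \<xi>"
proof -
  show m: "case_prod U \<in> borel_measurable (borel \<Otimes>\<^sub>M borel)"
    using assms by (simp add: wbounded_def)
  then show "U t \<in> borel_measurable borel"
    by measurable
  show "\<bar>t\<bar> \<le> T \<Longrightarrow> cmod (U t \<xi>) \<le> a * wt \<xi>"
    using assms by (simp add: wbounded_def)
qed

lemma duhi_measurable [measurable (raw)]:
  assumes [measurable]: "case_prod U \<in> borel_measurable (borel \<Otimes>\<^sub>M borel)"
    "f \<in> borel_measurable M" "g \<in> borel_measurable M" "h \<in> borel_measurable M"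
  shows "(\<lambda>x. duhi U (f x) (g x) (h x)) \<in> borel_measurable M"
  unfolding duhi_def by measurable

lemma duh_measurable:
  assumes [measurable]: "case_prod U \<in> borel_measurable (borel \<Otimes>\<^sub>M borel)"
    "f \<in> borel_measurable M" "g \<in> borel_measurable M"
  shows "(\<lambda>x. duh U (f x) (g x)) \<in> borel_measurable M"
  unfolding duh_def by measurable

text \<open>The \<open>4 * pi\<close> in the symbol cancels exactly the \<open>4 * pi\<close> of
  \<open>conv_bound\<close>, so the Duhamel integrand obeys the bound
  \<open>a\<^sup>2 * wt \<xi>\<close> with constant 1.\<close>

lemma symbol_bound:
  assumes "cmod z \<le> 4 * pi * c * w"
  shows "cmod (cis a * (\<i> * of_real (sg \<xi>) / (4 * pi) * z)) \<le> c * w"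
proof -
  have "cmod (cis a * (\<i> * of_real (sg \<xi>) / (4 * pi) * z)) = \<bar>sg \<xi>\<bar> * (cmod z / (4 * pi))"
    by (simp add: norm_mult norm_divide)
  also have "\<dots> \<le> 1 * (4 * pi * c * w / (4 * pi))"
    using assms by (intro mult_mono abs_sg_le divide_right_mono) auto
  finally show ?thesis by simp
qed

lemma duhi_bound:
  assumes "wbounded T a U" "\<bar>\<tau>\<bar> \<le> T"
  shows "cmod (duhi U t \<xi> \<tau>) \<le> a\<^sup>2 * wt \<xi>"
  unfolding duhi_def
  by (rule symbol_bound)
     (use conv_bound[of "U \<tau>" a "U \<tau>" a \<xi>] wboundedD[OF assms(1)] assms(2) in \<open>auto simp: power2_eq_square mult.assoc\<close>)

lemma duh_bound:
  assumes U: "wbounded T a U" and t: "\<bar>t\<bar> \<le> T"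
  shows "cmod (duh U t \<xi>) \<le> T * a\<^sup>2 * wt \<xi>"
proof -
  have "cmod (duh U t \<xi>) \<le> \<bar>t\<bar> * (a\<^sup>2 * wt \<xi>)"
    unfolding duh_def by (rule itv_integral_bound) (use duhi_bound[OF U] t in auto)
  also have "\<dots> \<le> T * (a\<^sup>2 * wt \<xi>)"
    using t wt_nonneg by (intro mult_right_mono) auto
  finally show ?thesis by simp
qed

lemma duh_diff:
  assumes U: "wbounded T a U" and V: "wbounded T b V"
    and d: "\<And>t \<xi>. \<bar>t\<bar> \<le> T \<Longrightarrow> cmod (U t \<xi> - V t \<xi>) \<le> d * wt \<xi>" and t: "\<bar>t\<bar> \<le> T"
  shows "cmod (duh U t \<xi> - duh V t \<xi>) \<le> T * ((a + b) * d) * wt \<xi>"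
proof -
  note [measurable] = wboundedD(1)[OF U] wboundedD(1)[OF V]
  have i: "integrable lborel (\<lambda>\<tau>. itv t \<tau> *\<^sub>R duhi U t \<xi> \<tau>)" "integrable lborel (\<lambda>\<tau>. itv t \<tau> *\<^sub>R duhi V t \<xi> \<tau>)"
    using duhi_bound[OF U] duhi_bound[OF V] t
    by (intro itv_integrable[where B = "a\<^sup>2 * wt \<xi>"], auto)
       (intro itv_integrable[where B = "b\<^sup>2 * wt \<xi>"], auto)
  have b: "cmod (duhi U t \<xi> \<tau> - duhi V t \<xi> \<tau>) \<le> (a + b) * d * wt \<xi>" if "\<bar>\<tau>\<bar> \<le> T" for \<tau>
  proof -
    have "duhi U t \<xi> \<tau> - duhi V t \<xi> \<tau> = cis (- (sg \<xi> * (t - \<tau>))) *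
        (\<i> * of_real (sg \<xi>) / (4 * pi) * (conv (U \<tau>) (U \<tau>) \<xi> - conv (V \<tau>) (V \<tau>) \<xi>))"
      by (simp only: duhi_def right_diff_distrib)
    then show ?thesis
      using symbol_bound[OF conv_diff[of "U \<tau>" a "V \<tau>" b d \<xi>]]
        wboundedD(2,3)[OF U] wboundedD(2,3)[OF V] d that by simp
  qed
  have "duh U t \<xi> - duh V t \<xi> = (LINT \<tau>|lborel. itv t \<tau> *\<^sub>R (duhi U t \<xi> \<tau> - duhi V t \<xi> \<tau>))"
    unfolding duh_def using i by (simp add: scaleR_diff_right)
  also have "cmod \<dots> \<le> \<bar>t\<bar> * ((a + b) * d * wt \<xi>)"
    by (rule itv_integral_bound) (use b t in auto)
  also have "\<dots> \<le> T * ((a + b) * d * wt \<xi>)"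
    using t order_trans[OF norm_ge_zero b[of t]] by (intro mult_right_mono) auto
  finally show ?thesis by simp
qed

text \<open>Pulling the group factor at time \<open>t\<close> out of the integral leaves
  \<open>Z\<close>, which depends on \<open>t\<close> only through the limit of integration. In
  \<open>T + 1\<close> the \<open>T\<close> comes from varying the group factor and the 1 from
  varying the limit.\<close>

lemma duh_lipschitz:
  assumes U: "wbounded T a U" and t: "\<bar>t\<bar> \<le> T" "\<bar>t'\<bar> \<le> T"
  shows "cmod (duh U t \<xi> - duh U t' \<xi>) \<le> (T + 1) * a\<^sup>2 * \<bar>t - t'\<bar> * wt \<xi>"
proof -
  note [measurable] = wboundedD(1)[OF U]
  define Z where "Z = (\<lambda>t. LINT \<tau>|lborel. itv t \<tau> *\<^sub>R duhi U 0 \<xi> \<tau>)"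
  have duh_Z: "duh U t \<xi> = cis (- (sg \<xi> * t)) * Z t" for t
  proof -
    have "duhi U t \<xi> \<tau> = cis (- (sg \<xi> * t)) * duhi U 0 \<xi> \<tau>" for \<tau>
    proof -
      have "cis (- (sg \<xi> * (t - \<tau>))) = cis (- (sg \<xi> * t)) * cis (- (sg \<xi> * (0 - \<tau>)))"
        by (simp add: cis_mult algebra_simps)
      then show ?thesis
        by (simp only: duhi_def mult.assoc)
    qed
    then have "duh U t \<xi> = (LINT \<tau>|lborel. cis (- (sg \<xi> * t)) * (itv t \<tau> *\<^sub>R duhi U 0 \<xi> \<tau>))"
      unfolding duh_def by simp
    then show ?thesis
      by (simp add: Z_def del: mult_scaleR_right)
  qed
  have Zb: "cmod (Z t) \<le> T * (a\<^sup>2 * wt \<xi>)"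
  proof -
    have "cmod (Z t) \<le> \<bar>t\<bar> * (a\<^sup>2 * wt \<xi>)"
      unfolding Z_def by (rule itv_integral_bound) (use duhi_bound[OF U] t in auto)
    also have "\<dots> \<le> T * (a\<^sup>2 * wt \<xi>)"
      using t wt_nonneg by (intro mult_right_mono) auto
    finally show ?thesis .
  qed
  have Zl: "cmod (Z t - Z t') \<le> \<bar>t - t'\<bar> * (a\<^sup>2 * wt \<xi>)"
    unfolding Z_def by (rule itv_integral_lipschitz[where T = T]) (use duhi_bound[OF U] t in auto)
  have c: "cmod (cis (- (sg \<xi> * t)) - cis (- (sg \<xi> * t'))) \<le> \<bar>t - t'\<bar>"
  proof -
    have "cmod (cis (- (sg \<xi> * t)) - cis (- (sg \<xi> * t'))) \<le> \<bar>sg \<xi>\<bar> * \<bar>t - t'\<bar>"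
      using cis_diff_bound[of "- (sg \<xi> * t)" "- (sg \<xi> * t')"]
      by (simp add: abs_minus_commute[of t'] flip: right_diff_distrib) (simp add: abs_mult abs_minus_commute)
    also have "\<dots> \<le> 1 * \<bar>t - t'\<bar>"
      by (intro mult_right_mono abs_sg_le) auto
    finally show ?thesis by simp
  qed
  have "duh U t \<xi> - duh U t' \<xi> = (cis (- (sg \<xi> * t)) - cis (- (sg \<xi> * t'))) * Z t + cis (- (sg \<xi> * t')) * (Z t - Z t')"
    unfolding duh_Z by (simp add: algebra_simps)
  also have "cmod \<dots> \<le> \<bar>t - t'\<bar> * (T * (a\<^sup>2 * wt \<xi>)) + 1 * (\<bar>t - t'\<bar> * (a\<^sup>2 * wt \<xi>))"
    by (intro norm_triangle_mono) (auto simp: norm_mult intro!: mult_mono c Zb Zl)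
  finally show ?thesis by (simp add: algebra_simps)
qed

lemma conv_cnj:
  assumes "\<And>x. g (- x) = cnj (g x)"
  shows "conv g g (- \<xi>) = cnj (conv g g \<xi>)"
proof -
  have "conv g g (- \<xi>) = (LINT \<eta>|lborel. g (- \<xi> + \<eta>) * g (- \<eta>))"
    using lborel_integral_real_affine[of "-1" "\<lambda>\<eta>. g (- \<xi> - \<eta>) * g \<eta>" 0] by (simp add: conv_def)
  also have "\<dots> = (LINT \<eta>|lborel. cnj (g (\<xi> - \<eta>) * g \<eta>))"
    using assms by (metis (no_types, opaque_lifting) complex_cnj_mult minus_diff_eq uminus_add_conv_diff)
  also have "\<dots> = cnj (conv g g \<xi>)"
    unfolding conv_def by (rule Bochner_Integration.integral_cnj)
  finally show ?thesis .
qed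

lemma sg_minus: "sg (- \<xi>) = - sg \<xi>"
  by (simp add: sg_def)

lemma duh_cnj:
  assumes "\<And>t \<xi>. U t (- \<xi>) = cnj (U t \<xi>)"
  shows "duh U t (- \<xi>) = cnj (duh U t \<xi>)"
proof -
  have "duhi U t (- \<xi>) \<tau> = cnj (duhi U t \<xi> \<tau>)" for \<tau>
    unfolding duhi_def conv_cnj[of "U \<tau>", OF assms] sg_minus by (simp add: cis_cnj)
  then have "duh U t (- \<xi>) = (LINT \<tau>|lborel. cnj (itv t \<tau> *\<^sub>R duhi U t \<xi> \<tau>))"
    by (simp add: duh_def)
  also have "\<dots> = cnj (duh U t \<xi>)"
    unfolding duh_def by (rule Bochner_Integration.integral_cnj)
  finally show ?thesis .
qed

section \<open>Picard iteration for small data\<close>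

fun picard :: "(real \<Rightarrow> complex) \<Rightarrow> nat \<Rightarrow> real \<Rightarrow> real \<Rightarrow> complex" where
  "picard f 0 t \<xi> = 0"
| "picard f (Suc n) t \<xi> = cis (- (sg \<xi> * t)) * f \<xi> - duh (picard f n) t \<xi>"

lemma geometric_cauchy_limit:
  fixes z :: "nat \<Rightarrow> complex"
  assumes "\<And>n. cmod (z (Suc n) - z n) \<le> c / 2 ^ n"
  shows "z \<longlonglongrightarrow> lim z" "cmod (lim z - z n) \<le> 2 * c / 2 ^ n"
proof -
  \<comment> \<open>Keeping the negative term makes the induction close exactly: each step consumes
    \<open>c / 2 ^ (n + k)\<close> of the remaining geometric tail.\<close>
  have tail: "cmod (z (n + k) - z n) \<le> 2 * c / 2 ^ n - 2 * c / 2 ^ (n + k)" for n k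
  proof (induction k)
    case (Suc k)
    have "cmod (z (n + Suc k) - z n) \<le> cmod (z (Suc (n + k)) - z (n + k)) + cmod (z (n + k) - z n)"
      using norm_triangle_ineq[of "z (Suc (n + k)) - z (n + k)" "z (n + k) - z n"] by simp
    then show ?case
      using assms[of "n + k"] Suc by simp
  qed simp
  have c: "0 \<le> c" using order_trans[OF norm_ge_zero assms[of 0]] by simp
  have tail': "cmod (z (n + k) - z n) \<le> 2 * c / 2 ^ n" for n k
  proof -
    have "0 \<le> 2 * c / 2 ^ (n + k)" using c by simp
    with tail[of n k] show ?thesis by linarith
  qed
  have "Cauchy z"
  proof (rule CauchyI')
    fix e :: real assume "0 < e"
    have "(\<lambda>n. 2 * c / 2 ^ n) \<longlonglongrightarrow> 0" by real_asymp
    then obtain N where N: "2 * c / 2 ^ n < e" if "n \<ge> N" for n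
      using order_tendstoD(2)[OF _ \<open>0 < e\<close>] by (fastforce simp: eventually_sequentially)
    have "dist (z m) (z n) < e" if "m \<ge> N" "n > m" for m n
      using tail'[of m "n - m"] N[OF that(1)] that(2) by (simp add: dist_norm norm_minus_commute)
    then show "\<exists>M. \<forall>m\<ge>M. \<forall>n>m. dist (z m) (z n) < e" by blast
  qed
  then show l: "z \<longlonglongrightarrow> lim z"
    using Cauchy_convergent convergent_LIMSEQ_iff by blast
  have "(\<lambda>k. cmod (z (k + n) - z n)) \<longlonglongrightarrow> cmod (lim z - z n)"
    by (intro tendsto_intros LIMSEQ_ignore_initial_segment l)
  then show "cmod (lim z - z n) \<le> 2 * c / 2 ^ n"
    by (rule LIMSEQ_le_const2) (use tail'[of n] in \<open>auto simp: add.commute\<close>)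
qed

text \<open>Contraction with \<open>T\<close> prescribed: \<open>8 * A * T \<le> 1\<close> is met by
  shrinking the datum. The Duhamel term on the ball of radius \<open>2 * A\<close> then has size at
  most \<open>A / 2\<close>, and its Lipschitz constant \<open>4 * A * T\<close> is at most
  \<open>1 / 2\<close>. The symmetry is carried along so that real data have real solutions.\<close>

lemma picard_solution:
  assumes f: "f \<in> borel_measurable borel" "\<And>\<xi>. cmod (f \<xi>) \<le> A * wt \<xi>" "\<And>\<xi>. f (- \<xi>) = cnj (f \<xi>)"
    and T: "0 \<le> T" "8 * A * T \<le> 1"
  obtains U where "wbounded T (2 * A) U"
    "\<And>t \<xi>. \<bar>t\<bar> \<le> T \<Longrightarrow> U t \<xi> = cis (- (sg \<xi> * t)) * f \<xi> - duh U t \<xi>"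
    "\<And>t \<xi>. \<bar>t\<bar> \<le> T \<Longrightarrow> U t (- \<xi>) = cnj (U t \<xi>)"
proof -
  have A: "0 \<le> A"
    using order_trans[OF norm_ge_zero f(2)[of 0]] by (simp add: wt_def)
  have meas: "case_prod (picard f n) \<in> borel_measurable (borel \<Otimes>\<^sub>M borel)" for n
  proof (induction n)
    case (Suc n)
    note [measurable] = duh_measurable[OF Suc] f(1)
    show ?case unfolding picard.simps split_beta' by measurable
  qed (simp add: split_beta')
  have bd: "wbounded T (2 * A) (picard f n)" for n
  proof (induction n)
    case (Suc n)
    have "cmod (picard f (Suc n) t \<xi>) \<le> 2 * A * wt \<xi>" if "\<bar>t\<bar> \<le> T" for t \<xi>
    proof -
      have "cmod (picard f (Suc n) t \<xi>) \<le> A * wt \<xi> + T * (2 * A)\<^sup>2 * wt \<xi>"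
        unfolding picard.simps
        by (intro norm_triangle_le_diff add_mono duh_bound[OF Suc that]) (simp add: norm_mult f)
      also have "T * (2 * A)\<^sup>2 * wt \<xi> = (8 * A * T) * (A * wt \<xi> / 2)"
        by (simp add: power2_eq_square)
      also have "\<dots> \<le> 1 * (A * wt \<xi> / 2)"
        using A wt_nonneg by (intro mult_right_mono T) auto
      finally show ?thesis
        using A wt_nonneg[of \<xi>] mult_nonneg_nonneg[OF A wt_nonneg[of \<xi>]] by linarith
    qed
    then show ?case using meas[of "Suc n"] unfolding wbounded_def by blast
  qed (use A wt_nonneg in \<open>auto simp: wbounded_def split_beta'\<close>)
  have contr: "cmod (duh U t \<xi> - duh V t \<xi>) \<le> d / 2 * wt \<xi>"
    if "wbounded T (2 * A) U" "wbounded T (2 * A) V" "\<bar>t\<bar> \<le> T"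
      and d: "\<And>t \<xi>. \<bar>t\<bar> \<le> T \<Longrightarrow> cmod (U t \<xi> - V t \<xi>) \<le> d * wt \<xi>" for U V t d \<xi>
  proof -
    have "0 \<le> d * wt \<xi>"
      using order_trans[OF norm_ge_zero d[OF that(3)]] .
    have "cmod (duh U t \<xi> - duh V t \<xi>) \<le> T * ((2 * A + 2 * A) * d) * wt \<xi>"
      by (rule duh_diff[OF that(1,2) d that(3)])
    also have "\<dots> = (8 * A * T) * (d * wt \<xi> / 2)" by simp
    also have "\<dots> \<le> 1 * (d * wt \<xi> / 2)"
      using \<open>0 \<le> d * wt \<xi>\<close> by (intro mult_right_mono T) auto
    finally show ?thesis by simp
  qed
  have step: "cmod (picard f (Suc n) t \<xi> - picard f n t \<xi>) \<le> (A / 2 ^ n) * wt \<xi>" if "\<bar>t\<bar> \<le> T" for n t \<xi>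
    using that
  proof (induction n arbitrary: t \<xi>)
    case 0
    \<comment> \<open>The iteration starts from 0, so the first increment is the linear flow, of
      size \<open>A * wt \<xi>\<close>; later increments are halved each time.\<close>
    have "duh (picard f 0) t \<xi> = 0"
      by (simp add: duh_def duhi_def conv_def)
    then show ?case using f(2) by (simp add: norm_mult)
  next
    case (Suc n)
    have "cmod (picard f (Suc (Suc n)) t \<xi> - picard f (Suc n) t \<xi>) = cmod (duh (picard f (Suc n)) t \<xi> - duh (picard f n) t \<xi>)"
      by (simp add: norm_minus_commute)
    also have "\<dots> \<le> (A / 2 ^ n) / 2 * wt \<xi>"
      by (rule contr[OF bd bd Suc.prems Suc.IH])
    finally show ?case by (simp add: mult.commute)
  qed
  define U where "U = (\<lambda>t \<xi>. lim (\<lambda>n. picard f n t \<xi>))"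
  have lims: "(\<lambda>n. picard f n t \<xi>) \<longlonglongrightarrow> U t \<xi>" "cmod (U t \<xi> - picard f n t \<xi>) \<le> (2 * A / 2 ^ n) * wt \<xi>"
    if "\<bar>t\<bar> \<le> T" for t \<xi> n
  proof -
    have s: "cmod (picard f (Suc n) t \<xi> - picard f n t \<xi>) \<le> (A * wt \<xi>) / 2 ^ n" for n
      using step[OF that, of n \<xi>] by simp
    show "(\<lambda>n. picard f n t \<xi>) \<longlonglongrightarrow> U t \<xi>"
      unfolding U_def by (rule geometric_cauchy_limit(1)[OF s])
    show "cmod (U t \<xi> - picard f n t \<xi>) \<le> (2 * A / 2 ^ n) * wt \<xi>"
      unfolding U_def using geometric_cauchy_limit(2)[OF s, of n] by (simp add: mult.assoc)
  qed
  have Um: "case_prod U \<in> borel_measurable (borel \<Otimes>\<^sub>M borel)"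
  proof -
    have "(\<lambda>p. lim (\<lambda>n. case_prod (picard f n) p)) \<in> borel_measurable (borel \<Otimes>\<^sub>M borel)"
      using meas by (rule borel_measurable_lim_metric)
    then show ?thesis by (simp add: U_def split_beta')
  qed
  have Ub: "wbounded T (2 * A) U"
    unfolding wbounded_def
  proof (intro conjI Um allI impI)
    fix t \<xi> assume t: "\<bar>t\<bar> \<le> T"
    show "cmod (U t \<xi>) \<le> 2 * A * wt \<xi>"
      by (rule LIMSEQ_le_const2[OF tendsto_norm[OF lims(1)[OF t]]]) (use wboundedD(3)[OF bd t] in auto)
  qed
  have eq: "U t \<xi> = cis (- (sg \<xi> * t)) * f \<xi> - duh U t \<xi>" if t: "\<bar>t\<bar> \<le> T" for t \<xi>
  proof -
    have "cmod (duh U t \<xi> - duh (picard f n) t \<xi>) \<le> 2 * A / 2 ^ n / 2 * wt \<xi>" for n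
      by (rule contr[OF Ub bd t lims(2)])
    then have le: "cmod (duh U t \<xi> - duh (picard f n) t \<xi>) \<le> A / 2 ^ n * wt \<xi>" for n
      by simp
    have lim0: "(\<lambda>n. A / 2 ^ n * wt \<xi>) \<longlonglongrightarrow> 0" by real_asymp
    have "(\<lambda>n. duh U t \<xi> - duh (picard f n) t \<xi>) \<longlonglongrightarrow> 0"
      by (rule Lim_null_comparison[OF always_eventually lim0]) (use le in blast)
    from tendsto_diff[OF tendsto_const[of "duh U t \<xi>"] this]
    have "(\<lambda>n. duh (picard f n) t \<xi>) \<longlonglongrightarrow> duh U t \<xi>"
      by simp
    then have "(\<lambda>n. picard f (Suc n) t \<xi>) \<longlonglongrightarrow> cis (- (sg \<xi> * t)) * f \<xi> - duh U t \<xi>"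
      unfolding picard.simps by (intro tendsto_intros)
    with LIMSEQ_Suc[OF lims(1)[OF t]] show ?thesis
      by (rule LIMSEQ_unique)
  qed
  have psym: "picard f n t (- \<xi>) = cnj (picard f n t \<xi>)" for n t \<xi>
  proof (induction n arbitrary: t \<xi>)
    case (Suc n)
    show ?case
      unfolding picard.simps duh_cnj[of "picard f n", OF Suc] by (simp add: sg_minus f(3) cis_cnj)
  qed simp
  have "U t (- \<xi>) = cnj (U t \<xi>)" if t: "\<bar>t\<bar> \<le> T" for t \<xi>
    using LIMSEQ_unique[OF lims(1)[OF t, of "- \<xi>", unfolded psym] tendsto_cnj[OF lims(1)[OF t]]] .
  then show thesis
    using that Ub eq by blast
qed


section \<open>The Picard limit solves the equation in Christ's sense\<close>

text \<open>Fubini, with the integrand dominated by a constant multiple of the product of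
  \<open>\<bar>itv t \<tau>\<bar>\<close> and \<open>wt \<xi>\<close>, which is integrable in both
  variables together.\<close>

lemma duhi_mult_schwartz_swap:
  assumes U: "wbounded T a U" and t: "\<bar>t\<bar> \<le> T" and \<theta>: "\<theta> \<in> schwartz"
  shows "(LINT \<tau>|lborel. itv t \<tau> *\<^sub>R (LINT \<xi>|lborel. duhi U t \<xi> \<tau> * \<theta> \<xi>)) = (LINT \<xi>|lborel. duh U t \<xi> * \<theta> \<xi>)"
proof -
  note [measurable] = wboundedD(1)[OF U] schwartz_measurable[OF \<theta>]
  obtain B where B: "0 \<le> B" "\<And>x. cmod (\<theta> x) \<le> B"
    using schwartz_bound0[OF \<theta>, where j = 0] by auto
  have "integrable lborel (\<lambda>\<tau>. complex_of_real \<bar>itv t \<tau>\<bar>)" "integrable lborel (\<lambda>\<xi>. complex_of_real (wt \<xi>))"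
    using abs_itv_integrable wt_integrable by auto
  from kernel_integrable[OF this, of "\<lambda>_ _. of_real (a\<^sup>2 * B)" "a\<^sup>2 * B"]
  have dom: "integrable (lborel \<Otimes>\<^sub>M lborel) (\<lambda>(\<tau>, \<xi>). complex_of_real (a\<^sup>2 * B) * (complex_of_real \<bar>itv t \<tau>\<bar> * complex_of_real (wt \<xi>)))"
    using B by (simp add: norm_mult norm_power)
  have i: "integrable (lborel \<Otimes>\<^sub>M lborel) (\<lambda>(\<tau>, \<xi>). itv t \<tau> *\<^sub>R (duhi U t \<xi> \<tau> * \<theta> \<xi>))"
  proof (rule Bochner_Integration.integrable_bound[OF dom])
    show "(\<lambda>(\<tau>, \<xi>). itv t \<tau> *\<^sub>R (duhi U t \<xi> \<tau> * \<theta> \<xi>)) \<in> borel_measurable (lborel \<Otimes>\<^sub>M lborel)"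
      unfolding split_beta' by measurable
    have "cmod (itv t \<tau> *\<^sub>R (duhi U t \<xi> \<tau> * \<theta> \<xi>)) \<le> a\<^sup>2 * B * (\<bar>itv t \<tau>\<bar> * wt \<xi>)" for \<tau> \<xi>
    proof -
      have "cmod (duhi U t \<xi> \<tau> * \<theta> \<xi>) \<le> (a\<^sup>2 * wt \<xi>) * B" if "\<bar>\<tau>\<bar> \<le> \<bar>t\<bar>" for \<tau>
        unfolding norm_mult using duhi_bound[OF U, of \<tau> t \<xi>] B t that wt_nonneg by (intro mult_mono) auto
      from itv_bound[where t = t and \<tau> = \<tau> and f = "\<lambda>\<tau>. duhi U t \<xi> \<tau> * \<theta> \<xi>", OF this]
      show ?thesis by (simp only: mult_ac)
    qed
    moreover have "cmod (complex_of_real (a\<^sup>2 * B) * (complex_of_real \<bar>itv t \<tau>\<bar> * complex_of_real (wt \<xi>))) = a\<^sup>2 * B * (\<bar>itv t \<tau>\<bar> * wt \<xi>)" for \<tau> \<xi>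
      using B wt_nonneg by (simp add: norm_mult norm_power)
    ultimately show "AE p in lborel \<Otimes>\<^sub>M lborel. norm (case p of (\<tau>, \<xi>) \<Rightarrow> itv t \<tau> *\<^sub>R (duhi U t \<xi> \<tau> * \<theta> \<xi>))
       \<le> norm (case p of (\<tau>, \<xi>) \<Rightarrow> complex_of_real (a\<^sup>2 * B) * (complex_of_real \<bar>itv t \<tau>\<bar> * complex_of_real (wt \<xi>)))"
      by (intro AE_I2) (simp only: split_beta')
  qed
  have "(LINT \<tau>|lborel. itv t \<tau> *\<^sub>R (LINT \<xi>|lborel. duhi U t \<xi> \<tau> * \<theta> \<xi>))
      = (LINT \<tau>|lborel. LINT \<xi>|lborel. itv t \<tau> *\<^sub>R (duhi U t \<xi> \<tau> * \<theta> \<xi>))"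
    by simp
  also have "\<dots> = (LINT \<xi>|lborel. LINT \<tau>|lborel. itv t \<tau> *\<^sub>R (duhi U t \<xi> \<tau> * \<theta> \<xi>))"
    by (rule lborel_pair.Fubini_integral[OF i, symmetric])
  also have "\<dots> = (LINT \<xi>|lborel. duh U t \<xi> * \<theta> \<xi>)"
    by (simp add: duh_def flip: mult_scaleR_left)
  finally show ?thesis .
qed

text \<open>Two dominated convergences, in the convolution variable and then in time. The common
  bound \<open>C\<close> of the cutoffs yields one radius \<open>C * a\<close> for all truncations,
  and their shape is irrelevant, as independence of the truncating sequence demands.\<close>

lemma duh_truncation_tendsto:
  assumes U: "wbounded T a U" and t: "\<bar>t\<bar> \<le> T"
    and m: "\<And>n. m n \<in> borel_measurable borel" "\<And>n \<xi>. cmod (m n \<xi>) \<le> C" "\<And>\<xi>. (\<lambda>n. m n \<xi>) \<longlonglongrightarrow> 1"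
  shows "(\<lambda>n. duh (\<lambda>\<tau> \<xi>. m n \<xi> * U \<tau> \<xi>) t \<xi>) \<longlonglongrightarrow> duh U t \<xi>"
    and "wbounded T (C * a) (\<lambda>\<tau> \<xi>. m n \<xi> * U \<tau> \<xi>)"
proof -
  note [measurable] = wboundedD(1)[OF U] m(1)
  have C: "0 \<le> C" using order_trans[OF norm_ge_zero m(2)] .
  have a: "0 \<le> a" using order_trans[OF norm_ge_zero wboundedD(3)[OF U t, of 0]] by (simp add: wt_def)
  show mU: "wbounded T (C * a) (\<lambda>\<tau> \<xi>. m n \<xi> * U \<tau> \<xi>)" for n
    unfolding wbounded_def
  proof (intro conjI allI impI)
    show "(\<lambda>(\<tau>, \<xi>). m n \<xi> * U \<tau> \<xi>) \<in> borel_measurable (borel \<Otimes>\<^sub>M borel)"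
      unfolding split_beta' by measurable
    fix \<tau> \<xi> assume "\<bar>\<tau>\<bar> \<le> T"
    then show "cmod (m n \<xi> * U \<tau> \<xi>) \<le> C * a * wt \<xi>"
      unfolding norm_mult mult.assoc using C by (intro mult_mono m wboundedD(3)[OF U]) auto
  qed
  have conv: "(\<lambda>n. conv (\<lambda>\<xi>. m n \<xi> * U \<tau> \<xi>) (\<lambda>\<xi>. m n \<xi> * U \<tau> \<xi>) \<xi>) \<longlonglongrightarrow> conv (U \<tau>) (U \<tau>) \<xi>"
    if \<tau>: "\<bar>\<tau>\<bar> \<le> T" for \<tau>
    unfolding conv_def
  \<comment> \<open>One factor of the product is bounded by \<open>C * a\<close> because
    \<open>wt\<close> is at most 1; the other keeps its integrable weight.\<close>
  proof (rule integral_dominated_convergence[where w = "\<lambda>\<eta>. (C * a) * (C * a * wt \<eta>)"])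
    have [measurable]: "U \<tau> \<in> borel_measurable borel"
      by (rule wboundedD(2)[OF U])
    show "(\<lambda>\<eta>. U \<tau> (\<xi> - \<eta>) * U \<tau> \<eta>) \<in> borel_measurable lborel"
      "\<And>n. (\<lambda>\<eta>. m n (\<xi> - \<eta>) * U \<tau> (\<xi> - \<eta>) * (m n \<eta> * U \<tau> \<eta>)) \<in> borel_measurable lborel"
      by measurable
    show "integrable lborel (\<lambda>\<eta>. (C * a) * (C * a * wt \<eta>))"
      using wt_integrable by auto
    have "(\<lambda>n. m n (\<xi> - \<eta>) * U \<tau> (\<xi> - \<eta>) * (m n \<eta> * U \<tau> \<eta>)) \<longlonglongrightarrow> 1 * U \<tau> (\<xi> - \<eta>) * (1 * U \<tau> \<eta>)" for \<eta>
      by (intro tendsto_mult m tendsto_const)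
    then show "AE \<eta> in lborel. (\<lambda>n. m n (\<xi> - \<eta>) * U \<tau> (\<xi> - \<eta>) * (m n \<eta> * U \<tau> \<eta>)) \<longlonglongrightarrow> U \<tau> (\<xi> - \<eta>) * U \<tau> \<eta>"
      by simp
    have "cmod (m n (\<xi> - \<eta>) * U \<tau> (\<xi> - \<eta>) * (m n \<eta> * U \<tau> \<eta>)) \<le> (C * a) * (C * a * wt \<eta>)" for n \<eta>
    proof -
      have "cmod (m n (\<xi> - \<eta>) * U \<tau> (\<xi> - \<eta>)) \<le> C * a * 1"
        using wboundedD(3)[OF mU \<tau>, of n "\<xi> - \<eta>"] mult_left_mono[OF wt_le_1, of "C * a" "\<xi> - \<eta>"] C a by simp
      then show ?thesis
        using wboundedD(3)[OF mU \<tau>, of n \<eta>] C a unfolding norm_mult[of "m n (\<xi> - \<eta>) * U \<tau> (\<xi> - \<eta>)"]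
        by (intro mult_mono) auto
    qed
    then show "AE \<eta> in lborel. cmod (m n (\<xi> - \<eta>) * U \<tau> (\<xi> - \<eta>) * (m n \<eta> * U \<tau> \<eta>)) \<le> (C * a) * (C * a * wt \<eta>)" for n
      by simp
  qed
  show "(\<lambda>n. duh (\<lambda>\<tau> \<xi>. m n \<xi> * U \<tau> \<xi>) t \<xi>) \<longlonglongrightarrow> duh U t \<xi>"
    unfolding duh_def
  proof (rule integral_dominated_convergence[where w = "\<lambda>\<tau>. ((C * a)\<^sup>2 * wt \<xi>) * \<bar>itv t \<tau>\<bar>"])
    note [measurable] = wboundedD(1)[OF mU]
    show "(\<lambda>\<tau>. itv t \<tau> *\<^sub>R duhi U t \<xi> \<tau>) \<in> borel_measurable lborel"
      "\<And>n. (\<lambda>\<tau>. itv t \<tau> *\<^sub>R duhi (\<lambda>\<tau> \<xi>. m n \<xi> * U \<tau> \<xi>) t \<xi> \<tau>) \<in> borel_measurable lborel"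
      by measurable
    show "integrable lborel (\<lambda>\<tau>. ((C * a)\<^sup>2 * wt \<xi>) * \<bar>itv t \<tau>\<bar>)"
      using abs_itv_integrable by auto
    have "(\<lambda>n. itv t \<tau> *\<^sub>R duhi (\<lambda>\<tau> \<xi>. m n \<xi> * U \<tau> \<xi>) t \<xi> \<tau>) \<longlonglongrightarrow> itv t \<tau> *\<^sub>R duhi U t \<xi> \<tau>" for \<tau>
    proof (cases "itv t \<tau> = 0")
      case False
      then have "\<bar>\<tau>\<bar> \<le> T" using t by (auto simp: itv_def split: if_splits)
      then show ?thesis
        unfolding duhi_def by (intro tendsto_scaleR tendsto_mult tendsto_const conv)
    qed simp
    then show "AE \<tau> in lborel. (\<lambda>n. itv t \<tau> *\<^sub>R duhi (\<lambda>\<tau> \<xi>. m n \<xi> * U \<tau> \<xi>) t \<xi> \<tau>) \<longlonglongrightarrow> itv t \<tau> *\<^sub>R duhi U t \<xi> \<tau>"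
      by simp
    show "AE \<tau> in lborel. cmod (itv t \<tau> *\<^sub>R duhi (\<lambda>\<tau> \<xi>. m n \<xi> * U \<tau> \<xi>) t \<xi> \<tau>) \<le> ((C * a)\<^sup>2 * wt \<xi>) * \<bar>itv t \<tau>\<bar>" for n
    proof (rule AE_I2)
      fix \<tau>
      show "cmod (itv t \<tau> *\<^sub>R duhi (\<lambda>\<tau> \<xi>. m n \<xi> * U \<tau> \<xi>) t \<xi> \<tau>) \<le> ((C * a)\<^sup>2 * wt \<xi>) * \<bar>itv t \<tau>\<bar>"
        by (rule itv_bound) (use duhi_bound[OF mU] t in auto)
    qed
  qed
qed

text \<open>For each truncation the pairing is computed on the Fourier side, where Fubini turns it
  into a pairing with \<open>duh\<close>. The limit is then a third dominated convergence, now in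
  the frequency.\<close>

lemma has_duhamel_integral_duh:
  assumes U: "wbounded T a U" and t: "\<bar>t\<bar> \<le> T" and v: "has_fourier v (duh U t)"
  shows "has_duhamel_integral (\<lambda>\<tau>. tdist_of_fun (inv_fourier (U \<tau>))) t v"
  unfolding has_duhamel_integral_def
proof (intro allI impI ballI)
  fix m \<psi> assume m: "fourier_cutoffs m" and \<psi>: "\<psi> \<in> schwartz"
  let ?u = "\<lambda>\<tau>. tdist_of_fun (inv_fourier (U \<tau>))"
  obtain C where mm: "\<And>n. m n \<in> borel_measurable borel" and C: "\<And>n \<xi>. cmod (m n \<xi>) \<le> C"
    and lim: "\<And>\<xi>. (\<lambda>n. m n \<xi>) \<longlonglongrightarrow> 1" and R: "\<And>n. \<exists>R. \<forall>\<xi>. R < \<bar>\<xi>\<bar> \<longrightarrow> m n \<xi> = 0"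
    using m unfolding fourier_cutoffs_def by blast
  define h where "h = (\<lambda>n \<tau> \<xi>. m n \<xi> * U \<tau> \<xi>)"
  have tr: "(\<lambda>n. duh (h n) t \<xi>) \<longlonglongrightarrow> duh U t \<xi>" "wbounded T (C * a) (h n)" for n \<xi>
    unfolding h_def by (rule duh_truncation_tendsto[of T a U t m C, OF U t mm C lim])+
  \<comment> \<open>\<open>has_fourier\<close> evaluates distributions only on transforms of test
    functions, so \<open>\<psi>\<close> is written as one.\<close>
  define \<theta> where "\<theta> = inv_fourier \<psi>"
  have \<theta>: "\<theta> \<in> schwartz" and \<psi>_eq: "fourier \<theta> = \<psi>"
    using inv_fourier_schwartz[OF \<psi>] fourier_inv_fourier[OF \<psi>] by (auto simp: \<theta>_def)
  note [measurable] = schwartz_measurable[OF \<theta>]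
  obtain B where B: "0 \<le> B" "\<And>x. cmod (\<theta> x) \<le> B"
    using schwartz_bound0[OF \<theta>, where j = 0] by auto
  have hf: "has_fourier (?u \<tau>) (U \<tau>)" if "\<bar>\<tau>\<bar> \<le> T" for \<tau>
    using wboundedD(2,3)[OF U] that by (intro has_fourier_inv_fourier integrable_wt_bound[where A = a])
  have "(LBINT \<tau>=ereal 0..ereal t. tapply (Sgrp (t - \<tau>) (Lam (truncated_uux (m n) (?u \<tau>)))) \<psi>)
      = (LINT \<xi>|lborel. duh (h n) t \<xi> * \<theta> \<xi>)" for n
  proof -
    obtain r where r: "\<And>\<xi>. r < \<bar>\<xi>\<bar> \<Longrightarrow> m n \<xi> = 0"
      using R by blast
    have "itv t \<tau> *\<^sub>R tapply (Sgrp (t - \<tau>) (Lam (truncated_uux (m n) (?u \<tau>)))) \<psi>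
        = itv t \<tau> *\<^sub>R (LINT \<xi>|lborel. duhi (h n) t \<xi> \<tau> * \<theta> \<xi>)" for \<tau>
    \<comment> \<open>\<open>U \<tau>\<close> is controlled only for
      \<open>\<bar>\<tau>\<bar> \<le> T\<close>, so the transforms are identified where
      \<open>itv\<close> is nonzero; elsewhere both sides are 0.\<close>
    proof (cases "itv t \<tau> = 0")
      case False
      then have \<tau>: "\<bar>\<tau>\<bar> \<le> T" using t by (auto simp: itv_def split: if_splits)
      have "has_fourier (Sgrp (t - \<tau>) (Lam (truncated_uux (m n) (?u \<tau>)))) (\<lambda>\<xi>. duhi (h n) t \<xi> \<tau>)"
        unfolding duhi_def h_def
        by (rule has_fourier_duhamel_integrand[OF hf[OF \<tau>] wboundedD(2)[OF U] wboundedD(3)[OF U \<tau>] mm C r])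
      then show ?thesis
        using \<theta> \<psi>_eq by (auto simp: has_fourier_def)
    qed simp
    then show ?thesis
      unfolding LBINT_eq_itv by (simp only: duhi_mult_schwartz_swap[OF tr(2) t \<theta>])
  qed
  moreover have "(\<lambda>n. LINT \<xi>|lborel. duh (h n) t \<xi> * \<theta> \<xi>) \<longlonglongrightarrow> (LINT \<xi>|lborel. duh U t \<xi> * \<theta> \<xi>)"
  proof (rule integral_dominated_convergence[where w = "\<lambda>\<xi>. T * (C * a)\<^sup>2 * wt \<xi> * B"])
    have dm: "duh V t \<in> borel_measurable borel" if "wbounded T b V" for b V
      by (rule duh_measurable[OF wboundedD(1)[OF that], where f = "\<lambda>_. t" and g = "\<lambda>x. x"]) simp_all
    have [measurable]: "duh U t \<in> borel_measurable borel" "duh (h n) t \<in> borel_measurable borel" for n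
      by (rule dm[OF U], rule dm[OF tr(2)])
    show "(\<lambda>\<xi>. duh U t \<xi> * \<theta> \<xi>) \<in> borel_measurable lborel" "\<And>n. (\<lambda>\<xi>. duh (h n) t \<xi> * \<theta> \<xi>) \<in> borel_measurable lborel"
      by measurable
    show "integrable lborel (\<lambda>\<xi>. T * (C * a)\<^sup>2 * wt \<xi> * B)"
      using wt_integrable by auto
    show "AE \<xi> in lborel. (\<lambda>n. duh (h n) t \<xi> * \<theta> \<xi>) \<longlonglongrightarrow> duh U t \<xi> * \<theta> \<xi>"
      by (intro AE_I2 tendsto_mult tr tendsto_const)
    show "AE \<xi> in lborel. cmod (duh (h n) t \<xi> * \<theta> \<xi>) \<le> T * (C * a)\<^sup>2 * wt \<xi> * B" for n
      using duh_bound[OF tr(2) t] B order_trans[OF norm_ge_zero duh_bound[OF tr(2) t]]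
      unfolding norm_mult by (intro AE_I2 mult_mono) auto
  qed
  moreover have "tapply v \<psi> = (LINT \<xi>|lborel. duh U t \<xi> * \<theta> \<xi>)"
    using v \<theta> \<psi>_eq by (auto simp: has_fourier_def)
  ultimately show "(\<lambda>n. LBINT \<tau>=ereal 0..ereal t. tapply (Sgrp (t - \<tau>) (Lam (truncated_uux (m n) (?u \<tau>)))) \<psi>) \<longlonglongrightarrow> tapply v \<psi>"
    by simp
qed

text \<open>Continuity in time comes from a Lipschitz bound in the weighted norm, which dominates
  the \<open>Hs s\<close> norm; membership in \<open>X\<close> comes from the Hermitian
  symmetry.\<close>

lemma is_solution_of_duh:
  assumes f: "f \<in> borel_measurable borel" "\<And>\<xi>. cmod (f \<xi>) \<le> A * wt \<xi>"
    and U: "wbounded T a U"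
    and eq: "\<And>t \<xi>. \<bar>t\<bar> \<le> T \<Longrightarrow> U t \<xi> = cis (- (sg \<xi> * t)) * f \<xi> - duh U t \<xi>"
    and sym: "\<And>t \<xi>. \<bar>t\<bar> \<le> T \<Longrightarrow> U t (- \<xi>) = cnj (U t \<xi>)"
    and s: "s < 0" and X: "Hs_real s \<subseteq> X"
  shows "is_solution X s T (tdist_of_fun (inv_fourier f)) (\<lambda>t. tdist_of_fun (inv_fourier (U t)))"
proof -
  let ?u = "\<lambda>t. tdist_of_fun (inv_fourier (U t))"
  have fi: "integrable lborel f" using integrable_wt_bound[OF f] .
  have Ui: "integrable lborel (U t)" if "\<bar>t\<bar> \<le> T" for t
    using integrable_wt_bound[OF wboundedD(2)[OF U] wboundedD(3)[OF U that]] .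
  have hf: "has_fourier (?u t) (U t)" if "\<bar>t\<bar> \<le> T" for t
    by (rule has_fourier_inv_fourier[OF Ui[OF that]])
  have lip: "cmod (U \<tau> \<xi> - U t \<xi>) \<le> (A + (T + 1) * a\<^sup>2) * \<bar>\<tau> - t\<bar> * wt \<xi>"
    if \<tau>: "\<bar>\<tau>\<bar> \<le> T" and t: "\<bar>t\<bar> \<le> T" for \<tau> t \<xi>
  proof -
    have "cmod (cis (- (sg \<xi> * \<tau>)) - cis (- (sg \<xi> * t))) \<le> \<bar>sg \<xi>\<bar> * \<bar>\<tau> - t\<bar>"
      using cis_diff_bound[of "- (sg \<xi> * \<tau>)" "- (sg \<xi> * t)"]
      by (simp add: abs_minus_commute[of t] flip: right_diff_distrib) (simp add: abs_mult abs_minus_commute)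
    also have "\<dots> \<le> 1 * \<bar>\<tau> - t\<bar>"
      by (intro mult_right_mono abs_sg_le) auto
    finally have c: "cmod (cis (- (sg \<xi> * \<tau>)) - cis (- (sg \<xi> * t))) \<le> \<bar>\<tau> - t\<bar>" by simp
    have "U \<tau> \<xi> - U t \<xi> = (cis (- (sg \<xi> * \<tau>)) * f \<xi> - duh U \<tau> \<xi>) - (cis (- (sg \<xi> * t)) * f \<xi> - duh U t \<xi>)"
      by (rule arg_cong2[where f = "(-)", OF eq[OF \<tau>] eq[OF t]])
    also have "\<dots> = (cis (- (sg \<xi> * \<tau>)) - cis (- (sg \<xi> * t))) * f \<xi> - (duh U \<tau> \<xi> - duh U t \<xi>)"
      by (simp add: algebra_simps)
    also have "cmod \<dots> \<le> \<bar>\<tau> - t\<bar> * (A * wt \<xi>) + (T + 1) * a\<^sup>2 * \<bar>\<tau> - t\<bar> * wt \<xi>"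
      by (intro norm_triangle_le_diff add_mono duh_lipschitz[OF U \<tau> t])
         (auto simp: norm_mult intro!: mult_mono c f)
    finally show ?thesis by (simp add: algebra_simps)
  qed
  have cont: "((\<lambda>\<tau>. Hs_norm s (?u \<tau> - ?u t)) \<longlongrightarrow> 0) (at t within {-T..T})" if t: "t \<in> {-T..T}" for t
  proof (rule tendsto_sandwich[OF _ _ tendsto_const])
    let ?g = "\<lambda>\<tau>. (A + (T + 1) * a\<^sup>2) * \<bar>\<tau> - t\<bar> * sqrt pi"
    show "\<forall>\<^sub>F \<tau> in at t within {-T..T}. 0 \<le> Hs_norm s (?u \<tau> - ?u t)"
      by (simp add: Hs_norm_nonneg)
    show "\<forall>\<^sub>F \<tau> in at t within {-T..T}. Hs_norm s (?u \<tau> - ?u t) \<le> ?g \<tau>"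
      unfolding eventually_at_filter
    proof (intro always_eventually allI impI)
      fix \<tau> assume "\<tau> \<in> {-T..T}"
      with t have *: "\<bar>\<tau>\<bar> \<le> T" "\<bar>t\<bar> \<le> T" by auto
      show "Hs_norm s (?u \<tau> - ?u t) \<le> ?g \<tau>"
        by (rule Hs_norm_le[OF has_fourier_diff[OF hf[OF *(1)] hf[OF *(2)]]]) (use s lip[OF *] in auto)
    qed
    show "(?g \<longlongrightarrow> 0) (at t within {-T..T})"
      by (auto intro!: tendsto_eq_intros)
  qed
  have duhamel: "\<exists>v. has_duhamel_integral ?u t v \<and> ?u t = Sgrp t (tdist_of_fun (inv_fourier f)) - v"
    if "t \<in> {-T..T}" for t
  proof -
    from that have t: "\<bar>t\<bar> \<le> T" by auto
    \<comment> \<open>Defining the integral as this difference makes the Duhamel identity automatic;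
      what remains is that its transform is \<open>duh U t\<close>, which is the fixed-point
      equation.\<close>
    let ?v = "Sgrp t (tdist_of_fun (inv_fourier f)) - ?u t"
    have "has_fourier ?v (\<lambda>\<xi>. cis (- (sg \<xi> * t)) * f \<xi> - U t \<xi>)"
      by (intro has_fourier_diff has_fourier_Sgrp has_fourier_inv_fourier fi Ui t)
    moreover have "(\<lambda>\<xi>. cis (- (sg \<xi> * t)) * f \<xi> - U t \<xi>) = duh U t"
      using eq[OF t] by auto
    ultimately have "has_duhamel_integral ?u t ?v"
      using has_duhamel_integral_duh[OF U t] by simp
    then show ?thesis by (intro exI[of _ ?v]) simp
  qed
  have "?u t \<in> X" if "t \<in> {-T..T}" for t
  proof -
    from that have t: "\<bar>t\<bar> \<le> T" by auto
    have "?u t \<in> Hs_real s"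
      by (rule Hs_real_inv_fourier[OF _ wboundedD(2)[OF U] wboundedD(3)[OF U t] sym[OF t]]) (use s in simp)
    then show ?thesis using X by blast
  qed
  then show ?thesis
    unfolding is_solution_def using cont duhamel by blast
qed


section \<open>A low-frequency functional\<close>

text \<open>The factor \<open>- \<i> * cis (sg \<xi> * t)\<close> undoes the phase of the group and the factor \<open>\<i>\<close> of the
  nonlinearity, so that the quadratic term of the flow of a packet has positive real part.\<close>

definition lfun :: "real \<Rightarrow> (real \<Rightarrow> complex) \<Rightarrow> real" where
  "lfun t g = (LINT \<xi>|lborel. Re (- \<i> * cis (sg \<xi> * t) * (indicator {1/4..1/2} \<xi> *\<^sub>R g \<xi>)))"

lemma lfun_integrable:
  assumes "integrable lborel (\<lambda>\<xi>. indicator {1/4..1/2} \<xi> *\<^sub>R g \<xi> :: complex)"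
  shows "integrable lborel (\<lambda>\<xi>. Re (- \<i> * cis (sg \<xi> * t) * (indicator {1/4..1/2} \<xi> *\<^sub>R g \<xi>)))"
  by (intro integrable_Re integrable_bounded_mult[OF assms, where C = 1]) (auto simp: norm_mult)

lemma lfun_diff:
  assumes "integrable lborel (\<lambda>\<xi>. indicator {1/4..1/2} \<xi> *\<^sub>R g \<xi> :: complex)"
    "integrable lborel (\<lambda>\<xi>. indicator {1/4..1/2} \<xi> *\<^sub>R h \<xi> :: complex)"
  shows "lfun t (\<lambda>\<xi>. g \<xi> - h \<xi>) = lfun t g - lfun t h"
  unfolding lfun_def
  by (subst Bochner_Integration.integral_diff[OF lfun_integrable[OF assms(1)] lfun_integrable[OF assms(2)], symmetric])
     (intro Bochner_Integration.integral_cong, auto simp: indicator_def algebra_simps)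

lemma lfun_scaleR: "lfun t (\<lambda>\<xi>. c *\<^sub>R g \<xi>) = c * lfun t g"
proof -
  have "lfun t (\<lambda>\<xi>. c *\<^sub>R g \<xi>) = (LINT \<xi>|lborel. c * Re (- \<i> * cis (sg \<xi> * t) * (indicator {1/4..1/2} \<xi> *\<^sub>R g \<xi>)))"
    unfolding lfun_def by (intro Bochner_Integration.integral_cong) (auto simp: indicator_def algebra_simps)
  then show ?thesis by (simp only: lfun_def integral_mult_right_zero)
qed

lemma wt_window_integrable:
  assumes "g \<in> borel_measurable borel" "\<And>\<xi>. cmod (g \<xi>) \<le> a * wt \<xi>"
  shows "integrable lborel (\<lambda>\<xi>. indicator {1/4..1/2} \<xi> *\<^sub>R g \<xi> :: complex)"
  using integrable_wt_bound[OF assms] by (intro integrable_mult_indicator) auto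

lemma Re_window_le: "\<bar>Re (- \<i> * cis a * (indicator A \<xi> *\<^sub>R z))\<bar> \<le> indicator A \<xi> * cmod z"
  by (rule order_trans[OF abs_Re_le_cmod]) (simp add: norm_mult)

lemma lfun_wt_bound:
  assumes "\<And>\<xi>. cmod (g \<xi>) \<le> a * wt \<xi>"
  shows "\<bar>lfun t g\<bar> \<le> a * pi"
proof -
  have "norm (lfun t g) \<le> (LINT \<xi>|lborel. a * wt \<xi>)"
    unfolding lfun_def
  proof (rule norm_integral_le)
    show "integrable lborel (\<lambda>\<xi>. a * wt \<xi>)" using wt_integrable by auto
    fix \<xi>
    have "indicator {1/4..1/2} \<xi> * cmod (g \<xi>) \<le> 1 * cmod (g \<xi>)"
      by (intro mult_right_mono) (auto simp: indicator_def)
    then show "norm (Re (- \<i> * cis (sg \<xi> * t) * (indicator {1/4..1/2} \<xi> *\<^sub>R g \<xi>))) \<le> a * wt \<xi>"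
      using Re_window_le[of "sg \<xi> * t" "{1/4..1/2}" \<xi> "g \<xi>"] assms[of \<xi>] by simp
  qed
  then show ?thesis by (simp add: wt_integral)
qed

text \<open>Young's inequality \<open>2 * cmod z \<le> (cmod z)\<^sup>2 / c + c\<close>, combined
  with \<open>1 + \<xi>\<^sup>2 \<le> 5 / 4\<close> on the window, which bounds the Sobolev weight
  below. The free parameter \<open>c\<close> allows a later optimisation in place of the
  Cauchy-Schwarz inequality.\<close>

lemma window_weight_bound:
  assumes "s \<le> 0" "0 < c"
  shows "indicator {1/4..1/2} \<xi> * cmod z \<le>
    ((5/4) powr (-s) / c * ((1 + \<xi>\<^sup>2) powr s * (cmod z)\<^sup>2) + c * indicator {1/4..1/2} \<xi>) / 2"
proof (cases "\<xi> \<in> {1/4..1/2::real}")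
  case True
  have "\<xi>\<^sup>2 \<le> (1/2)\<^sup>2" using True by (intro power_mono) auto
  then have le: "1 + \<xi>\<^sup>2 \<le> 5/4" by (simp add: power2_eq_square)
  have pos: "0 < 1 + \<xi>\<^sup>2" by (auto intro: add_pos_nonneg)
  have "(1 + \<xi>\<^sup>2) powr (-s) \<le> (5/4) powr (-s)"
    using assms(1) le by (intro powr_mono2) auto
  then have "1 \<le> (5/4) powr (-s) * (1 + \<xi>\<^sup>2) powr s"
    using pos by (simp add: powr_minus field_simps)
  then have "(cmod z)\<^sup>2 / c \<le> ((5/4) powr (-s) * (1 + \<xi>\<^sup>2) powr s) * ((cmod z)\<^sup>2 / c)"
    using assms(2) mult_right_mono[of 1 "(5/4) powr (-s) * (1 + \<xi>\<^sup>2) powr s" "(cmod z)\<^sup>2 / c"] by simp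
  moreover have "2 * cmod z \<le> (cmod z)\<^sup>2 / c + c"
    using zero_le_power2[of "cmod z - c"] assms(2) by (simp add: power2_eq_square field_simps)
  ultimately show ?thesis using True by (simp add: mult_ac)
next
  case False
  then show ?thesis using assms(2) by (simp del: atLeastAtMost_iff)
qed

lemma Hs_window_integrable:
  assumes u: "has_fourier u g" and i: "integrable lborel (\<lambda>\<xi>. (1 + \<xi>\<^sup>2) powr s * (cmod (g \<xi>))\<^sup>2)" and s: "s \<le> 0"
  shows "integrable lborel (\<lambda>\<xi>. indicator {1/4..1/2} \<xi> *\<^sub>R g \<xi> :: complex)"
proof (rule Bochner_Integration.integrable_bound)
  show "integrable lborel (\<lambda>\<xi>. ((5/4) powr (-s) / 1 * ((1 + \<xi>\<^sup>2) powr s * (cmod (g \<xi>))\<^sup>2) + 1 * indicator {1/4..1/2::real} \<xi>) / 2)"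
    using i by (intro integrable_divide Bochner_Integration.integrable_add integrable_mult_right integrable_real_indicator) auto
  have "g \<in> borel_measurable borel" using u by (simp add: has_fourier_def)
  then show "(\<lambda>\<xi>. indicator {1/4..1/2} \<xi> *\<^sub>R g \<xi> :: complex) \<in> borel_measurable lborel"
    by measurable
  show "AE \<xi> in lborel. norm (indicator {1/4..1/2} \<xi> *\<^sub>R g \<xi> :: complex) \<le>
      norm (((5/4) powr (-s) / 1 * ((1 + \<xi>\<^sup>2) powr s * (cmod (g \<xi>))\<^sup>2) + 1 * indicator {1/4..1/2::real} \<xi>) / 2)"
  proof (rule AE_I2)
    fix \<xi>
    show "norm (indicator {1/4..1/2} \<xi> *\<^sub>R g \<xi> :: complex) \<le>
      norm (((5/4) powr (-s) / 1 * ((1 + \<xi>\<^sup>2) powr s * (cmod (g \<xi>))\<^sup>2) + 1 * indicator {1/4..1/2::real} \<xi>) / 2)"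
      using window_weight_bound[OF s, of 1 \<xi> "g \<xi>"] by simp
  qed
qed

lemma lfun_fhat:
  assumes "has_fourier u g"
  shows "lfun t (fhat u) = lfun t g"
proof -
  have [measurable]: "fhat u \<in> borel_measurable borel" "g \<in> borel_measurable borel"
    using has_fourier_fhat[OF assms] assms by (auto simp: has_fourier_def)
  show ?thesis
    unfolding lfun_def
  proof (rule integral_cong_AE)
    show "AE \<xi> in lborel. Re (- \<i> * cis (sg \<xi> * t) * (indicator {1/4..1/2} \<xi> *\<^sub>R fhat u \<xi>))
        = Re (- \<i> * cis (sg \<xi> * t) * (indicator {1/4..1/2} \<xi> *\<^sub>R g \<xi>))"
      using fhat_AE[OF assms] by eventually_elim simp
  qed measurable
qed

text \<open>Low frequencies are controlled by the \<open>Hs s\<close> norm even for negative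
  \<open>s\<close>. Integrating \<open>window_weight_bound\<close> and choosing \<open>c\<close>
  near the norm makes the two terms comparable; the \<open>c / 4\<close> is the window length times
  \<open>c\<close>.\<close>

lemma lfun_Hs_bound:
  assumes "u \<in> Hs s" "s \<le> 0"
  shows "\<bar>lfun t (fhat u)\<bar> \<le> ((5/4) powr (-s) + 1) * Hs_norm s u"
proof -
  define D where "D = (5/4::real) powr (-s)"
  have D: "0 \<le> D" by (simp add: D_def)
  obtain g where g: "has_fourier u g" and i: "integrable lborel (\<lambda>\<xi>. (1 + \<xi>\<^sup>2) powr s * (cmod (g \<xi>))\<^sup>2)"
    using assms(1) by (auto simp: Hs_def)
  define N where "N = Hs_norm s u"
  have N: "0 \<le> N" by (simp add: N_def Hs_norm_nonneg)
  have N2: "(LINT \<xi>|lborel. (1 + \<xi>\<^sup>2) powr s * (cmod (g \<xi>))\<^sup>2) = N\<^sup>2"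
    unfolding N_def Hs_norm_eq[OF g] by (intro real_sqrt_pow2[symmetric] Bochner_Integration.integral_nonneg) simp
  have main: "\<bar>lfun t g\<bar> \<le> (D * N\<^sup>2 / c + c / 4) / 2" if c: "0 < c" for c
  proof -
    have ib: "integrable lborel (\<lambda>\<xi>. c * indicator {1/4..1/2::real} \<xi>)"
      by (auto intro!: integrable_real_indicator)
    have ia: "integrable lborel (\<lambda>\<xi>. D / c * ((1 + \<xi>\<^sup>2) powr s * (cmod (g \<xi>))\<^sup>2))"
      using i by (rule integrable_mult_right)
    have "norm (lfun t g) \<le> (LINT \<xi>|lborel. (D / c * ((1 + \<xi>\<^sup>2) powr s * (cmod (g \<xi>))\<^sup>2) + c * indicator {1/4..1/2::real} \<xi>) / 2)"
      unfolding lfun_def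
    proof (rule norm_integral_le)
      show "integrable lborel (\<lambda>\<xi>. (D / c * ((1 + \<xi>\<^sup>2) powr s * (cmod (g \<xi>))\<^sup>2) + c * indicator {1/4..1/2::real} \<xi>) / 2)"
        by (intro integrable_divide Bochner_Integration.integrable_add ia ib)
      fix \<xi>
      show "norm (Re (- \<i> * cis (sg \<xi> * t) * (indicator {1/4..1/2} \<xi> *\<^sub>R g \<xi>)))
          \<le> (D / c * ((1 + \<xi>\<^sup>2) powr s * (cmod (g \<xi>))\<^sup>2) + c * indicator {1/4..1/2::real} \<xi>) / 2"
        unfolding real_norm_def D_def
        by (rule order_trans[OF Re_window_le window_weight_bound[OF assms(2) c]])
    qed
    also have "\<dots> = (D / c * N\<^sup>2 + c * (1/4)) / 2"
      unfolding integral_divide_zero Bochner_Integration.integral_add[OF ia ib] integral_mult_right_zero N2 by simp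
    finally show ?thesis by simp
  qed
  have "\<bar>lfun t g\<bar> \<le> (D + 1) * N"
  \<comment> \<open>The natural choice \<open>c = N\<close> fails when the norm vanishes, hence
    \<open>c = N + e\<close> with arbitrary positive \<open>e\<close>.\<close>
  proof (rule field_le_epsilon)
    fix e :: real assume e: "0 < e"
    have "N\<^sup>2 / (N + e) \<le> N"
      using N e by (simp add: power2_eq_square divide_le_eq mult_left_mono)
    then have q: "D * N\<^sup>2 / (N + e) \<le> D * N"
      using D mult_left_mono[of "N\<^sup>2 / (N + e)" N D] by simp
    have "\<bar>lfun t g\<bar> \<le> (D * N\<^sup>2 / (N + e) + (N + e) / 4) / 2"
      by (rule main[OF add_nonneg_pos[OF N e]])
    also have "\<dots> \<le> (D * N + (N + e) / 4) / 2"
      using q by (intro divide_right_mono add_right_mono) auto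
    also have "\<dots> \<le> D * N + N + e"
      using mult_nonneg_nonneg[OF D N] N e by (simp add: field_simps)
    finally show "\<bar>lfun t g\<bar> \<le> (D + 1) * N + e"
      by (simp add: algebra_simps)
  qed
  then show ?thesis
    unfolding lfun_fhat[OF g] D_def N_def .
qed

section \<open>Linear structure of the Sobolev spaces and linearity of the functional\<close>

lemma Hs_diff:
  assumes "u \<in> Hs s" "v \<in> Hs s"
  shows "u - v \<in> Hs s"
proof -
  obtain g h where g: "has_fourier u g" "integrable lborel (\<lambda>\<xi>. (1 + \<xi>\<^sup>2) powr s * (cmod (g \<xi>))\<^sup>2)"
    and h: "has_fourier v h" "integrable lborel (\<lambda>\<xi>. (1 + \<xi>\<^sup>2) powr s * (cmod (h \<xi>))\<^sup>2)"
    using assms by (auto simp: Hs_def)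
  have [measurable]: "g \<in> borel_measurable borel" "h \<in> borel_measurable borel"
    using g h by (auto simp: has_fourier_def)
  have "integrable lborel (\<lambda>\<xi>. (1 + \<xi>\<^sup>2) powr s * (cmod (g \<xi> - h \<xi>))\<^sup>2)"
  proof (rule Bochner_Integration.integrable_bound)
    show "integrable lborel (\<lambda>\<xi>. 2 * ((1 + \<xi>\<^sup>2) powr s * (cmod (g \<xi>))\<^sup>2) + 2 * ((1 + \<xi>\<^sup>2) powr s * (cmod (h \<xi>))\<^sup>2))"
      using g h by (intro Bochner_Integration.integrable_add integrable_mult_right)
    have "(1 + \<xi>\<^sup>2) powr s * (cmod (g \<xi> - h \<xi>))\<^sup>2 \<le> 2 * ((1 + \<xi>\<^sup>2) powr s * (cmod (g \<xi>))\<^sup>2) + 2 * ((1 + \<xi>\<^sup>2) powr s * (cmod (h \<xi>))\<^sup>2)" for \<xi>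
    proof -
      have "(cmod (g \<xi> - h \<xi>))\<^sup>2 \<le> (cmod (g \<xi>) + cmod (h \<xi>))\<^sup>2"
        by (intro power_mono norm_triangle_ineq4) auto
      also have "\<dots> \<le> 2 * (cmod (g \<xi>))\<^sup>2 + 2 * (cmod (h \<xi>))\<^sup>2"
        using zero_le_power2[of "cmod (g \<xi>) - cmod (h \<xi>)"] by (simp add: power2_eq_square algebra_simps)
      finally have "(1 + \<xi>\<^sup>2) powr s * (cmod (g \<xi> - h \<xi>))\<^sup>2 \<le> (1 + \<xi>\<^sup>2) powr s * (2 * (cmod (g \<xi>))\<^sup>2 + 2 * (cmod (h \<xi>))\<^sup>2)"
        by (rule mult_left_mono) simp
      then show ?thesis by (simp add: algebra_simps)
    qed
    then show "AE \<xi> in lborel. norm ((1 + \<xi>\<^sup>2) powr s * (cmod (g \<xi> - h \<xi>))\<^sup>2)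
        \<le> norm (2 * ((1 + \<xi>\<^sup>2) powr s * (cmod (g \<xi>))\<^sup>2) + 2 * ((1 + \<xi>\<^sup>2) powr s * (cmod (h \<xi>))\<^sup>2))"
      by (intro AE_I2) simp
  qed measurable
  then show ?thesis
    using has_fourier_diff[OF g(1) h(1)] by (auto simp: Hs_def)
qed

lemma Hs_scaleR:
  assumes "u \<in> Hs s"
  shows "c *\<^sub>R u \<in> Hs s"
proof -
  obtain g where g: "has_fourier u g" "integrable lborel (\<lambda>\<xi>. (1 + \<xi>\<^sup>2) powr s * (cmod (g \<xi>))\<^sup>2)"
    using assms by (auto simp: Hs_def)
  have "integrable lborel (\<lambda>\<xi>. c\<^sup>2 * ((1 + \<xi>\<^sup>2) powr s * (cmod (g \<xi>))\<^sup>2))"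
    using g(2) by (rule integrable_mult_right)
  then have "integrable lborel (\<lambda>\<xi>. (1 + \<xi>\<^sup>2) powr s * (cmod (c *\<^sub>R g \<xi>))\<^sup>2)"
    by (simp add: power_mult_distrib mult_ac)
  with has_fourier_scaleR[OF g(1), of c] show ?thesis
    unfolding Hs_def by blast
qed

lemma Hs_real_scaleR: "u \<in> Hs_real s \<Longrightarrow> c *\<^sub>R u \<in> Hs_real s"
  by (auto simp: Hs_real_def Hs_scaleR scaleR_tdist.rep_eq scaleR_conv_of_real)

lemma lfun_fhat_diff:
  assumes "u \<in> Hs s" "v \<in> Hs s" "s \<le> 0"
  shows "lfun t (fhat (u - v)) = lfun t (fhat u) - lfun t (fhat v)"
proof -
  obtain g h where g: "has_fourier u g" "integrable lborel (\<lambda>\<xi>. (1 + \<xi>\<^sup>2) powr s * (cmod (g \<xi>))\<^sup>2)"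
    and h: "has_fourier v h" "integrable lborel (\<lambda>\<xi>. (1 + \<xi>\<^sup>2) powr s * (cmod (h \<xi>))\<^sup>2)"
    using assms by (auto simp: Hs_def)
  show ?thesis
    unfolding lfun_fhat[OF g(1)] lfun_fhat[OF h(1)] lfun_fhat[OF has_fourier_diff[OF g(1) h(1)]]
    by (rule lfun_diff[OF Hs_window_integrable[OF g assms(3)] Hs_window_integrable[OF h assms(3)]])
qed

lemma lfun_fhat_scaleR:
  assumes "u \<in> Hs s"
  shows "lfun t (fhat (c *\<^sub>R u)) = c * lfun t (fhat u)"
proof -
  obtain g where g: "has_fourier u g"
    using assms by (auto simp: Hs_def)
  show ?thesis
    unfolding lfun_fhat[OF g] lfun_fhat[OF has_fourier_scaleR[OF g]] by (rule lfun_scaleR)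
qed

section \<open>The second-order coefficient of a twice differentiable map\<close>

text \<open>Uniqueness of the second-order Taylor coefficient. The derivative \<open>g1\<close> is
  differentiable at the single point 0, so the argument compares \<open>g\<close> with its candidate
  Taylor polynomial by one application of the mean value theorem, in the manner of Peano's
  remainder.\<close>

lemma second_order_coefficient:
  fixes g g1 :: "real \<Rightarrow> real"
  assumes r: "0 < r" and g: "\<And>\<epsilon>. \<bar>\<epsilon>\<bar> < r \<Longrightarrow> (g has_real_derivative g1 \<epsilon>) (at \<epsilon>)"
    and g1: "(g1 has_real_derivative b) (at 0)"
    and M: "\<And>\<epsilon>. \<bar>\<epsilon>\<bar> < r \<Longrightarrow> \<bar>g \<epsilon> - \<epsilon> * l1 - \<epsilon>\<^sup>2 * l2\<bar> \<le> M * \<bar>\<epsilon>\<bar> ^ 3"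
  shows "l2 = b / 2"
proof -
  have ev: "\<forall>\<^sub>F h in at (0::real). \<bar>h\<bar> < r"
    using r by (auto simp: eventually_at intro!: exI[of _ r])
  have g0: "g 0 = 0" using M[of 0] r by simp
  have g10: "g1 0 = l1"
  proof -
    have "((\<lambda>h. (g (0 + h) - g 0) / h) \<longlongrightarrow> g1 0) (at 0)"
      using g[of 0] r by (simp add: DERIV_def)
    moreover have "((\<lambda>h. (g (0 + h) - g 0) / h) \<longlongrightarrow> l1) (at 0)"
    proof (rule LIM_zero_cancel, rule Lim_null_comparison)
      show "\<forall>\<^sub>F h in at 0. norm ((g (0 + h) - g 0) / h - l1) \<le> \<bar>h * l2\<bar> + M * \<bar>h\<bar>\<^sup>2"
        using ev eventually_neq_at_within[of 0 0 UNIV]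
      proof eventually_elim
        case (elim h)
        have "\<bar>h\<bar> * \<bar>(g h - 0) / h - l1\<bar> = \<bar>g h - h * l1\<bar>"
          using elim by (simp add: abs_mult[symmetric] field_simps)
        also have "\<dots> \<le> \<bar>h\<^sup>2 * l2\<bar> + M * \<bar>h\<bar> ^ 3"
          using M[of h] elim by linarith
        also have "\<dots> = \<bar>h\<bar> * (\<bar>h * l2\<bar> + M * \<bar>h\<bar>\<^sup>2)"
          by (simp add: abs_mult power2_eq_square power3_eq_cube algebra_simps)
        finally show ?case
          using elim g0 by simp
      qed
      show "((\<lambda>h. \<bar>h * l2\<bar> + M * \<bar>h\<bar>\<^sup>2) \<longlongrightarrow> 0) (at 0)"
        by (auto intro!: tendsto_eq_intros)
    qed
    ultimately show ?thesis
      by (rule LIM_unique)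
  qed
  have le: "\<bar>l2 - b / 2\<bar> \<le> 0 + e" if e: "0 < e" for e
  proof -
    have "((\<lambda>h. (g1 (0 + h) - g1 0) / h) \<longlongrightarrow> b) (at 0)"
      using g1 by (simp add: DERIV_def)
    then have "\<forall>\<^sub>F h in at 0. dist ((g1 (0 + h) - g1 0) / h) b < e / 2"
      using e by (intro tendstoD) auto
    then obtain d where d: "0 < d" "\<And>h. h \<noteq> 0 \<Longrightarrow> \<bar>h\<bar> < d \<Longrightarrow> \<bar>(g1 h - l1) / h - b\<bar> < e / 2"
      by (auto simp: eventually_at dist_real_def g10)
    \<comment> \<open>The first two entries keep the point where the expansion and the difference
      quotient estimate hold; the third makes the cubic remainder cost at most \<open>e / 2\<close>
      after division by \<open>\<epsilon>\<^sup>2\<close>.\<close>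
    define \<epsilon> where "\<epsilon> = min (min (r / 2) (d / 2)) (e / (2 * (\<bar>M\<bar> + 1)))"
    have \<epsilon>: "0 < \<epsilon>" "\<epsilon> < r" "\<epsilon> < d" "\<epsilon> \<le> e / (2 * (\<bar>M\<bar> + 1))"
      using r d e by (auto simp: \<epsilon>_def)
    define h where "h = (\<lambda>x. g x - x * l1 - x\<^sup>2 * (b / 2))"
    \<comment> \<open>At the intermediate point the derivative of \<open>h\<close> is
      \<open>z\<close> times the error of the difference quotient of \<open>g1\<close>, so
      \<open>h \<epsilon>\<close> is at most \<open>\<epsilon>\<^sup>2 * (e / 2)\<close>.\<close>
    have "\<exists>z>0. z < \<epsilon> \<and> h \<epsilon> - h 0 = (\<epsilon> - 0) * (g1 z - l1 - z * b)"
    proof (rule MVT2[OF \<epsilon>(1)])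
      fix x assume "0 \<le> x" "x \<le> \<epsilon>"
      then have "\<bar>x\<bar> < r" using \<epsilon> by simp
      from g[OF this] show "(h has_real_derivative g1 x - l1 - x * b) (at x)"
        unfolding h_def by (auto intro!: derivative_eq_intros)
    qed
    then obtain z where z: "0 < z" "z < \<epsilon>" and hz: "h \<epsilon> = \<epsilon> * (g1 z - l1 - z * b)"
      by (auto simp: h_def g0)
    have "\<bar>g1 z - l1 - z * b\<bar> = z * \<bar>(g1 z - l1) / z - b\<bar>"
      using z by (simp add: abs_mult[symmetric] field_simps)
    also have "\<dots> \<le> \<epsilon> * (e / 2)"
      using d(2)[of z] z \<epsilon> by (intro mult_mono) auto
    finally have h1: "\<bar>h \<epsilon>\<bar> \<le> \<epsilon> * (\<epsilon> * (e / 2))"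
      unfolding hz abs_mult using \<epsilon> by (intro mult_mono) auto
    have "M * \<epsilon> \<le> \<bar>M\<bar> * \<epsilon>" using \<epsilon> by (intro mult_right_mono) auto
    also have "\<dots> \<le> (\<bar>M\<bar> + 1) * (e / (2 * (\<bar>M\<bar> + 1)))"
      using \<epsilon> by (intro mult_mono) auto
    also have "\<dots> = e / 2" by (simp add: field_simps add_pos_nonneg)
    finally have M2: "M * \<epsilon> \<le> e / 2" .
    have "h \<epsilon> - (g \<epsilon> - \<epsilon> * l1 - \<epsilon>\<^sup>2 * l2) = \<epsilon>\<^sup>2 * (l2 - b / 2)"
      by (simp add: h_def algebra_simps)
    then have "\<epsilon>\<^sup>2 * \<bar>l2 - b / 2\<bar> = \<bar>h \<epsilon> - (g \<epsilon> - \<epsilon> * l1 - \<epsilon>\<^sup>2 * l2)\<bar>"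
      by (simp add: abs_mult)
    also have "\<dots> \<le> \<epsilon> * (\<epsilon> * (e / 2)) + M * \<epsilon> ^ 3"
      using h1 M[of \<epsilon>] \<epsilon> by simp
    also have "\<dots> = \<epsilon>\<^sup>2 * (e / 2 + M * \<epsilon>)"
      by (simp add: power2_eq_square power3_eq_cube algebra_simps)
    also have "\<dots> \<le> \<epsilon>\<^sup>2 * e"
      using M2 by (intro mult_left_mono) auto
    finally show ?thesis using \<epsilon> by simp
  qed
  have "\<bar>l2 - b / 2\<bar> \<le> 0"
    by (rule field_le_epsilon[OF le])
  then show ?thesis by simp
qed

lemma difference_quotient_less:
  fixes h a b e :: real
  assumes "h \<noteq> 0" "\<bar>a - h * b\<bar> < e * \<bar>h\<bar>"
  shows "\<bar>a / h - b\<bar> < e"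
proof -
  have "a / h - b = (a - h * b) / h"
    using assms(1) by (simp add: diff_divide_distrib)
  then show ?thesis
    using assms by (simp add: divide_less_eq)
qed

text \<open>Applying \<open>lfun\<close> along the ray through \<open>\<phi>\<close> gives a real
  function whose second-order coefficient is half of \<open>lfun\<close> at the second derivative in
  direction \<open>(\<phi>, \<phi>)\<close>. The order of quantifiers matters: \<open>K\<close>
  depends on the second derivative at zero and on \<open>s\<close>, but not on
  \<open>\<phi>\<close>, \<open>M\<close> or \<open>\<epsilon>0\<close>.\<close>

lemma C2_at_second_order_bound:
  assumes C2: "C2_at X (Hs_norm s) F 0" and X: "X \<subseteq> Hs s" "\<And>u c. u \<in> X \<Longrightarrow> c *\<^sub>R u \<in> X" and s: "s \<le> 0"
  obtains K where "\<And>\<phi> l1 l2 M \<epsilon>0. \<lbrakk>\<phi> \<in> X; 0 < \<epsilon>0;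
      \<And>\<epsilon>. \<bar>\<epsilon>\<bar> < \<epsilon>0 \<Longrightarrow> \<bar>lfun t (fhat (F (\<epsilon> *\<^sub>R \<phi>))) - \<epsilon> * l1 - \<epsilon>\<^sup>2 * l2\<bar> \<le> M * \<bar>\<epsilon>\<bar> ^ 3\<rbrakk>
    \<Longrightarrow> \<bar>l2\<bar> \<le> K * (Hs_norm s \<phi>)\<^sup>2"
proof -
  let ?n = "Hs_norm s" and ?l = "\<lambda>u. lfun t (fhat u)"
  define C where "C = (5/4::real) powr (-s) + 1"
  have C: "0 < C" by (auto simp: C_def intro: add_pos_nonneg add_nonneg_pos)
  have lb: "\<bar>?l u\<bar> \<le> C * ?n u" if "u \<in> Hs s" for u
    unfolding C_def by (rule lfun_Hs_bound[OF that s])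
  obtain r DF D2F where r: "0 < r"
    and D: "\<And>x. x \<in> X \<Longrightarrow> ?n x < r \<Longrightarrow> F x \<in> X \<and> frechet_on X ?n F (DF x) x \<and> frechet2_on X ?n DF (D2F x) x"
    using C2 unfolding C2_at_def by (metis diff_zero)
  show thesis
  proof (cases "X = {}")
    case True
    then show thesis using that by blast
  next
    case False
    then obtain x0 where "x0 \<in> X" by blast
    then have X0: "0 \<in> X" using X(2)[of x0 0] by simp
    obtain g0 where "has_fourier 0 g0" using X0 X(1) by (auto simp: Hs_def)
    then have n0: "?n 0 = 0" using Hs_norm_scaleR[of 0 g0 s 0] by simp
    have D0: "frechet2_on X ?n DF (D2F 0) 0" using D[OF X0] n0 r by simp
    then have bil: "bounded_bilinear_on X ?n (D2F 0)" by (simp add: frechet2_on_def)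
    then obtain K where K: "\<And>x y. x \<in> X \<Longrightarrow> y \<in> X \<Longrightarrow> ?n (D2F 0 x y) \<le> K * ?n x * ?n y"
      unfolding bounded_bilinear_on_def by blast
    have "\<bar>l2\<bar> \<le> (C * K / 2) * (?n \<phi>)\<^sup>2"
      if \<phi>: "\<phi> \<in> X" and \<epsilon>0: "0 < \<epsilon>0"
        and M: "\<And>\<epsilon>. \<bar>\<epsilon>\<bar> < \<epsilon>0 \<Longrightarrow> \<bar>?l (F (\<epsilon> *\<^sub>R \<phi>)) - \<epsilon> * l1 - \<epsilon>\<^sup>2 * l2\<bar> \<le> M * \<bar>\<epsilon>\<bar> ^ 3"
      for \<phi> l1 l2 M \<epsilon>0
    proof -
      obtain g where "has_fourier \<phi> g" using \<phi> X(1) by (auto simp: Hs_def)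
      note nsc = Hs_norm_scaleR[OF this]
      have nn: "0 \<le> ?n \<phi>" by (rule Hs_norm_nonneg)
      \<comment> \<open>A positive upper bound for the norm, so that radii can be divided by it even
        when the norm of \<open>\<phi>\<close> is 0.\<close>
      define p where "p = ?n \<phi> + 1"
      have p: "0 < p" "?n \<phi> \<le> p" using nn by (auto simp: p_def)
      have small: "?n (\<epsilon> *\<^sub>R \<phi>) < d" if "\<bar>\<epsilon>\<bar> < d / p" for \<epsilon> d
      proof -
        have "?n (\<epsilon> *\<^sub>R \<phi>) \<le> \<bar>\<epsilon>\<bar> * p" unfolding nsc using p by (intro mult_left_mono) auto
        also have "\<dots> < d" using that p by (simp add: field_simps)
        finally show ?thesis .
      qed
      define b where "b = ?l (D2F 0 \<phi> \<phi>)"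
      let ?g = "\<lambda>\<epsilon>. ?l (F (\<epsilon> *\<^sub>R \<phi>))" and ?g1 = "\<lambda>\<epsilon>. ?l (DF (\<epsilon> *\<^sub>R \<phi>) \<phi>)"
      have deriv: "(?g has_real_derivative ?g1 \<epsilon>) (at \<epsilon>)" if \<epsilon>: "\<bar>\<epsilon>\<bar> < r / p" for \<epsilon>
      proof -
        let ?x = "\<epsilon> *\<^sub>R \<phi>"
        have x: "?x \<in> X" "?n ?x < r" using X(2)[OF \<phi>] small[OF \<epsilon>] by auto
        have fr: "frechet_on X ?n F (DF ?x) ?x" using D[OF x] by simp
        then have bl: "bounded_linear_on X ?n (DF ?x)" by (simp add: frechet_on_def)
        show ?thesis
          unfolding DERIV_def LIM_eq
        proof (intro allI impI)
          fix e :: real assume e: "0 < e"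
          \<comment> \<open>The denominators undo the bound \<open>C\<close> of the functional and
            the size \<open>p\<close> of the direction; the 2 leaves \<open>e / 2\<close>, which
            gives the strict inequality.\<close>
          then have "0 < e / (2 * C * p)" using C p by simp
          with fr obtain d where d: "0 < d"
            "\<And>h. h \<in> X \<Longrightarrow> ?n h < d \<Longrightarrow> ?n (F (?x + h) - F ?x - DF ?x h) \<le> e / (2 * C * p) * ?n h"
            unfolding frechet_on_def by blast
          show "\<exists>d'>0. \<forall>h. h \<noteq> 0 \<and> norm (h - 0) < d' \<longrightarrow> norm ((?g (\<epsilon> + h) - ?g \<epsilon>) / h - ?g1 \<epsilon>) < e"
          proof (intro exI conjI allI impI)
            show "0 < min (d / p) (r / p - \<bar>\<epsilon>\<bar>)" using d p \<epsilon> by simp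
            fix h :: real assume "h \<noteq> 0 \<and> norm (h - 0) < min (d / p) (r / p - \<bar>\<epsilon>\<bar>)"
            then have h: "h \<noteq> 0" "\<bar>h\<bar> < d / p" "\<bar>\<epsilon> + h\<bar> < r / p" by auto
            have hX: "h *\<^sub>R \<phi> \<in> X" "(\<epsilon> + h) *\<^sub>R \<phi> \<in> X" using X(2)[OF \<phi>] by auto
            have FX: "F ?x \<in> X" "F ((\<epsilon> + h) *\<^sub>R \<phi>) \<in> X"
              using D[OF x] D[OF hX(2) small[OF h(3)]] by auto
            have AX: "DF ?x (h *\<^sub>R \<phi>) = h *\<^sub>R DF ?x \<phi>" "DF ?x \<phi> \<in> X" "h *\<^sub>R DF ?x \<phi> \<in> X"
              using bl \<phi> X(2) unfolding bounded_linear_on_def by auto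
            have in_Hs: "F ((\<epsilon> + h) *\<^sub>R \<phi>) \<in> Hs s" "F ?x \<in> Hs s" "DF ?x \<phi> \<in> Hs s" "h *\<^sub>R DF ?x \<phi> \<in> Hs s"
              using FX AX X(1) by auto
            let ?R = "F ((\<epsilon> + h) *\<^sub>R \<phi>) - F ?x - h *\<^sub>R DF ?x \<phi>"
            have "?l ?R = ?g (\<epsilon> + h) - ?g \<epsilon> - h * ?g1 \<epsilon>"
              by (simp add: lfun_fhat_diff[OF Hs_diff[OF in_Hs(1,2)] in_Hs(4) s] lfun_fhat_diff[OF in_Hs(1,2) s]
                  lfun_fhat_scaleR[OF in_Hs(3)])
            moreover have "\<bar>?l ?R\<bar> \<le> C * ?n ?R"
              by (intro lb Hs_diff in_Hs)
            moreover have "?n ?R \<le> e / (2 * C * p) * (\<bar>h\<bar> * ?n \<phi>)"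
              using d(2)[OF hX(1) small[OF h(2)]] unfolding nsc AX(1) by (simp add: scaleR_add_left)
            moreover have "e / (2 * C * p) * (\<bar>h\<bar> * ?n \<phi>) \<le> e / (2 * C * p) * (\<bar>h\<bar> * p)"
              using e C p by (intro mult_left_mono) auto
            ultimately have "\<bar>?g (\<epsilon> + h) - ?g \<epsilon> - h * ?g1 \<epsilon>\<bar> \<le> C * (e / (2 * C * p) * (\<bar>h\<bar> * p))"
              using C by (smt (verit) mult_left_mono)
            also have "\<dots> = e / 2 * \<bar>h\<bar>" using C p by simp
            also have "\<dots> < e * \<bar>h\<bar>" using e h by simp
            finally show "norm ((?g (\<epsilon> + h) - ?g \<epsilon>) / h - ?g1 \<epsilon>) < e"
              unfolding real_norm_def by (rule difference_quotient_less[OF h(1)])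
          qed
        qed
      qed
      have deriv2: "(?g1 has_real_derivative b) (at 0)"
        unfolding DERIV_def LIM_eq
      proof (intro allI impI)
        fix e :: real assume e: "0 < e"
        \<comment> \<open>Here \<open>p\<close> enters squared, since the remainder of the second
          derivative is measured against both the increment and the direction.\<close>
        then have "0 < e / (2 * C * p\<^sup>2)" using C p by simp
        with D0 obtain d where d: "0 < d"
          "\<And>h k. h \<in> X \<Longrightarrow> ?n h < d \<Longrightarrow> k \<in> X \<Longrightarrow> ?n (DF (0 + h) k - DF 0 k - D2F 0 h k) \<le> e / (2 * C * p\<^sup>2) * ?n h * ?n k"
          unfolding frechet2_on_def by metis
        show "\<exists>d'>0. \<forall>h. h \<noteq> 0 \<and> norm (h - 0) < d' \<longrightarrow> norm ((?g1 (0 + h) - ?g1 0) / h - b) < e"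
        proof (intro exI conjI allI impI)
          show "0 < min (d / p) (r / p)" using d p r by simp
          fix h :: real assume "h \<noteq> 0 \<and> norm (h - 0) < min (d / p) (r / p)"
          then have h: "h \<noteq> 0" "\<bar>h\<bar> < d / p" "\<bar>h\<bar> < r / p" by auto
          have hX: "h *\<^sub>R \<phi> \<in> X" using X(2)[OF \<phi>] by auto
          have "bounded_linear_on X ?n (DF (h *\<^sub>R \<phi>))" "bounded_linear_on X ?n (DF 0)"
            using D[OF hX small[OF h(3)]] D[OF X0] n0 r by (auto simp: frechet_on_def)
          then have DX: "DF (h *\<^sub>R \<phi>) \<phi> \<in> X" "DF 0 \<phi> \<in> X"
            using \<phi> unfolding bounded_linear_on_def by auto
          have BX: "D2F 0 (h *\<^sub>R \<phi>) \<phi> = h *\<^sub>R D2F 0 \<phi> \<phi>" "D2F 0 \<phi> \<phi> \<in> X" "h *\<^sub>R D2F 0 \<phi> \<phi> \<in> X"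
            using bil \<phi> X(2) unfolding bounded_bilinear_on_def by auto
          have in_Hs: "DF (h *\<^sub>R \<phi>) \<phi> \<in> Hs s" "DF 0 \<phi> \<in> Hs s" "D2F 0 \<phi> \<phi> \<in> Hs s" "h *\<^sub>R D2F 0 \<phi> \<phi> \<in> Hs s"
            using DX BX X(1) by auto
          let ?R = "DF (h *\<^sub>R \<phi>) \<phi> - DF 0 \<phi> - h *\<^sub>R D2F 0 \<phi> \<phi>"
          have "?l ?R = ?g1 h - ?g1 0 - h * b"
            by (simp add: b_def lfun_fhat_diff[OF Hs_diff[OF in_Hs(1,2)] in_Hs(4) s] lfun_fhat_diff[OF in_Hs(1,2) s]
                lfun_fhat_scaleR[OF in_Hs(3)])
          moreover have "\<bar>?l ?R\<bar> \<le> C * ?n ?R"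
            by (intro lb Hs_diff in_Hs)
          moreover have "?n ?R \<le> e / (2 * C * p\<^sup>2) * (\<bar>h\<bar> * (?n \<phi> * ?n \<phi>))"
            using d(2)[OF hX small[OF h(2)] \<phi>] unfolding nsc BX(1) by (simp add: mult.assoc)
          moreover have "e / (2 * C * p\<^sup>2) * (\<bar>h\<bar> * (?n \<phi> * ?n \<phi>)) \<le> e / (2 * C * p\<^sup>2) * (\<bar>h\<bar> * (p * p))"
            using e C p nn by (intro mult_left_mono mult_mono) auto
          ultimately have "\<bar>?g1 h - ?g1 0 - h * b\<bar> \<le> C * (e / (2 * C * p\<^sup>2) * (\<bar>h\<bar> * (p * p)))"
            using C by (smt (verit) mult_left_mono)
          also have "\<dots> = e / 2 * \<bar>h\<bar>" using C p by (simp add: power2_eq_square)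
          also have "\<dots> < e * \<bar>h\<bar>" using e h by simp
          finally show "norm ((?g1 (0 + h) - ?g1 0) / h - b) < e"
            unfolding real_norm_def add_0 by (rule difference_quotient_less[OF h(1)])
        qed
      qed
      have "l2 = b / 2"
      proof (rule second_order_coefficient[where g = ?g and ?g1.0 = ?g1 and r = "min (r / p) \<epsilon>0"])
        show "0 < min (r / p) \<epsilon>0" using r p \<epsilon>0 by simp
      qed (use deriv deriv2 M in auto)
      moreover have "\<bar>b\<bar> \<le> C * (K * ?n \<phi> * ?n \<phi>)"
      proof -
        have "D2F 0 \<phi> \<phi> \<in> Hs s" using bil \<phi> X(1) unfolding bounded_bilinear_on_def by auto
        from lb[OF this] have "\<bar>b\<bar> \<le> C * ?n (D2F 0 \<phi> \<phi>)"
          by (simp only: b_def)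
        also have "\<dots> \<le> C * (K * ?n \<phi> * ?n \<phi>)"
          using C by (intro mult_left_mono K \<phi>) simp
        finally show ?thesis .
      qed
      ultimately show ?thesis by (simp add: power2_eq_square)
    qed
    then show thesis using that by blast
  qed
qed


section \<open>Expansion of the flow and the high-to-low frequency interaction\<close>

text \<open>The linear flow \<open>W\<close> of the small datum is of order
  \<open>\<epsilon>\<close>, the solution differs from it by order
  \<open>\<epsilon>\<^sup>2\<close>, and \<open>duh\<close> is quadratic, so replacing
  \<open>U\<close> by \<open>W\<close> inside \<open>duh\<close> costs order
  \<open>\<epsilon>\<^sup>3\<close>. The quadratic coefficient carries the minus sign of the Duhamel
  formula.\<close>

lemma flow_expansion:
  assumes f: "f \<in> borel_measurable borel" "\<And>\<xi>. cmod (f \<xi>) \<le> A * wt \<xi>"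
    and U: "wbounded T (2 * (\<bar>\<epsilon>\<bar> * A)) U"
    and eq: "\<And>t \<xi>. \<bar>t\<bar> \<le> T \<Longrightarrow> U t \<xi> = cis (- (sg \<xi> * t)) * (\<epsilon> *\<^sub>R f \<xi>) - duh U t \<xi>"
    and t: "\<bar>t\<bar> \<le> T"
  shows "\<bar>lfun t (U t) - \<epsilon> * lfun t (\<lambda>\<xi>. cis (- (sg \<xi> * t)) * f \<xi>)
      - \<epsilon>\<^sup>2 * - lfun t (duh (\<lambda>\<tau> \<xi>. cis (- (sg \<xi> * \<tau>)) * f \<xi>) t)\<bar> \<le> 12 * T\<^sup>2 * A ^ 3 * pi * \<bar>\<epsilon>\<bar> ^ 3"
proof -
  define V where "V = (\<lambda>\<tau> \<xi>. cis (- (sg \<xi> * \<tau>)) * f \<xi>)"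
  define W where "W = (\<lambda>\<tau> \<xi>. \<epsilon> *\<^sub>R V \<tau> \<xi>)"
  note [measurable] = f(1)
  have V: "wbounded T A V"
    unfolding wbounded_def V_def split_beta' using f(2) by (auto simp: norm_mult)
  have W: "wbounded T (\<bar>\<epsilon>\<bar> * A) W"
    using wboundedD(1)[OF V] wboundedD(3)[OF V] unfolding wbounded_def W_def split_beta'
    by (auto simp: mult.assoc intro!: mult_left_mono)
  have eqW: "U t \<xi> = W t \<xi> - duh U t \<xi>" if "\<bar>t\<bar> \<le> T" for t \<xi>
    unfolding eq[OF that, of \<xi>] by (simp add: W_def V_def)
  have d: "cmod (U t \<xi> - W t \<xi>) \<le> (T * (2 * (\<bar>\<epsilon>\<bar> * A))\<^sup>2) * wt \<xi>" if "\<bar>t\<bar> \<le> T" for t \<xi>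
  proof -
    have "U t \<xi> - W t \<xi> = - duh U t \<xi>"
      using eqW[OF that, of \<xi>] by (metis add_diff_cancel_left' diff_add_cancel minus_diff_eq)
    then show ?thesis
      using duh_bound[OF U that, of \<xi>] by simp
  qed
  \<comment> \<open>The 12 is \<open>3 * 4\<close>: the radii
    \<open>2 * \<bar>\<epsilon>\<bar> * A\<close> and \<open>\<bar>\<epsilon>\<bar> * A\<close> add
    up to three units, and the distance of \<open>U\<close> from \<open>W\<close> contains
    \<open>(2 * \<bar>\<epsilon>\<bar> * A)\<^sup>2\<close>.\<close>
  have dd: "cmod (duh U t \<xi> - duh W t \<xi>) \<le> (12 * T\<^sup>2 * A ^ 3 * \<bar>\<epsilon>\<bar> ^ 3) * wt \<xi>" for \<xi>
    using duh_diff[OF U W d t, of \<xi>] by (simp add: power2_eq_square power3_eq_cube mult_ac)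
  have duhW: "duh W t \<xi> = (\<epsilon>\<^sup>2) *\<^sub>R duh V t \<xi>" for \<xi>
  proof -
    have "conv (W \<tau>) (W \<tau>) \<xi> = (\<epsilon>\<^sup>2) *\<^sub>R conv (V \<tau>) (V \<tau>) \<xi>" for \<tau>
      by (simp add: conv_def W_def power2_eq_square)
    then have "duhi W t \<xi> \<tau> = (\<epsilon>\<^sup>2) *\<^sub>R duhi V t \<xi> \<tau>" for \<tau>
      by (simp add: duhi_def)
    then have "duh W t \<xi> = (LINT \<tau>|lborel. (\<epsilon>\<^sup>2) *\<^sub>R (itv t \<tau> *\<^sub>R duhi V t \<xi> \<tau>))"
      unfolding duh_def by (simp add: mult.commute)
    then show ?thesis
      unfolding duh_def by (simp del: scaleR_scaleR)
  qed
  have meas: "duh Z t \<in> borel_measurable borel" if "wbounded T b Z" for b Z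
    by (rule duh_measurable[OF wboundedD(1)[OF that], where f = "\<lambda>_. t" and g = "\<lambda>x. x"]) simp_all
  have win: "integrable lborel (\<lambda>\<xi>. indicator {1/4..1/2} \<xi> *\<^sub>R duh Z t \<xi> :: complex)" if "wbounded T b Z" for b Z
    by (rule wt_window_integrable[OF meas[OF that] duh_bound[OF that t]])
  have "U t = (\<lambda>\<xi>. \<epsilon> *\<^sub>R V t \<xi> - duh U t \<xi>)"
    using eqW[OF t] by (auto simp: W_def)
  then have "lfun t (U t) = lfun t (\<lambda>\<xi>. \<epsilon> *\<^sub>R V t \<xi> - duh U t \<xi>)"
    by (rule arg_cong)
  also have "\<dots> = lfun t (W t) - lfun t (duh U t)"
    using lfun_diff[OF wt_window_integrable[OF wboundedD(2)[OF W] wboundedD(3)[OF W t]] win[OF U]]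
    by (simp add: W_def)
  also have "lfun t (W t) = \<epsilon> * lfun t (V t)"
    unfolding W_def by (rule lfun_scaleR)
  finally have 1: "lfun t (U t) = \<epsilon> * lfun t (V t) - lfun t (duh U t)" .
  have "lfun t (duh W t) = \<epsilon>\<^sup>2 * lfun t (duh V t)"
    using lfun_scaleR[of t "\<epsilon>\<^sup>2" "duh V t"] by (simp add: duhW[abs_def, symmetric])
  then have "\<epsilon>\<^sup>2 * lfun t (duh V t) - lfun t (duh U t) = - lfun t (\<lambda>\<xi>. duh U t \<xi> - duh W t \<xi>)"
    unfolding lfun_diff[OF win[OF U] win[OF W]] by simp
  then have "\<bar>\<epsilon>\<^sup>2 * lfun t (duh V t) - lfun t (duh U t)\<bar> \<le> 12 * T\<^sup>2 * A ^ 3 * \<bar>\<epsilon>\<bar> ^ 3 * pi"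
    using lfun_wt_bound[OF dd] by simp
  then show ?thesis
    unfolding V_def[symmetric] 1 using V_def by (simp add: mult_ac)
qed

section \<open>Near-resonance of opposite high frequencies, and wave packets\<close>

lemma cos_ge_half: "\<bar>x\<bar> \<le> 1 \<Longrightarrow> 1 / 2 \<le> cos (x :: real)"
proof -
  assume x: "\<bar>x\<bar> \<le> 1"
  have "\<bar>sin (x / 2)\<bar> \<le> 1 / 2"
    using abs_sin_x_le_abs_x[of "x / 2"] x by simp
  then have "(sin (x / 2))\<^sup>2 \<le> (1 / 2)\<^sup>2"
    by (metis abs_ge_zero power2_abs power_mono)
  then show ?thesis
    using cos_double_sin[of "x / 2"] by (simp add: power2_eq_square)
qed

text \<open>At high frequency \<open>sg\<close> is close to \<open>sgn\<close>, so that the phases of opposite high frequencies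
  nearly cancel.\<close>

lemma resonance_bound_aux:
  assumes "1/4 \<le> \<xi>" "\<xi> \<le> 1/2" "1 \<le> \<eta>" "1 \<le> \<eta> - \<xi>"
  shows "\<bar>sg \<xi> - sg (\<xi> - \<eta>) - sg \<eta>\<bar> \<le> 1"
proof -
  have 1: "0 \<le> sg \<xi>" "sg \<xi> \<le> 1 / 2"
    using assms by (auto simp: sg_def divide_le_eq)
  have "sg (\<xi> - \<eta>) + sg \<eta> = 1 / (1 + (\<eta> - \<xi>)) - 1 / (1 + \<eta>)"
    using assms by (simp add: sg_def field_simps)
  moreover have "1 / (1 + (\<eta> - \<xi>)) \<le> 1 / 2" "0 \<le> 1 / (1 + (\<eta> - \<xi>))" "1 / (1 + \<eta>) \<le> 1 / 2" "0 \<le> 1 / (1 + \<eta>)"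
    using assms by (auto simp: field_simps)
  ultimately show ?thesis using 1 by linarith
qed

text \<open>The phase is symmetric under exchanging \<open>\<eta>\<close> and
  \<open>\<xi> - \<eta>\<close>. As \<open>\<xi>\<close> is small, the two frequencies have opposite
  signs, and the exchange makes \<open>\<eta>\<close> the positive one.\<close>

lemma resonance_bound:
  assumes \<xi>: "1/4 \<le> \<xi>" "\<xi> \<le> 1/2" and "1 \<le> \<bar>\<eta>\<bar>" "1 \<le> \<bar>\<xi> - \<eta>\<bar>"
  shows "\<bar>sg \<xi> - sg (\<xi> - \<eta>) - sg \<eta>\<bar> \<le> 1"
proof (cases "0 \<le> \<eta>")
  case True
  then show ?thesis using resonance_bound_aux[of \<xi> \<eta>] assms by linarith
next
  case False
  then show ?thesis using resonance_bound_aux[of \<xi> "\<xi> - \<eta>"] assms by simp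
qed

text \<open>Even in \<open>\<xi>\<close>, so that the datum is real and both signs of the frequency
  are present; opposite frequencies are what produces low-frequency output.\<close>

definition packet :: "real \<Rightarrow> real \<Rightarrow> real \<Rightarrow> real" where
  "packet a N \<xi> = a * indicator {N..N+1} \<bar>\<xi>\<bar>"

lemma packet_measurable [measurable]: "packet a N \<in> borel_measurable borel"
  unfolding packet_def by measurable

lemma packet_wt_bound:
  assumes "0 \<le> a" "0 \<le> N"
  shows "cmod (of_real (packet a N \<xi>)) \<le> a * (1 + (N + 1)\<^sup>2) * wt \<xi>"
proof (cases "\<bar>\<xi>\<bar> \<in> {N..N+1}")
  case True
  then have "\<bar>\<xi>\<bar>\<^sup>2 \<le> (N + 1)\<^sup>2" by (intro power_mono) auto
  then have "a * (1 + \<xi>\<^sup>2) \<le> a * (1 + (N + 1)\<^sup>2)"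
    using assms(1) by (intro mult_left_mono) auto
  then show ?thesis
    unfolding le_wt_iff using True assms by (simp add: packet_def)
next
  case False
  then show ?thesis using assms wt_nonneg[of \<xi>] by (simp add: packet_def del: atLeastAtMost_iff)
qed

lemma Re_cis_mult_of_real: "Re (cis x * of_real r) = cos x * r"
  by simp

lemma Re_of_real_mult: "Re (of_real r * z) = r * Re z"
  by simp

text \<open>On the whole product of supports the phase has modulus at most 1 for times up to 1, so
  its cosine is at least \<open>1 / 2\<close> and no pair of frequencies contributes negatively. It
  suffices to keep one convenient set of pairs.\<close>

lemma packet_interaction:
  assumes a: "0 \<le> a" and N: "1 \<le> N" and \<xi>: "1/4 \<le> \<xi>" "\<xi> \<le> 1/2" and \<tau>: "0 \<le> \<tau>" "\<tau> \<le> 1"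
  shows "a\<^sup>2 / 4 \<le> Re (cis (sg \<xi> * \<tau>) * conv (\<lambda>\<xi>. cis (- (sg \<xi> * \<tau>)) * of_real (packet a N \<xi>))
    (\<lambda>\<xi>. cis (- (sg \<xi> * \<tau>)) * of_real (packet a N \<xi>)) \<xi>)"
proof -
  let ?p = "packet a N" and ?v = "\<lambda>\<xi>. cis (- (sg \<xi> * \<tau>)) * complex_of_real (packet a N \<xi>)"
  have vb: "cmod (?v \<xi>) \<le> a * (1 + (N + 1)\<^sup>2) * wt \<xi>" for \<xi>
    using packet_wt_bound[of a N \<xi>] a N by (simp add: norm_mult)
  have vm: "?v \<in> borel_measurable borel" by measurable
  have vi: "integrable lborel (\<lambda>\<eta>. ?v (\<xi> - \<eta>) * ?v \<eta>)"
    by (rule wt_bounded_mult_integrable[OF vm vb integrable_wt_bound[OF vm vb]])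
  have ci: "integrable lborel (\<lambda>\<eta>. cis (sg \<xi> * \<tau>) * (?v (\<xi> - \<eta>) * ?v \<eta>))"
    using vi by (rule integrable_mult_right)
  have eq: "Re (cis (sg \<xi> * \<tau>) * (?v (\<xi> - \<eta>) * ?v \<eta>))
      = cos ((sg \<xi> - sg (\<xi> - \<eta>) - sg \<eta>) * \<tau>) * (?p (\<xi> - \<eta>) * ?p \<eta>)" for \<eta>
  proof -
    have "cis (sg \<xi> * \<tau>) * (?v (\<xi> - \<eta>) * ?v \<eta>) = cis ((sg \<xi> - sg (\<xi> - \<eta>) - sg \<eta>) * \<tau>) * of_real (?p (\<xi> - \<eta>) * ?p \<eta>)"
    proof -
      have "cis ((sg \<xi> - sg (\<xi> - \<eta>) - sg \<eta>) * \<tau>) = cis (sg \<xi> * \<tau>) * cis (- (sg (\<xi> - \<eta>) * \<tau>)) * cis (- (sg \<eta> * \<tau>))"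
        unfolding cis_mult by (simp add: algebra_simps)
      then show ?thesis by (simp only: of_real_mult mult_ac)
    qed
    then show ?thesis
      unfolding Re_cis_mult_of_real[symmetric] by (rule arg_cong)
  qed
  \<comment> \<open>For every \<open>\<xi>\<close> in the window and every \<open>\<eta>\<close> in
    this interval of length \<open>1 / 2\<close>, \<open>\<eta> - \<xi>\<close> lies between
    \<open>N\<close> and \<open>N + 3/4\<close>, so both factors equal \<open>a\<close>. The density
    \<open>a\<^sup>2 / 2\<close> contains the lower bound of the cosine.\<close>
  have "a\<^sup>2 / 4 = (LINT \<eta>|lborel. a\<^sup>2 / 2 * indicator {N+1/2..N+1} \<eta>)"
    by simp
  also have "\<dots> \<le> (LINT \<eta>|lborel. Re (cis (sg \<xi> * \<tau>) * (?v (\<xi> - \<eta>) * ?v \<eta>)))"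
  proof (rule integral_mono)
    show "integrable lborel (\<lambda>\<eta>. a\<^sup>2 / 2 * indicator {N+1/2..N+1} \<eta>)"
      by (intro integrable_mult_right integrable_real_indicator emeasure_bounded_finite) auto
    show "integrable lborel (\<lambda>\<eta>. Re (cis (sg \<xi> * \<tau>) * (?v (\<xi> - \<eta>) * ?v \<eta>)))"
      using ci by (rule integrable_Re)
    fix \<eta>
    have nn: "0 \<le> ?p (\<xi> - \<eta>) * ?p \<eta>" using a by (simp add: packet_def)
    show "a\<^sup>2 / 2 * indicator {N+1/2..N+1} \<eta> \<le> Re (cis (sg \<xi> * \<tau>) * (?v (\<xi> - \<eta>) * ?v \<eta>))"
    proof (cases "?p (\<xi> - \<eta>) * ?p \<eta> = 0")
      case True
      have "a = 0 \<or> \<eta> \<notin> {N+1/2..N+1}"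
        using True \<xi> N by (auto simp: packet_def indicator_def split: if_splits)
      then show ?thesis unfolding eq True by auto
    next
      case False
      then have "\<bar>\<xi> - \<eta>\<bar> \<in> {N..N+1}" "\<bar>\<eta>\<bar> \<in> {N..N+1}" and p: "?p (\<xi> - \<eta>) * ?p \<eta> = a\<^sup>2"
        by (auto simp: packet_def indicator_def power2_eq_square split: if_splits)
      then have "\<bar>sg \<xi> - sg (\<xi> - \<eta>) - sg \<eta>\<bar> \<le> 1"
        using N by (intro resonance_bound \<xi>) auto
      then have "\<bar>(sg \<xi> - sg (\<xi> - \<eta>) - sg \<eta>) * \<tau>\<bar> \<le> 1"
        using \<tau> unfolding abs_mult by (intro mult_le_one) auto
      from mult_right_mono[OF cos_ge_half[OF this] nn]
      have "a\<^sup>2 / 2 \<le> Re (cis (sg \<xi> * \<tau>) * (?v (\<xi> - \<eta>) * ?v \<eta>))"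
        unfolding eq p by simp
      moreover have "a\<^sup>2 / 2 * indicator {N+1/2..N+1} \<eta> \<le> a\<^sup>2 / 2 * 1"
        by (intro mult_left_mono) (auto simp: indicator_def)
      ultimately show ?thesis by linarith
    qed
  qed
  also have "\<dots> = Re (LINT \<eta>|lborel. cis (sg \<xi> * \<tau>) * (?v (\<xi> - \<eta>) * ?v \<eta>))"
    by (rule integral_Re[OF ci])
  also have "(LINT \<eta>|lborel. cis (sg \<xi> * \<tau>) * (?v (\<xi> - \<eta>) * ?v \<eta>)) = cis (sg \<xi> * \<tau>) * conv ?v ?v \<xi>"
    unfolding conv_def by (rule integral_mult_right_zero)
  finally show ?thesis .
qed

text \<open>The phase factor in \<open>lfun\<close> turns the group at time
  \<open>t - \<tau>\<close> into the factor \<open>cis (sg \<xi> * \<tau>)\<close> of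
  \<open>packet_interaction\<close>, so all times add up without cancellation. The constant 320 is
  80 divided by the window length \<open>1 / 4\<close>, and 80 is \<open>5 * 4 * 4\<close>: the
  lower bound of \<open>sg\<close>, the symbol's \<open>4 * pi\<close>, and the interaction
  bound.\<close>

lemma packet_quadratic_lower_bound:
  assumes a: "0 \<le> a" and N: "1 \<le> N" and t: "0 \<le> t" "t \<le> 1"
  shows "t * a\<^sup>2 / (320 * pi) \<le> lfun t (duh (\<lambda>\<tau> \<xi>. cis (- (sg \<xi> * \<tau>)) * of_real (packet a N \<xi>)) t)"
proof -
  define V where "V = (\<lambda>\<tau> \<xi>. cis (- (sg \<xi> * \<tau>)) * complex_of_real (packet a N \<xi>))"
  define A where "A = a * (1 + (N + 1)\<^sup>2)"
  have V: "wbounded 1 A V"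
    unfolding wbounded_def V_def split_beta' A_def using packet_wt_bound[of a N] a N
    by (auto simp: norm_mult)
  note [measurable] = wboundedD(1)[OF V]
  have t1: "\<bar>t\<bar> \<le> 1" using t by simp
  have dm: "duh V t \<in> borel_measurable borel"
    by (rule duh_measurable[OF wboundedD(1)[OF V], where f = "\<lambda>_. t" and g = "\<lambda>x. x"]) simp_all
  have low: "t * a\<^sup>2 / (80 * pi) \<le> Re (- \<i> * cis (sg \<xi> * t) * duh V t \<xi>)" if \<xi>: "1/4 \<le> \<xi>" "\<xi> \<le> 1/2" for \<xi>
  proof -
    have i: "integrable lborel (\<lambda>\<tau>. itv t \<tau> *\<^sub>R duhi V t \<xi> \<tau>)"
      by (rule itv_integrable[where B = "A\<^sup>2 * wt \<xi>"]) (use duhi_bound[OF V] t in auto)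
    then have ci: "integrable lborel (\<lambda>\<tau>. - \<i> * cis (sg \<xi> * t) * (itv t \<tau> *\<^sub>R duhi V t \<xi> \<tau>))"
      by (rule integrable_mult_right)
    \<comment> \<open>The window stays away from frequency 0 because the symbol of the nonlinearity
      vanishes there; \<open>1 / 5\<close> is the value of \<open>sg\<close> at
      \<open>1 / 4\<close>.\<close>
    have sg: "1 / 5 \<le> sg \<xi>" using \<xi> by (simp add: sg_def field_simps)
    have b: "a\<^sup>2 / (80 * pi) \<le> Re (- \<i> * cis (sg \<xi> * t) * duhi V t \<xi> \<tau>)" if \<tau>: "0 < \<tau>" "\<tau> < t" for \<tau>
    proof -
      have "- \<i> * cis (sg \<xi> * t) * duhi V t \<xi> \<tau> = of_real (sg \<xi> / (4 * pi)) * (cis (sg \<xi> * \<tau>) * conv (V \<tau>) (V \<tau>) \<xi>)"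
      proof -
        have "cis (sg \<xi> * t) * cis (- (sg \<xi> * (t - \<tau>))) = cis (sg \<xi> * \<tau>)"
          unfolding cis_mult by (simp add: algebra_simps)
        moreover have "- \<i> * x * (y * (\<i> * z / p * w)) = x * y * (z / p * w)" for x y z p w
        proof -
          have "- \<i> * x * (y * (\<i> * q * w)) = x * y * (q * w)" for q
            by (simp add: complex_eq_iff algebra_simps)
          from this[of "z / p"] show ?thesis by simp
        qed
        ultimately show ?thesis
          by (simp add: duhi_def)
      qed
      then have "Re (- \<i> * cis (sg \<xi> * t) * duhi V t \<xi> \<tau>) = sg \<xi> / (4 * pi) * Re (cis (sg \<xi> * \<tau>) * conv (V \<tau>) (V \<tau>) \<xi>)"
        by (simp only: Re_of_real_mult)
      moreover have "(1 / 5) / (4 * pi) * (a\<^sup>2 / 4) \<le> sg \<xi> / (4 * pi) * Re (cis (sg \<xi> * \<tau>) * conv (V \<tau>) (V \<tau>) \<xi>)"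
        using sg packet_interaction[OF a N \<xi>, of \<tau>, folded V_def] \<tau> t
        by (intro mult_mono divide_right_mono) (auto simp: V_def)
      ultimately show ?thesis by simp
    qed
    have "t * a\<^sup>2 / (80 * pi) = (LINT \<tau>|lborel. a\<^sup>2 / (80 * pi) * \<bar>itv t \<tau>\<bar>)"
      using t abs_itv_integral[of t] by simp
    also have "\<dots> \<le> (LINT \<tau>|lborel. Re (- \<i> * cis (sg \<xi> * t) * (itv t \<tau> *\<^sub>R duhi V t \<xi> \<tau>)))"
    proof (rule integral_mono)
      show "integrable lborel (\<lambda>\<tau>. a\<^sup>2 / (80 * pi) * \<bar>itv t \<tau>\<bar>)"
        using abs_itv_integrable by (rule integrable_mult_right)
      show "integrable lborel (\<lambda>\<tau>. Re (- \<i> * cis (sg \<xi> * t) * (itv t \<tau> *\<^sub>R duhi V t \<xi> \<tau>)))"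
        using ci by (rule integrable_Re)
      show "a\<^sup>2 / (80 * pi) * \<bar>itv t \<tau>\<bar> \<le> Re (- \<i> * cis (sg \<xi> * t) * (itv t \<tau> *\<^sub>R duhi V t \<xi> \<tau>))" for \<tau>
        using b[of \<tau>] t by (auto simp: itv_def)
    qed
    also have "\<dots> = Re (LINT \<tau>|lborel. - \<i> * cis (sg \<xi> * t) * (itv t \<tau> *\<^sub>R duhi V t \<xi> \<tau>))"
      by (rule integral_Re[OF ci])
    also have "(LINT \<tau>|lborel. - \<i> * cis (sg \<xi> * t) * (itv t \<tau> *\<^sub>R duhi V t \<xi> \<tau>)) = - \<i> * cis (sg \<xi> * t) * duh V t \<xi>"
      unfolding duh_def by (rule integral_mult_right_zero)
    finally show ?thesis .
  qed
  have "t * a\<^sup>2 / (320 * pi) = (LINT \<xi>|lborel. t * a\<^sup>2 / (80 * pi) * indicator {1/4..1/2::real} \<xi>)"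
    by simp
  also have "\<dots> \<le> lfun t (duh V t)"
    unfolding lfun_def
  proof (rule integral_mono)
    show "integrable lborel (\<lambda>\<xi>. t * a\<^sup>2 / (80 * pi) * indicator {1/4..1/2::real} \<xi>)"
      by (intro integrable_mult_right integrable_real_indicator) auto
    show "integrable lborel (\<lambda>\<xi>. Re (- \<i> * cis (sg \<xi> * t) * (indicator {1/4..1/2} \<xi> *\<^sub>R duh V t \<xi>)))"
      by (rule lfun_integrable[OF wt_window_integrable[OF dm duh_bound[OF V t1]]])
    show "t * a\<^sup>2 / (80 * pi) * indicator {1/4..1/2::real} \<xi> \<le> Re (- \<i> * cis (sg \<xi> * t) * (indicator {1/4..1/2} \<xi> *\<^sub>R duh V t \<xi>))" for \<xi>
      using low[of \<xi>] by (cases "\<xi> \<in> {1/4..1/2}") auto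
  qed
  finally show ?thesis unfolding V_def .
qed

text \<open>On the support the Sobolev weight is at most \<open>N powr (2 * s)\<close>, which the
  squared amplitude cancels exactly; 2 is the total length of the two frequency intervals.\<close>

lemma packet_Hs_norm:
  assumes s: "s < 0" and N: "1 \<le> N" and u: "has_fourier u (\<lambda>\<xi>. of_real (packet (N powr (-s)) N \<xi>))"
  shows "(Hs_norm s u)\<^sup>2 \<le> 2"
proof -
  let ?w = "\<lambda>\<xi>. (1 + \<xi>\<^sup>2) powr s * (cmod (of_real (packet (N powr (-s)) N \<xi>)))\<^sup>2"
  let ?J = "{N..N+1} \<union> {-(N+1)..-N}"
  have le: "?w \<xi> \<le> indicator ?J \<xi>" for \<xi>
  proof (cases "\<bar>\<xi>\<bar> \<in> {N..N+1}")
    case True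
    then have "N\<^sup>2 \<le> \<bar>\<xi>\<bar>\<^sup>2" using N by (intro power_mono) auto
    then have "(1 + \<xi>\<^sup>2) powr s \<le> (N\<^sup>2) powr s"
      using s N by (intro powr_mono2') auto
    then have "?w \<xi> \<le> (N\<^sup>2) powr s * (N powr (-s))\<^sup>2"
      using True by (simp add: packet_def mult_right_mono)
    also have "\<dots> = 1"
      using N by (simp add: power2_eq_square powr_mult powr_minus field_simps)
    also have "1 = indicator ?J \<xi>"
      using True by (auto simp: indicator_def)
    finally show ?thesis .
  next
    case False
    then show ?thesis by (simp add: packet_def)
  qed
  have J: "emeasure lborel ?J < \<infinity>"
    by (rule order_le_less_trans[OF emeasure_subadditive]) auto
  have "(LINT \<xi>|lborel. ?w \<xi>) \<le> (LINT \<xi>|lborel. indicator ?J \<xi>)"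
  proof (rule integral_mono')
    show "integrable lborel (indicator ?J :: real \<Rightarrow> real)"
      using J by (intro integrable_real_indicator) auto
  qed (use le in auto)
  also have "\<dots> = measure lborel ?J" by simp
  also have "\<dots> \<le> measure lborel {N..N+1} + measure lborel {-(N+1)..-N}"
    by (rule measure_Un_le) auto
  also have "\<dots> = 2" using N by simp
  finally show ?thesis
    unfolding Hs_norm_eq[OF u] by (subst real_sqrt_pow2) (auto intro!: Bochner_Integration.integral_nonneg)
qed

section \<open>Contradiction from packets of large frequency\<close>

theorem mainTheorem5:
  fixes s :: real and X :: "tdist set"
  assumes "s < 0"
    and "X = Hs s \<or> X = Hs_real s"
  shows "\<not> (\<exists>T>0. well_posed_C2 X s T)"
proof
  assume "\<exists>T>0. well_posed_C2 X s T"
  then obtain T \<delta> \<Phi> where T: "0 < T" and \<delta>: "0 < \<delta>"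
    and sol: "\<And>\<phi> u t. \<phi> \<in> X \<Longrightarrow> Hs_norm s \<phi> < \<delta> \<Longrightarrow> is_solution X s T \<phi> u \<Longrightarrow> t \<in> {-T..T} \<Longrightarrow> u t = \<Phi> \<phi> t"
    and C2: "\<And>t. t \<in> {-T..T} \<Longrightarrow> C2_at X (Hs_norm s) (\<lambda>\<phi>. \<Phi> \<phi> t) 0"
    unfolding well_posed_C2_def by blast
  have s: "s \<le> 0" using assms(1) by simp
  have X: "X \<subseteq> Hs s" "Hs_real s \<subseteq> X" "\<And>u c. u \<in> X \<Longrightarrow> c *\<^sub>R u \<in> X"
    using assms(2) Hs_scaleR Hs_real_scaleR by (auto simp: Hs_real_def)
  \<comment> \<open>Within the lifespan, and short enough for the resonant phase to stay below
    1.\<close>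
  define t where "t = min T 1"
  have t: "0 < t" "t \<le> 1" "\<bar>t\<bar> \<le> T" "t \<in> {-T..T}" using T by (auto simp: t_def)
  obtain K where K: "\<And>\<phi> l1 l2 M \<epsilon>0. \<lbrakk>\<phi> \<in> X; 0 < \<epsilon>0;
      \<And>\<epsilon>. \<bar>\<epsilon>\<bar> < \<epsilon>0 \<Longrightarrow> \<bar>lfun t (fhat (\<Phi> (\<epsilon> *\<^sub>R \<phi>) t)) - \<epsilon> * l1 - \<epsilon>\<^sup>2 * l2\<bar> \<le> M * \<bar>\<epsilon>\<bar> ^ 3\<rbrakk>
    \<Longrightarrow> \<bar>l2\<bar> \<le> K * (Hs_norm s \<phi>)\<^sup>2"
    using C2_at_second_order_bound[OF C2[OF t(4)] X(1,3) s] by blast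
  have bound: "t * (N powr (-s))\<^sup>2 / (320 * pi) \<le> \<bar>K\<bar> * 2" if N: "1 \<le> N" for N
  proof -
    define a where "a = N powr (-s)"
    have a: "0 \<le> a" by (simp add: a_def)
    define f where "f = (\<lambda>\<xi>. complex_of_real (packet a N \<xi>))"
    define A where "A = a * (1 + (N + 1)\<^sup>2)"
    have A: "0 \<le> A" using a by (simp add: A_def)
    have f: "f \<in> borel_measurable borel" "\<And>\<xi>. cmod (f \<xi>) \<le> A * wt \<xi>" "\<And>\<xi>. f (- \<xi>) = cnj (f \<xi>)"
      using packet_wt_bound[OF a, of N] N by (simp_all add: f_def A_def) (simp add: packet_def)
    define \<phi> where "\<phi> = tdist_of_fun (inv_fourier f)"
    have fi: "integrable lborel f" using integrable_wt_bound[OF f(1,2)] .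
    have \<phi>f: "has_fourier \<phi> f" unfolding \<phi>_def by (rule has_fourier_inv_fourier[OF fi])
    have \<phi>X: "\<phi> \<in> X" using Hs_real_inv_fourier[OF s f] X(2) by (auto simp: \<phi>_def)
    define l1 l2 where "l1 = lfun t (\<lambda>\<xi>. cis (- (sg \<xi> * t)) * f \<xi>)"
      and "l2 = - lfun t (duh (\<lambda>\<tau> \<xi>. cis (- (sg \<xi> * \<tau>)) * f \<xi>) t)"
    \<comment> \<open>The first entry gives the smallness needed by the Picard iteration on all of
      \<open>[-T, T]\<close>, the second keeps the norm of the datum below \<open>\<delta>\<close>.
      The added ones keep the denominators positive.\<close>
    define \<epsilon>0 where "\<epsilon>0 = min (1 / (8 * (A + 1) * T)) (\<delta> / (Hs_norm s \<phi> + 1))"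
    have n: "0 \<le> Hs_norm s \<phi>" by (rule Hs_norm_nonneg)
    have \<epsilon>0: "0 < \<epsilon>0" using A T \<delta> n by (simp add: \<epsilon>0_def)
    have exp: "\<bar>lfun t (fhat (\<Phi> (\<epsilon> *\<^sub>R \<phi>) t)) - \<epsilon> * l1 - \<epsilon>\<^sup>2 * l2\<bar> \<le> (12 * T\<^sup>2 * A ^ 3 * pi) * \<bar>\<epsilon>\<bar> ^ 3"
      if \<epsilon>: "\<bar>\<epsilon>\<bar> < \<epsilon>0" for \<epsilon>
    proof -
      let ?f = "\<lambda>\<xi>. \<epsilon> *\<^sub>R f \<xi>"
      have less_mult: "\<bar>\<epsilon>\<bar> * d < c" if "\<bar>\<epsilon>\<bar> < c / d" "0 < d" for c d
        using that by (simp add: pos_less_divide_eq)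
      have "\<bar>\<epsilon>\<bar> < 1 / (8 * (A + 1) * T)" "\<bar>\<epsilon>\<bar> < \<delta> / (Hs_norm s \<phi> + 1)"
        using \<epsilon> unfolding \<epsilon>0_def min_less_iff_conj by blast+
      then have e1: "\<bar>\<epsilon>\<bar> * (8 * (A + 1) * T) < 1" and e2: "\<bar>\<epsilon>\<bar> * (Hs_norm s \<phi> + 1) < \<delta>"
        using A T n by (auto intro!: less_mult)
      have f': "?f \<in> borel_measurable borel" "\<And>\<xi>. cmod (?f \<xi>) \<le> (\<bar>\<epsilon>\<bar> * A) * wt \<xi>" "\<And>\<xi>. ?f (- \<xi>) = cnj (?f \<xi>)"
        using f by (auto simp: mult.assoc intro!: mult_left_mono)
      have "8 * (\<bar>\<epsilon>\<bar> * A) * T \<le> \<bar>\<epsilon>\<bar> * (8 * (A + 1) * T)"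
        using T by (simp add: algebra_simps)
      with e1 have small: "8 * (\<bar>\<epsilon>\<bar> * A) * T \<le> 1" by linarith
      obtain U where U: "wbounded T (2 * (\<bar>\<epsilon>\<bar> * A)) U"
        "\<And>t \<xi>. \<bar>t\<bar> \<le> T \<Longrightarrow> U t \<xi> = cis (- (sg \<xi> * t)) * ?f \<xi> - duh U t \<xi>"
        "\<And>t \<xi>. \<bar>t\<bar> \<le> T \<Longrightarrow> U t (- \<xi>) = cnj (U t \<xi>)"
        using picard_solution[OF f' _ small] T by (metis less_imp_le)
      have "has_fourier (tdist_of_fun (inv_fourier ?f)) ?f"
        using fi by (intro has_fourier_inv_fourier) auto
      then have \<phi>\<epsilon>: "tdist_of_fun (inv_fourier ?f) = \<epsilon> *\<^sub>R \<phi>"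
        using has_fourier_scaleR[OF \<phi>f] by (rule has_fourier_inject)
      have "Hs_norm s (\<epsilon> *\<^sub>R \<phi>) < \<delta>"
        using e2 unfolding Hs_norm_scaleR[OF \<phi>f] by (simp add: distrib_left)
      moreover have "is_solution X s T (\<epsilon> *\<^sub>R \<phi>) (\<lambda>t. tdist_of_fun (inv_fourier (U t)))"
        using is_solution_of_duh[OF f'(1,2) U assms(1) X(2)] unfolding \<phi>\<epsilon> .
      \<comment> \<open>Uniqueness is what ties the abstract flow to the constructed solution; from
        here on its values are explicit.\<close>
      ultimately have "\<Phi> (\<epsilon> *\<^sub>R \<phi>) t = tdist_of_fun (inv_fourier (U t))"
        using sol[OF X(3)[OF \<phi>X] _ _ t(4)] by metis
      moreover have "has_fourier (tdist_of_fun (inv_fourier (U t))) (U t)"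
        using wboundedD(2,3)[OF U(1)] t(3) by (intro has_fourier_inv_fourier integrable_wt_bound)
      ultimately have "lfun t (fhat (\<Phi> (\<epsilon> *\<^sub>R \<phi>) t)) = lfun t (U t)"
        using lfun_fhat by simp
      then show ?thesis
        using flow_expansion[OF f(1,2) U(1,2) t(3)] by (simp only: l1_def l2_def)
    qed
    have "t * a\<^sup>2 / (320 * pi) \<le> - l2"
      using packet_quadratic_lower_bound[OF a N _ t(2)] t(1) by (simp add: l2_def f_def)
    also have "\<dots> \<le> K * (Hs_norm s \<phi>)\<^sup>2"
      using K[OF \<phi>X \<epsilon>0 exp] by linarith
    also have "\<dots> \<le> \<bar>K\<bar> * 2"
      using packet_Hs_norm[OF assms(1) N, of \<phi>] \<phi>f by (intro mult_mono) (auto simp: f_def a_def)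
    finally show ?thesis by (simp add: a_def)
  qed
  \<comment> \<open>Chosen so that \<open>t * R\<close> exceeds
    \<open>640 * pi * \<bar>K\<bar>\<close>, the bound that \<open>t * R\<^sup>2\<close> would have
    to satisfy, by exactly \<open>t\<close>. Since \<open>s < 0\<close>, some frequency
    \<open>N\<close> has packet amplitude exactly \<open>R\<close>.\<close>
  define R where "R = \<bar>K\<bar> * 640 * pi / t + 1"
  have R: "1 \<le> R" using t by (simp add: R_def)
  define N where "N = R powr (1 / (-s))"
  have N: "1 \<le> N" using R assms(1) by (simp add: N_def ge_one_powr_ge_zero)
  have "N powr (-s) = R"
    using R assms(1) by (simp add: N_def powr_powr)
  then have "t * R\<^sup>2 / (320 * pi) \<le> \<bar>K\<bar> * 2"
    using bound[OF N] by simp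
  then have "t * R\<^sup>2 \<le> \<bar>K\<bar> * 640 * pi"
    by (simp add: field_simps)
  moreover have "t * R \<le> t * R\<^sup>2"
    using R t by (intro mult_left_mono) (auto simp: power2_eq_square)
  moreover have "t * R = \<bar>K\<bar> * 640 * pi + t"
    using t by (simp add: R_def field_simps)
  ultimately show False using t by linarith
qed

end
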